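(* Let $q\ne0$ be real, $\mathcal H_{\mathbb R}$ a real Hilbert space, $\alpha\in S_0(n)$, $\beta\in S_0(k)$, $F\in\mathcal H_{\mathbb R}^{\odot n}$, $G\in\mathcal H_{\mathbb R}^{\odot k}$. Then in $\mathcal{TP}(\mathcal H_{\mathbb R})$ $$W(\alpha\otimes_sF)\,W(\beta\otimes_sG)=W\big((\alpha\cup\beta)\otimes_s(F\otimes G)\big)+\sum_{\ell=1}^{\min(n,k)}\frac1{\ell!}W\big(\mathcal L^{(\ell)}_{n,k}((\alpha\cup\beta)\otimes(F\otimes G))\big)=\sum_{\pi\in\mathcal P_{1,2}(n,k)}W\big(C_\pi(\alpha\cup\beta)\otimes_sC_\pi(F\otimes G)\big).$$
   Context: Permutations. $[n]=\{1,\dots,n\}$, $[0,n]=\{0,\dots,n\}$; $S(n)$, $S_0(n)$ are the permutation groups of $[n]$, $[0,n]$, with $S(n)\subset S_0(n)$ the permutations fixing $0$; products are composed right to left; for $m>n$, $S_0(n)\subset S_0(m)$ by fixing $n+1,\dots,m$. $\mathrm{cyc}_0(\alpha)$ is the number of cycles of $\alpha\in S_0(n)$ (fixed points are cycles) not containing $0$. For $\alpha\in S_0(n)$, $\beta\in S_0(k)$, $\alpha\cup\beta=\beta'\alpha\in S_0(n+k)$, where $\beta'$ fixes $[n]$ and is obtained from $\beta$ by replacing each $j\in[k]$ by $n+j$ ($0$ unchanged). Contractions. $\mathcal P_{1,2}(n)$ is the set of partitions $\pi$ of $[n]$ into blocks of size 1 and 2, identified with the involution swapping the elements of each pair; $|\pi|$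 is the number of pairs, $\mathrm{supp}(\pi)$ the union of the pairs. $\mathcal P_{1,2}(n,k)$ is the set of $\pi\in\mathcal P_{1,2}(n+k)$ such that every pair $\{i<j\}$ of $\pi$ satisfies $i\le n<j$. For $S\subset[n]$, $\alpha|_{S^c}$ is the permutation of $[0,n]\setminus S$, $x\mapsto\alpha^m(x)$, $m=\min\{j>0:\alpha^j(x)\notin S\}$. For $\ell=|\pi|$, $$C_\pi(\alpha)=q^{\mathrm{cyc}_0((\pi\alpha)|_{\mathrm{supp}(\pi)^c})-\mathrm{cyc}_0(\pi\alpha)+\ell}\;P\big((\pi\alpha)|_{\mathrm{supp}(\pi)^c}\big)\in\mathbb C[S_0(n-2\ell)],$$ where $P$ relabels $[0,n]\setminus\mathrm{supp}(\pi)$ by $[0,n-2\ell]$ in the order-preserving way; extend linearly. On tensors, $C_\pi(h_1\otimes\dots\otimes h_n)=\prod_{\{i,j\}\text{ pair of }\pi}\langle h_i,h_j\rangle\ h_{u_1}\otimes\dots\otimes h_{u_{n-2\ell}}$, with $u_1<\dots<u_{n-2\ell}$ the singletons of $\pi$. $C_\pi(\alpha\otimes F)=C_\pi(\alpha)\otimes C_\pi(F)$. $\mathcal L^{(\ell)}_{n,k}=\ell!\sum_{\pi\in\mathcal P_{1,2}(n,k),|\pi|=\ell}C_\pi$. Algebra. $\mathcal H_{\mathbb R}^{\odot n}$ is the algebraic tensor power. For $\sigma\in S(n)$, $U_\sigma(h_1\otimes\dots\otimes h_n)=h_{\sigma^{-1}(1)}\otimes\dots\otimes h_{\sigma^{-1}(n)}$,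 and $\alpha\otimes_sF=\frac1{n!}\sum_{\sigma\in S(n)}\sigma\alpha\sigma^{-1}\otimes U_\sigma F$. As a complex vector space $\mathcal{TP}(\mathcal H_{\mathbb R})=\bigoplus_{n\ge0}\mathbb C[S_0(n)]\otimes_s\mathcal H_{\mathbb R}^{\odot n}$ (the span of all $\alpha\otimes_sF$, equivalently the quotient identifying $\alpha\otimes F$ with $\sigma\alpha\sigma^{-1}\otimes U_\sigma F$; $W(\alpha\otimes F)$ means $W(\alpha\otimes_s F)$); the element corresponding to $\xi$ is written $W(\xi)$. $T(\eta\otimes F)=\sum_{\pi\in\mathcal P_{1,2}(n)}W(C_\pi(\eta\otimes F))$ (well defined on the symmetrized space; the $T$'s also span). Multiplication on $\mathcal{TP}(\mathcal H_{\mathbb R})$ is defined bilinearly by $T(\alpha\otimes_sF)T(\beta\otimes_sG)=T((\alpha\cup\beta)\otimes_s(F\otimes G))$. *)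

theory Defs
  imports
    "HOL-Analysis.Inner_Product"
    "HOL-Library.Poly_Mapping"
    "HOL-Library.Disjoint_Sets"
    "HOL-Combinatorics.Permutations"
    "HOL-Combinatorics.Orbits"
begin

section \<open>Complex vector spaces\<close>

class scaleC =
  fixes scaleC :: "complex \<Rightarrow> 'a \<Rightarrow> 'a"  (infixr \<open>*\<^sub>C\<close> 75)

class complex_vector = scaleC + ab_group_add +
  assumes scaleC_add_right: "a *\<^sub>C (x + y) = a *\<^sub>C x + a *\<^sub>C y"
    and scaleC_add_left: "(a + b) *\<^sub>C x = a *\<^sub>C x + b *\<^sub>C x"
    and scaleC_scaleC: "a *\<^sub>C b *\<^sub>C x = (a * b) *\<^sub>C x"
    and scaleC_one: "1 *\<^sub>C x = x"

global_interpretation cv: vector_space "scaleC :: complex \<Rightarrow> 'a \<Rightarrow> 'a::complex_vector"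
  by standard (rule scaleC_add_right scaleC_add_left scaleC_scaleC scaleC_one)+

global_interpretation rv:
  vector_space "\<lambda>r x. complex_of_real r *\<^sub>C (x :: 'a::complex_vector)"
  by standard (simp_all add: scaleC_add_right scaleC_add_left scaleC_scaleC scaleC_one)

abbreviation clinear :: "('a::complex_vector \<Rightarrow> 'b::complex_vector) \<Rightarrow> bool" where
  "clinear \<equiv> Vector_Spaces.linear scaleC scaleC"

lemma clinearI:
  "(\<And>x y. f (x + y) = f x + f y) \<Longrightarrow> (\<And>c x. f (c *\<^sub>C x) = c *\<^sub>C f x) \<Longrightarrow> clinear f"
  by unfold_locales

instantiation complex :: complex_vector
begin
definition scaleC_complex :: "complex \<Rightarrow> complex \<Rightarrow> complex" where
  "scaleC_complex = (*)"
instance by standard (simp_all add: scaleC_complex_def algebra_simps)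
end

instantiation poly_mapping :: (type, complex_vector) complex_vector
begin
definition scaleC_poly_mapping ::
    "complex \<Rightarrow> ('a \<Rightarrow>\<^sub>0 'b) \<Rightarrow> ('a \<Rightarrow>\<^sub>0 'b)" where
  "scaleC_poly_mapping c p = Poly_Mapping.map (scaleC c) p"

lemma lookup_scaleC [simp]:
  "Poly_Mapping.lookup (c *\<^sub>C p :: 'a \<Rightarrow>\<^sub>0 'b) k = c *\<^sub>C Poly_Mapping.lookup p k"
  by (cases "Poly_Mapping.lookup p k = 0") (simp_all add: scaleC_poly_mapping_def map.rep_eq)

instance
  by standard
    (auto intro!: poly_mapping_eqI
      simp: lookup_add scaleC_add_right scaleC_add_left scaleC_scaleC scaleC_one)
end

definition lin_ext :: "('k \<Rightarrow> 'b::complex_vector) \<Rightarrow> ('k \<Rightarrow>\<^sub>0 complex) \<Rightarrow> 'b" where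
  "lin_ext f p = (\<Sum>k\<in>Poly_Mapping.keys p. Poly_Mapping.lookup p k *\<^sub>C f k)"

lemma lin_ext_superset:
  assumes "finite A" "Poly_Mapping.keys p \<subseteq> A"
  shows "lin_ext f p = (\<Sum>k\<in>A. Poly_Mapping.lookup p k *\<^sub>C f k)"
  unfolding lin_ext_def using assms
  by (intro sum.mono_neutral_left) (auto simp: in_keys_iff)

lemma lin_ext_single [simp]: "lin_ext f (Poly_Mapping.single k c) = c *\<^sub>C f k"
  by (subst lin_ext_superset[of "{k}"]) auto

lemma lin_ext_linear: "clinear (lin_ext f)"
proof (rule clinearI)
  fix p q :: "'a \<Rightarrow>\<^sub>0 complex" and c
  let ?A = "Poly_Mapping.keys p \<union> Poly_Mapping.keys q"
  show "lin_ext f (p + q) = lin_ext f p + lin_ext f q"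
    by (subst (1 2 3) lin_ext_superset[of ?A])
      (auto simp: lookup_add scaleC_add_left sum.distrib dest: set_mp[OF Poly_Mapping.keys_add])
  show "lin_ext f (c *\<^sub>C p) = c *\<^sub>C lin_ext f p"
    by (subst (1 2) lin_ext_superset[of "Poly_Mapping.keys p"])
      (auto simp: in_keys_iff cv.scale_sum_right scaleC_scaleC scaleC_complex_def)
qed

section \<open>Algebraic tensor powers\<close>

text \<open>
  The type \<open>'a tensor\<close> is the complexification of the algebraic tensor algebra of the real
  vector space \<open>'a\<close>: formal complex combinations of words, modulo the complex span of the
  relations of real multilinearity. The real tensor power of degree \<open>n\<close> is the real span
  \<open>tpow n\<close> of the pure tensors of length \<open>n\<close> in it.
\<close>

definition multilinear_relations :: "('a::real_vector list \<Rightarrow>\<^sub>0 complex) set" where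
  "multilinear_relations =
     {Poly_Mapping.single (us @ (a + b) # vs) 1
        - Poly_Mapping.single (us @ a # vs) 1
        - Poly_Mapping.single (us @ b # vs) 1 | us a b vs. True} \<union>
     {Poly_Mapping.single (us @ (r *\<^sub>R a) # vs) 1
        - complex_of_real r *\<^sub>C Poly_Mapping.single (us @ a # vs) 1 | us r a vs. True}"

quotient_type (overloaded) 'a tensor = "'a::real_vector list \<Rightarrow>\<^sub>0 complex" /
  "\<lambda>p q. p - q \<in> cv.span (multilinear_relations :: ('a list \<Rightarrow>\<^sub>0 complex) set)"
proof (rule equivpI)
  let ?N = "cv.span (multilinear_relations :: ('a list \<Rightarrow>\<^sub>0 complex) set)"
  show "reflp (\<lambda>p q. p - q \<in> ?N)"
    by (rule reflpI) (simp add: cv.span_zero)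
  show "symp (\<lambda>p q. p - q \<in> ?N)"
  proof (rule sympI)
    fix p q assume "p - q \<in> ?N"
    from cv.span_neg[OF this] show "q - p \<in> ?N" by simp
  qed
  show "transp (\<lambda>p q. p - q \<in> ?N)"
  proof (rule transpI)
    fix p q r assume "p - q \<in> ?N" "q - r \<in> ?N"
    from cv.span_add[OF this] show "p - r \<in> ?N" by simp
  qed
qed

instantiation tensor :: (real_vector) complex_vector
begin

lift_definition zero_tensor :: "'a tensor" is 0 .

lift_definition plus_tensor :: "'a tensor \<Rightarrow> 'a tensor \<Rightarrow> 'a tensor" is "(+)"
  subgoal premises prems for p p' q q'
    using cv.span_add[OF prems] by (simp add: add_diff_add)
  done

lift_definition minus_tensor :: "'a tensor \<Rightarrow> 'a tensor \<Rightarrow> 'a tensor" is "(-)"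
  subgoal premises prems for p p' q q'
    using cv.span_diff[OF prems] by (simp add: algebra_simps)
  done

lift_definition uminus_tensor :: "'a tensor \<Rightarrow> 'a tensor" is uminus
  subgoal premises prems for p p'
    using cv.span_neg[OF prems] by (simp add: algebra_simps)
  done

lift_definition scaleC_tensor :: "complex \<Rightarrow> 'a tensor \<Rightarrow> 'a tensor" is scaleC
  subgoal premises prems for c p p'
    using cv.span_scale[OF prems, of c] by (simp add: cv.scale_right_diff_distrib)
  done

instance
  by standard
    (transfer, simp add: algebra_simps cv.span_zero scaleC_add_right scaleC_add_left
      scaleC_scaleC scaleC_one)+

end

lift_definition pure_tensor :: "'a::real_vector list \<Rightarrow> 'a tensor" is
  "\<lambda>hs. Poly_Mapping.single hs 1" .

definition tpow :: "nat \<Rightarrow> 'a::real_vector tensor set" where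
  "tpow n = rv.span {pure_tensor hs | hs. length hs = n}"

definition multilinear :: "('a::real_vector list \<Rightarrow> 'b::complex_vector) \<Rightarrow> bool" where
  "multilinear f \<longleftrightarrow>
     (\<forall>us a b vs. f (us @ (a + b) # vs) = f (us @ a # vs) + f (us @ b # vs)) \<and>
     (\<forall>us r a vs. f (us @ (r *\<^sub>R a) # vs) = complex_of_real r *\<^sub>C f (us @ a # vs))"

text \<open>
  The linear map on tensors induced by a multilinear map on words: it is computed from an
  arbitrary representative, the choice being immaterial for multilinear \<open>f\<close>.
\<close>

definition tensor_lift ::
    "('a::real_vector list \<Rightarrow> 'b::complex_vector) \<Rightarrow> 'a tensor \<Rightarrow> 'b" where
  "tensor_lift f F = lin_ext f (rep_tensor F)"

lemma lin_ext_relations: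
  assumes "multilinear f" "p \<in> cv.span multilinear_relations"
  shows "lin_ext f p = 0"
proof -
  interpret L: Vector_Spaces.linear scaleC scaleC "lin_ext f" by (rule lin_ext_linear)
  show ?thesis
    using assms(2)
  proof (induction rule: cv.span_induct)
    case base
    show ?case by (auto simp: cv.subspace_def L.add L.scale)
  next
    case (step x)
    then show ?case
      using assms(1)
      by (auto simp: multilinear_relations_def multilinear_def L.diff L.scale scaleC_one)
  qed
qed

lemma tensor_lift_abs:
  assumes "multilinear f"
  shows "tensor_lift f (abs_tensor p) = lin_ext f p"
proof -
  interpret L: Vector_Spaces.linear scaleC scaleC "lin_ext f" by (rule lin_ext_linear)
  have "rep_tensor (abs_tensor p) - p \<in> cv.span multilinear_relations"
    using Quotient3_rep_abs[OF Quotient3_tensor, of p] by (simp add: cv.span_zero)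
  from lin_ext_relations[OF assms this] show ?thesis
    by (simp add: tensor_lift_def L.diff)
qed

lemma tensor_lift_pure:
  "multilinear f \<Longrightarrow> tensor_lift f (pure_tensor hs) = f hs"
  by (simp add: pure_tensor.abs_eq tensor_lift_abs scaleC_one)

lemma tensor_lift_linear:
  assumes "multilinear f"
  shows "clinear (tensor_lift f)"
proof (rule clinearI)
  interpret L: Vector_Spaces.linear scaleC scaleC "lin_ext f" by (rule lin_ext_linear)
  fix x y :: "'a tensor" and c
  show "tensor_lift f (x + y) = tensor_lift f x + tensor_lift f y"
    by (induction x; induction y)
      (simp add: plus_tensor.abs_eq tensor_lift_abs[OF assms] L.add)
  show "tensor_lift f (c *\<^sub>C x) = c *\<^sub>C tensor_lift f x"
    by (induction x) (simp add: scaleC_tensor.abs_eq tensor_lift_abs[OF assms] L.scale)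
qed

lemma multilinear_pure: "multilinear pure_tensor"
  unfolding multilinear_def
proof (intro conjI allI)
  fix us vs :: "'a list" and a b r
  have "Poly_Mapping.single (us @ (a + b) # vs) 1
        - Poly_Mapping.single (us @ a # vs) 1 - Poly_Mapping.single (us @ b # vs) 1
      \<in> cv.span multilinear_relations"
    unfolding multilinear_relations_def by (rule cv.span_base) blast
  then show "pure_tensor (us @ (a + b) # vs) =
      pure_tensor (us @ a # vs) + pure_tensor (us @ b # vs)"
    by (simp add: pure_tensor.abs_eq plus_tensor.abs_eq tensor.abs_eq_iff diff_diff_eq)
  have "Poly_Mapping.single (us @ (r *\<^sub>R a) # vs) 1
        - complex_of_real r *\<^sub>C Poly_Mapping.single (us @ a # vs) 1
      \<in> cv.span multilinear_relations"
    unfolding multilinear_relations_def by (rule cv.span_base) blast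
  then show "pure_tensor (us @ (r *\<^sub>R a) # vs) =
      complex_of_real r *\<^sub>C pure_tensor (us @ a # vs)"
    by (simp add: pure_tensor.abs_eq scaleC_tensor.abs_eq tensor.abs_eq_iff)
qed

definition tensor_mult :: "'a::real_vector tensor \<Rightarrow> 'a tensor \<Rightarrow> 'a tensor"
    (infixr \<open>\<otimes>\<^sub>T\<close> 70) where
  "F \<otimes>\<^sub>T G = tensor_lift (\<lambda>gs. tensor_lift (\<lambda>hs. pure_tensor (hs @ gs)) F) G"

lemma tensor_mult_pure:
  "pure_tensor hs \<otimes>\<^sub>T pure_tensor gs = pure_tensor (hs @ gs)"
proof -
  have L: "multilinear (\<lambda>hs. pure_tensor (hs @ gs))" for gs :: "'a list"
    using multilinear_pure unfolding multilinear_def by auto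
  have R: "multilinear (\<lambda>gs. pure_tensor (hs @ gs))"
    unfolding multilinear_def
  proof (intro conjI allI)
    fix us vs :: "'a list" and a b r
    show "pure_tensor (hs @ us @ (a + b) # vs) =
        pure_tensor (hs @ us @ a # vs) + pure_tensor (hs @ us @ b # vs)"
      using multilinear_pure unfolding multilinear_def append_assoc[symmetric] by blast
    show "pure_tensor (hs @ us @ (r *\<^sub>R a) # vs) =
        complex_of_real r *\<^sub>C pure_tensor (hs @ us @ a # vs)"
      using multilinear_pure unfolding multilinear_def append_assoc[symmetric] by blast
  qed
  show ?thesis
    using R by (simp add: tensor_mult_def tensor_lift_pure[OF L] tensor_lift_pure)
qed

lemma tensor_mult_linear_left: "clinear (\<lambda>F. F \<otimes>\<^sub>T (G :: 'a::real_vector tensor))"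
proof -
  have L: "multilinear (\<lambda>hs. pure_tensor (hs @ gs))" for gs :: "'a list"
    using multilinear_pure unfolding multilinear_def by auto
  interpret L: Vector_Spaces.linear scaleC scaleC "tensor_lift (\<lambda>hs. pure_tensor (hs @ gs))"
    for gs :: "'a list" by (rule tensor_lift_linear[OF L])
  have add: "tensor_lift (\<lambda>k. f k + g k) G = tensor_lift f G + tensor_lift g G"
    for f g :: "'a list \<Rightarrow> 'a tensor"
    by (simp add: tensor_lift_def lin_ext_def scaleC_add_right sum.distrib)
  have scale: "tensor_lift (\<lambda>k. c *\<^sub>C f k) G = c *\<^sub>C tensor_lift f G"
    for c and f :: "'a list \<Rightarrow> 'a tensor"
    by (simp add: tensor_lift_def lin_ext_def cv.scale_sum_right mult.commute)
  show ?thesis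
    by (rule clinearI) (simp_all add: tensor_mult_def L.add L.scale add scale)
qed

section \<open>Permutations\<close>

text \<open>
  A permutation of a subset of the naturals is a function on the naturals that is the
  identity outside the set, so the inclusions between symmetric groups are literal.
\<close>

definition S0 :: "nat \<Rightarrow> (nat \<Rightarrow> nat) set" where
  "S0 n = {\<alpha>. \<alpha> permutes {0..n}}"

definition S1 :: "nat \<Rightarrow> (nat \<Rightarrow> nat) set" where
  "S1 n = {\<sigma>. \<sigma> permutes {1..n}}"

text \<open>The number of cycles not containing \<open>0\<close> of a permutation of \<open>A\<close>.\<close>

definition cyc0 :: "nat set \<Rightarrow> (nat \<Rightarrow> nat) \<Rightarrow> nat" where
  "cyc0 A \<alpha> = card {orbit \<alpha> x | x. x \<in> A \<and> 0 \<notin> orbit \<alpha> x}"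

definition shift_perm :: "nat \<Rightarrow> (nat \<Rightarrow> nat) \<Rightarrow> nat \<Rightarrow> nat" where
  "shift_perm n \<beta> x =
     (if x = 0 \<or> n < x
      then let y = \<beta> (x - n) in if y = 0 then 0 else n + y
      else x)"

definition perm_cup :: "nat \<Rightarrow> (nat \<Rightarrow> nat) \<Rightarrow> (nat \<Rightarrow> nat) \<Rightarrow> (nat \<Rightarrow> nat)" where
  "perm_cup n \<alpha> \<beta> = shift_perm n \<beta> \<circ> \<alpha>"

definition remove_points :: "nat set \<Rightarrow> (nat \<Rightarrow> nat) \<Rightarrow> nat \<Rightarrow> nat" where
  "remove_points X \<alpha> x =
     (if x \<in> X then x else (\<alpha> ^^ (LEAST m. 0 < m \<and> (\<alpha> ^^ m) x \<notin> X)) x)"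

text \<open>
  Transport of a permutation of the finite set \<open>A\<close> to \<open>{..<card A}\<close> along the
  order-preserving bijection.
\<close>

definition relabel :: "nat set \<Rightarrow> (nat \<Rightarrow> nat) \<Rightarrow> nat \<Rightarrow> nat" where
  "relabel A \<gamma> i =
     (if i < card A then card {y \<in> A. y < \<gamma> (sorted_list_of_set A ! i)} else i)"

section \<open>Partitions into singletons and pairs\<close>

definition P12 :: "nat \<Rightarrow> nat set set set" where
  "P12 n = {\<pi>. partition_on {1..n} \<pi> \<and> (\<forall>B\<in>\<pi>. card B = 1 \<or> card B = 2)}"

definition pairs :: "nat set set \<Rightarrow> nat set set" where
  "pairs \<pi> = {B \<in> \<pi>. card B = 2}"

definition supp :: "nat set set \<Rightarrow> nat set" where
  "supp \<pi> = \<Union> (pairs \<pi>)"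

definition involution :: "nat set set \<Rightarrow> nat \<Rightarrow> nat" where
  "involution \<pi> x = (if x \<in> supp \<pi> then (THE y. y \<noteq> x \<and> {x, y} \<in> \<pi>) else x)"

definition P12_bip :: "nat \<Rightarrow> nat \<Rightarrow> nat set set set" where
  "P12_bip n k = {\<pi> \<in> P12 (n + k). \<forall>i j. i < j \<and> {i, j} \<in> \<pi> \<longrightarrow> i \<le> n \<and> n < j}"

section \<open>The group algebra with tensor coefficients\<close>

text \<open>
  An element \<open>a\<close> of the group algebra is a finitely supported complex-valued function of
  permutations, \<open>\<alpha>\<close> itself being \<open>gr \<alpha>\<close>. The (real) tensor product of the group algebra
  of \<open>S0 n\<close> with \<open>tpow n\<close> consists of the finitely supported functions from \<open>S0 n\<close> to the
  complexification of \<open>tpow n\<close>.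
\<close>

type_synonym group_alg = "(nat \<Rightarrow> nat) \<Rightarrow>\<^sub>0 complex"
type_synonym 'a group_tensor = "(nat \<Rightarrow> nat) \<Rightarrow>\<^sub>0 'a tensor"

definition gr :: "(nat \<Rightarrow> nat) \<Rightarrow> group_alg" where
  "gr \<alpha> = Poly_Mapping.single \<alpha> 1"

definition gtens :: "group_alg \<Rightarrow> 'a::real_vector tensor \<Rightarrow> 'a group_tensor"
    (infix \<open>\<otimes>\<^sub>G\<close> 65) where
  "a \<otimes>\<^sub>G F = lin_ext (\<lambda>\<alpha>. Poly_Mapping.single \<alpha> F) a"

subsection \<open>Symmetrization\<close>

text \<open>
  The degree \<open>n\<close> is an explicit argument of the operators below, since a permutation
  fixing all large numbers lies in \<open>S0 n\<close> for many \<open>n\<close>. Words of another length are sent to \<open>0\<close>: this keeps the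
  maps multilinear on all words, so that they descend to \<open>'a tensor\<close>.
\<close>

definition U :: "nat \<Rightarrow> (nat \<Rightarrow> nat) \<Rightarrow> 'a::real_vector tensor \<Rightarrow> 'a tensor" where
  "U n \<sigma> = tensor_lift (\<lambda>hs.
     if length hs = n
     then pure_tensor (map (\<lambda>i. hs ! (inv \<sigma> i - 1)) [1..<Suc n])
     else 0)"

definition symmetrize :: "nat \<Rightarrow> 'a::real_vector group_tensor \<Rightarrow> 'a group_tensor" where
  "symmetrize n \<xi> =
     (1 / fact n) *\<^sub>C (\<Sum>\<sigma>\<in>S1 n. \<Sum>\<alpha>\<in>Poly_Mapping.keys \<xi>.
       Poly_Mapping.single (\<sigma> \<circ> \<alpha> \<circ> inv \<sigma>) (U n \<sigma> (Poly_Mapping.lookup \<xi> \<alpha>)))"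

text \<open>\<open>sym_tens n a F\<close> is the symmetrized tensor product of \<open>a\<close> and \<open>F\<close> in degree \<open>n\<close>.\<close>

definition sym_tens ::
    "nat \<Rightarrow> group_alg \<Rightarrow> 'a::real_vector tensor \<Rightarrow> 'a group_tensor" where
  "sym_tens n a F = symmetrize n (a \<otimes>\<^sub>G F)"

subsection \<open>Contractions\<close>

definition contract_perm :: "real \<Rightarrow> nat \<Rightarrow> nat set set \<Rightarrow> (nat \<Rightarrow> nat) \<Rightarrow> group_alg" where
  "contract_perm q n \<pi> \<alpha> =
     (let A = {0..n} - supp \<pi>;
          \<gamma> = involution \<pi> \<circ> \<alpha>;
          \<delta> = remove_points (supp \<pi>) \<gamma>
      in Poly_Mapping.single (relabel A \<delta>)
           (complex_of_real
             (q powi (int (cyc0 A \<delta>) - int (cyc0 {0..n} \<gamma>) + int (card (pairs \<pi>))))))"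

definition contract_alg :: "real \<Rightarrow> nat \<Rightarrow> nat set set \<Rightarrow> group_alg \<Rightarrow> group_alg" where
  "contract_alg q n \<pi> = lin_ext (contract_perm q n \<pi>)"

definition contract_word :: "nat \<Rightarrow> nat set set \<Rightarrow> 'a::real_inner list \<Rightarrow> 'a tensor" where
  "contract_word n \<pi> hs =
     (if length hs = n
      then complex_of_real (\<Prod>B\<in>pairs \<pi>. inner (hs ! (Min B - 1)) (hs ! (Max B - 1))) *\<^sub>C
             pure_tensor (map (\<lambda>u. hs ! (u - 1)) (sorted_list_of_set ({1..n} - supp \<pi>)))
      else 0)"

definition contract_tensor :: "nat \<Rightarrow> nat set set \<Rightarrow> 'a::real_inner tensor \<Rightarrow> 'a tensor" where
  "contract_tensor n \<pi> = tensor_lift (contract_word n \<pi>)"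

definition contract ::
    "real \<Rightarrow> nat \<Rightarrow> nat set set \<Rightarrow> 'a::real_inner group_tensor \<Rightarrow> 'a group_tensor" where
  "contract q n \<pi> \<xi> =
     (\<Sum>\<alpha>\<in>Poly_Mapping.keys \<xi>.
       contract_alg q n \<pi> (gr \<alpha>) \<otimes>\<^sub>G contract_tensor n \<pi> (Poly_Mapping.lookup \<xi> \<alpha>))"

definition contract_level ::
    "real \<Rightarrow> nat \<Rightarrow> nat \<Rightarrow> nat \<Rightarrow> 'a::real_inner group_tensor \<Rightarrow> 'a group_tensor" where
  "contract_level q n k l \<xi> =
     fact l *\<^sub>C (\<Sum>\<pi> | \<pi> \<in> P12_bip n k \<and> card (pairs \<pi>) = l. contract q (n + k) \<pi> \<xi>)"

subsection \<open>Evaluation on pure tensors\<close>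

lemma multilinear_lookups:
  assumes js: "distinct js" and g: "inj_on g (set js)" and i: "length us \<in> g ` set js"
  shows "pure_tensor (map (\<lambda>j. (us @ (a + b) # vs) ! g j) js) =
           pure_tensor (map (\<lambda>j. (us @ a # vs) ! g j) js) +
           pure_tensor (map (\<lambda>j. (us @ b # vs) ! g j) js)" (is ?A)
    and "pure_tensor (map (\<lambda>j. (us @ (r *\<^sub>R a) # vs) ! g j) js) =
           complex_of_real r *\<^sub>C pure_tensor (map (\<lambda>j. (us @ a # vs) ! g j) js)" (is ?B)
proof -
  obtain j where j: "j \<in> set js" "g j = length us" using i by auto
  obtain xs ys where xy: "js = xs @ j # ys" using split_list[OF j(1)] by blast
  have ne: "g x \<noteq> length us" if "x \<in> set xs \<union> set ys" for x
    using that js g j xy by (auto simp: inj_on_def)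
  have *: "(us @ c # vs) ! m = (us @ a # vs) ! m" if "m \<noteq> length us" for c m
    using that by (auto simp: nth_append nth_Cons')
  have **: "map (\<lambda>j. (us @ c # vs) ! g j) js =
      map (\<lambda>j. (us @ a # vs) ! g j) xs @ c # map (\<lambda>j. (us @ a # vs) ! g j) ys" for c
    unfolding xy using ne j(2) by (auto intro!: *)
  show ?A ?B
    using multilinear_pure unfolding multilinear_def ** by blast+
qed

lemma U_pure:
  fixes hs :: "'a::real_vector list"
  assumes "\<sigma> \<in> S1 n" "length hs = n"
  shows "U n \<sigma> (pure_tensor hs) = pure_tensor (map (\<lambda>i. hs ! (inv \<sigma> i - 1)) [1..<Suc n])"
proof -
  let ?f = "\<lambda>hs :: 'a list. if length hs = n
     then pure_tensor (map (\<lambda>i. hs ! (inv \<sigma> i - 1)) [1..<Suc n]) else 0"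
  have p: "inv \<sigma> permutes {1..n}" using assms by (simp add: S1_def permutes_inv)
  have inj: "inj_on (\<lambda>i. inv \<sigma> i - 1) (set [1..<Suc n])"
  proof (rule inj_onI)
    fix x y assume *: "x \<in> set [1..<Suc n]" "y \<in> set [1..<Suc n]" "inv \<sigma> x - 1 = inv \<sigma> y - 1"
    have "x \<in> {1..n}" "y \<in> {1..n}" using *(1,2) by auto
    then have "inv \<sigma> x \<in> {1..n}" "inv \<sigma> y \<in> {1..n}"
      by (simp_all only: permutes_in_image[OF p])
    then have "1 \<le> inv \<sigma> x" "1 \<le> inv \<sigma> y" by simp_all
    with *(3) have "inv \<sigma> x = inv \<sigma> y" by linarith
    then show "x = y" by (rule injD[OF permutes_inj[OF p]])
  qed
  have im: "l \<in> (\<lambda>i. inv \<sigma> i - 1) ` set [1..<Suc n]" if "l < n" for l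
  proof -
    have "Suc l \<in> inv \<sigma> ` {1..n}" using that permutes_image[OF p] by auto
    then obtain x where "x \<in> {1..n}" "Suc l = inv \<sigma> x" by blast
    then have "l = inv \<sigma> x - 1" by linarith
    moreover have "x \<in> set [1..<Suc n]" using \<open>x \<in> {1..n}\<close> by auto
    ultimately show ?thesis by (rule image_eqI)
  qed
  have "multilinear ?f"
    unfolding multilinear_def
  proof (intro conjI allI)
    fix us vs :: "'a list" and a b r
    have "length us < n" if "length (us @ c # vs) = n" for c :: 'a using that by auto
    note * = multilinear_lookups[OF distinct_upt inj im[OF this]]
    show "?f (us @ (a + b) # vs) = ?f (us @ a # vs) + ?f (us @ b # vs)"
      using *(1) by (simp del: upt_Suc)
    show "?f (us @ (r *\<^sub>R a) # vs) = complex_of_real r *\<^sub>C ?f (us @ a # vs)"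
      using *(2) by (simp del: upt_Suc)
  qed
  from tensor_lift_pure[OF this, of hs] show ?thesis using assms(2) by (simp add: U_def del: upt_Suc)
qed

lemma contract_tensor_pure:
  fixes hs :: "'a::real_inner list"
  assumes "\<pi> \<in> P12 n"
  shows "contract_tensor n \<pi> (pure_tensor hs) = contract_word n \<pi> hs"
proof -
  have part: "partition_on {1..n} \<pi>" using assms by (simp add: P12_def)
  have fin: "finite (pairs \<pi>)"
    using finite_elements[OF _ part] by (simp add: pairs_def)
  let ?js = "sorted_list_of_set ({1..n} - supp \<pi>)"
  let ?c = "\<lambda>hs B. inner (hs ! (Min B - 1)) (hs ! (Max B - 1))"
  let ?w = "\<lambda>hs. pure_tensor (map (\<lambda>u. hs ! (u - 1)) ?js)"
  have B12: "finite B \<and> Min B \<in> B \<and> Max B \<in> B \<and> Min B \<noteq> Max B \<and> B = {Min B, Max B} \<and> 1 \<le> Min B \<and> 1 \<le> Max B"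
    if B: "B \<in> pairs \<pi>" for B
  proof -
    obtain u v where uv: "B = {u, v}" "u \<noteq> v"
      using B unfolding pairs_def card_2_iff by blast
    obtain x y where xy: "B = {x, y}" "x < y"
      using uv by (metis insert_commute linorder_neqE)
    have "B \<subseteq> {1..n}" using B part by (auto simp: pairs_def partition_on_def)
    with xy show ?thesis by auto
  qed
  have other: "?c (us @ a # vs) B = ?c (us @ b # vs) B"
    if "B \<in> pairs \<pi>" "Suc (length us) \<notin> B" for us vs a b B
  proof -
    have ne: "m - 1 \<noteq> length us" if "m \<in> B" for m
    proof -
      have "m \<in> {Min B, Max B}" using B12[OF \<open>B \<in> pairs \<pi>\<close>] \<open>m \<in> B\<close> by blast
      then have "1 \<le> m" using B12[OF \<open>B \<in> pairs \<pi>\<close>] by (elim insertE) simp_all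
      moreover have "m \<noteq> Suc (length us)" using \<open>m \<in> B\<close> \<open>Suc (length us) \<notin> B\<close> by auto
      ultimately show ?thesis by auto
    qed
    have "(us @ a # vs) ! m = (us @ b # vs) ! m" if "m \<noteq> length us" for m
      using that by (auto simp: nth_append nth_Cons')
    then show ?thesis using B12[OF that(1)] ne by metis
  qed
  have hit: "?c (us @ (a + b) # vs) B = ?c (us @ a # vs) B + ?c (us @ b # vs) B"
       "?c (us @ (r *\<^sub>R a) # vs) B = r * ?c (us @ a # vs) B"
    if "B \<in> pairs \<pi>" "Suc (length us) \<in> B" for us vs a b r B
  proof -
    have "Min B - 1 \<noteq> Max B - 1" using B12[OF that(1)] by auto
    moreover have "Min B - 1 = length us \<or> Max B - 1 = length us"
    proof -
      have "Suc (length us) \<in> {Min B, Max B}" using B12[OF that(1)] that(2) by blast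
      then show ?thesis by auto
    qed
    ultimately show
       "?c (us @ (a + b) # vs) B = ?c (us @ a # vs) B + ?c (us @ b # vs) B"
       "?c (us @ (r *\<^sub>R a) # vs) B = r * ?c (us @ a # vs) B"
      by (auto simp: nth_append nth_Cons' inner_add_left inner_add_right)
  qed
  have "contract_word n \<pi> (us @ (a + b) # vs) =
            contract_word n \<pi> (us @ a # vs) + contract_word n \<pi> (us @ b # vs) \<and>
        contract_word n \<pi> (us @ (r *\<^sub>R a) # vs) =
            complex_of_real r *\<^sub>C contract_word n \<pi> (us @ a # vs)"
    for us vs :: "'a list" and a b r
  proof (cases "length (us @ a # vs) = n")
    case False
    then show ?thesis by (simp add: contract_word_def)
  next
    case len: True
    have word: "contract_word n \<pi> (us @ c # vs) =
       complex_of_real (\<Prod>B\<in>pairs \<pi>. ?c (us @ c # vs) B) *\<^sub>C ?w (us @ c # vs)" for c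
      using len by (simp add: contract_word_def)
    show ?thesis
    proof (cases "Suc (length us) \<in> supp \<pi>")
      case True
      then obtain B0 where B0: "B0 \<in> pairs \<pi>" "Suc (length us) \<in> B0"
        by (auto simp: supp_def)
      have uniq: "Suc (length us) \<notin> B" if "B \<in> pairs \<pi> - {B0}" for B
        using that B0 part unfolding pairs_def partition_on_def disjoint_def by blast
      have w: "?w (us @ c # vs) = ?w (us @ a # vs)" for c
      proof -
        have "map (\<lambda>u. (us @ c # vs) ! (u - 1)) ?js = map (\<lambda>u. (us @ a # vs) ! (u - 1)) ?js"
        proof (rule map_cong[OF refl])
          fix u assume "u \<in> set ?js"
          then have "u \<in> {1..n} - supp \<pi>" by simp
          then have "u - 1 \<noteq> length us" using True by (cases u) auto
          then show "(us @ c # vs) ! (u - 1) = (us @ a # vs) ! (u - 1)"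
            by (auto simp: nth_append nth_Cons')
        qed
        then show ?thesis by (rule arg_cong)
      qed
      have pr: "(\<Prod>B\<in>pairs \<pi>. ?c (us @ c # vs) B) =
          ?c (us @ c # vs) B0 * (\<Prod>B\<in>pairs \<pi> - {B0}. ?c (us @ a # vs) B)" for c
      proof -
        have "(\<Prod>B\<in>pairs \<pi> - {B0}. ?c (us @ c # vs) B) = (\<Prod>B\<in>pairs \<pi> - {B0}. ?c (us @ a # vs) B)"
          by (intro prod.cong refl other) (use uniq in auto)
        then show ?thesis by (simp only: prod.remove[OF fin B0(1)])
      qed
      show ?thesis
        unfolding word w[of "a + b"] w[of b] w[of "r *\<^sub>R a"] pr[of "a+b"] pr[of a] pr[of b] pr[of "r *\<^sub>R a"]
          hit[OF B0]
        by (simp add: scaleC_add_left[symmetric] scaleC_scaleC algebra_simps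
            del: cv.scale_left_distrib)
    next
      case False
      have inj: "inj_on (\<lambda>u. u - 1) (set ?js)" by (auto simp: inj_on_def)
      have mem: "length us \<in> (\<lambda>u. u - 1) ` set ?js"
        using False len by (auto simp: image_iff intro!: bexI[of _ "Suc (length us)"])
      have pr: "(\<Prod>B\<in>pairs \<pi>. ?c (us @ c # vs) B) = (\<Prod>B\<in>pairs \<pi>. ?c (us @ a # vs) B)" for c
        by (intro prod.cong refl other) (use False in \<open>auto simp: supp_def\<close>)
      note ml = multilinear_lookups[OF distinct_sorted_list_of_set inj mem]
      show ?thesis
        unfolding word pr[of "a + b"] pr[of b] pr[of "r *\<^sub>R a"] ml
        by (simp add: scaleC_add_right scaleC_scaleC mult.commute)
    qed
  qed
  note word_linear = this
  have "multilinear (contract_word n \<pi> :: 'a list \<Rightarrow> 'a tensor)"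
    unfolding multilinear_def
    by (intro conjI allI)
      (rule word_linear[THEN conjunct1], rule word_linear[THEN conjunct2])
  then show ?thesis by (simp add: contract_tensor_def tensor_lift_pure)
qed

section \<open>The algebra\<close>

typedef (overloaded) 'a TP =
  "cv.span {sym_tens n (gr \<alpha>) F | n \<alpha> F. \<alpha> \<in> S0 n \<and> F \<in> tpow n} ::
     'a::real_vector group_tensor set"
  by (rule exI[of _ 0]) (rule cv.span_zero)

setup_lifting type_definition_TP

instantiation TP :: (real_vector) complex_vector
begin

lift_definition zero_TP :: "'a TP" is 0 by (rule cv.span_zero)
lift_definition plus_TP :: "'a TP \<Rightarrow> 'a TP \<Rightarrow> 'a TP" is "(+)" by (rule cv.span_add)
lift_definition minus_TP :: "'a TP \<Rightarrow> 'a TP \<Rightarrow> 'a TP" is "(-)" by (rule cv.span_diff)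
lift_definition uminus_TP :: "'a TP \<Rightarrow> 'a TP" is uminus by (rule cv.span_neg)
lift_definition scaleC_TP :: "complex \<Rightarrow> 'a TP \<Rightarrow> 'a TP" is scaleC by (rule cv.span_scale)

instance
  by standard
    (transfer, simp add: scaleC_add_right scaleC_add_left scaleC_scaleC scaleC_one algebra_simps)+

end

text \<open>
  \<open>'a TP\<close> is the span of the symmetrized tensors, so the element \<open>W n \<xi>\<close> belonging to a
  not necessarily symmetric \<open>\<xi>\<close> of degree \<open>n\<close> is the class of its symmetrization.
\<close>

definition W :: "nat \<Rightarrow> 'a::real_vector group_tensor \<Rightarrow> 'a TP" where
  "W n \<xi> = Abs_TP (symmetrize n \<xi>)"

definition T :: "real \<Rightarrow> nat \<Rightarrow> 'a::real_inner group_tensor \<Rightarrow> 'a TP" where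
  "T q n \<xi> = (\<Sum>\<pi>\<in>P12 n. W (n - 2 * card (pairs \<pi>)) (contract q n \<pi> \<xi>))"

text \<open>
  The elements \<open>T q n (sym_tens n (gr \<alpha>) F)\<close> span \<open>'a TP\<close>, so a bilinear operation is
  determined by its values on them.
\<close>

definition is_TP_mult :: "real \<Rightarrow> ('a::real_inner TP \<Rightarrow> 'a TP \<Rightarrow> 'a TP) \<Rightarrow> bool" where
  "is_TP_mult q m \<longleftrightarrow>
     (\<forall>y. clinear (\<lambda>x. m x y)) \<and> (\<forall>x. clinear (m x)) \<and>
     (\<forall>n k. \<forall>\<alpha>\<in>S0 n. \<forall>\<beta>\<in>S0 k. \<forall>F\<in>tpow n. \<forall>G\<in>tpow k.
        m (T q n (sym_tens n (gr \<alpha>) F)) (T q k (sym_tens k (gr \<beta>) G)) =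
        T q (n + k) (sym_tens (n + k) (gr (perm_cup n \<alpha> \<beta>)) (F \<otimes>\<^sub>T G)))"

definition TP_mult :: "real \<Rightarrow> 'a::real_inner TP \<Rightarrow> 'a TP \<Rightarrow> 'a TP" where
  "TP_mult q = (THE m. is_TP_mult q m)"

end

theory Submission
  imports Defs
begin

text \<open>
  The multiplication is prescribed on the elements \<open>T\<close>, which are sums of elements \<open>W\<close> over
  all contractions; the claim is that on the elements \<open>W\<close> themselves it is the sum over the
  contractions that join the first factor to the second. The proof takes this formula as the
  definition of a bilinear map \<open>wick_mult\<close> and shows that it multiplies the \<open>T\<close>'s as
  prescribed (\<open>is_TP_mult_wick_mult\<close>). Since \<open>T\<close> of a monomial is \<open>W\<close> of that monomial plus
  terms of lower degree, the \<open>T\<close>'s span (\<open>span_T_elements\<close>), so no other bilinear map does.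

  The product of two \<open>T\<close>'s is computed as follows. A contraction of all \<open>n + k\<close> points is a
  contraction \<open>M\<close> of points of the first factor, a contraction \<open>N\<close> of points of the second, and
  a contraction \<open>K\<close> that joins remaining points of the first to remaining points of the second
  (\<open>bij_betw_split_matchings\<close>). Expanding both \<open>T\<close>'s and multiplying produces exactly the
  triples \<open>(M, N, K)\<close>, and it remains to see that contracting along \<open>M \<union> N \<union> K\<close> at once is the
  same as contracting the factors along \<open>M\<close> and \<open>N\<close> and then their product along \<open>K\<close>
  (\<open>labelled_contraction_split\<close>). For the permutations this says that points may be erased from
  a first return map in stages (\<open>residual_Un\<close>). For the power of \<open>q\<close> it rests on another reading
  of the exponent: erasing a set of points from a permutation destroys precisely the cycles
  contained in that set, so the exponent is the number of pairs minus the number of cycles that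
  lie inside the contracted points, and the latter is additive (\<open>weight_Un\<close>, \<open>card_loops_Un\<close>).

  The relabelling by initial segments, which every contraction involves, is avoided by allowing
  the points of a monomial to be labelled by any finite set of positive numbers. The class
  \<open>W\<close> is invariant under simultaneous conjugation of the permutation and rearrangement of the
  word, so it does not depend on how the labels are enumerated (\<open>W_labelling_unique\<close>); on
  labelled monomials a contraction merely deletes labels. The same invariance shows that
  \<open>wick_mult\<close> may be computed from any representatives of its arguments (\<open>wick_mult_W\<close>).
\<close>

section \<open>First return maps\<close>

lemma permutes_permutation: "\<gamma> permutes A \<Longrightarrow> finite A \<Longrightarrow> permutation \<gamma>"
  unfolding permutation_permutes by blast

text \<open>
  The first return map is defined by a least exponent. Following the path step by step instead
  turns each statement about it into a rule induction.
\<close>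

inductive leads_to :: "'a set \<Rightarrow> ('a \<Rightarrow> 'a) \<Rightarrow> 'a \<Rightarrow> 'a \<Rightarrow> bool" for X \<gamma> where
  stop: "y \<notin> X \<Longrightarrow> leads_to X \<gamma> y y"
| move: "y \<in> X \<Longrightarrow> leads_to X \<gamma> (\<gamma> y) z \<Longrightarrow> leads_to X \<gamma> y z"

lemma leads_to_unique: "leads_to X \<gamma> y z \<Longrightarrow> leads_to X \<gamma> y z' \<Longrightarrow> z = z'"
proof (induction rule: leads_to.induct)
  case (stop y)
  from stop(2,1) show ?case by cases auto
next
  case (move y z)
  from move(4,1) have "leads_to X \<gamma> (\<gamma> y) z'" by cases auto
  with move.IH show ?case .
qed

lemma leads_to_notin: "leads_to X \<gamma> y z \<Longrightarrow> z \<notin> X"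
  by (induction rule: leads_to.induct)

lemma leads_to_trans:
  "leads_to X \<gamma> y z \<Longrightarrow> leads_to (X \<union> Y) \<gamma> z w \<Longrightarrow> leads_to (X \<union> Y) \<gamma> y w"
  by (induction rule: leads_to.induct) (auto intro: leads_to.move)

lemma leads_to_in_orbit:
  "leads_to X \<gamma> y z \<Longrightarrow> y \<in> orbit \<gamma> x \<Longrightarrow> z \<in> orbit \<gamma> x"
  by (induction rule: leads_to.induct) (auto intro: orbit.step)

lemma remove_points_leads_to:
  assumes "permutation \<gamma>" "x \<notin> X"
  shows "leads_to X \<gamma> (\<gamma> x) (remove_points X \<gamma> x)"
proof -
  let ?P = "\<lambda>m. 0 < m \<and> (\<gamma> ^^ m) x \<notin> X"
  define m where "m = (LEAST m. ?P m)"
  have "x \<in> orbit \<gamma> x" by (rule permutation_self_in_orbit[OF assms(1)])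
  then obtain k where "0 < k" "(\<gamma> ^^ k) x = x" unfolding orbit_altdef by auto
  then have "?P k" using assms(2) by simp
  then have m: "?P m" unfolding m_def by (rule LeastI)
  have before: "(\<gamma> ^^ i) x \<in> X" if "0 < i" "i < m" for i
    using not_less_Least[of i ?P] that unfolding m_def by blast
  have "leads_to X \<gamma> ((\<gamma> ^^ (m - d)) x) ((\<gamma> ^^ m) x)" if "d < m" for d
    using that
  proof (induction d)
    case 0
    then show ?case using m by (auto intro: leads_to.stop)
  next
    case (Suc d)
    have "\<gamma> ((\<gamma> ^^ (m - Suc d)) x) = (\<gamma> ^^ (Suc (m - Suc d))) x" by simp
    also have "Suc (m - Suc d) = m - d" using Suc.prems by simp
    finally have "leads_to X \<gamma> (\<gamma> ((\<gamma> ^^ (m - Suc d)) x)) ((\<gamma> ^^ m) x)"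
      using Suc.IH Suc.prems by simp
    moreover have "(\<gamma> ^^ (m - Suc d)) x \<in> X" using Suc.prems by (intro before) simp_all
    ultimately show ?case using leads_to.move by metis
  qed
  from this[of "m - 1"] m have "leads_to X \<gamma> (\<gamma> x) ((\<gamma> ^^ m) x)" by simp
  then show ?thesis using assms(2) by (simp add: remove_points_def m_def)
qed

lemma remove_points_eqI:
  assumes "permutation \<gamma>" "x \<notin> X" "leads_to X \<gamma> (\<gamma> x) z"
  shows "remove_points X \<gamma> x = z"
  using remove_points_leads_to[OF assms(1,2)] assms(3) by (rule leads_to_unique)

lemma remove_points_in: "x \<in> X \<Longrightarrow> remove_points X \<gamma> x = x"
  by (simp add: remove_points_def)

text \<open>
  A \<open>\<gamma>\<close>-path that starts outside \<open>X\<close> consists of steps of the first return map with passages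
  through \<open>X\<close> in between.
\<close>

lemma orbit_remove_points:
  assumes "permutation \<gamma>" "x \<notin> X"
  shows "orbit (remove_points X \<gamma>) x = orbit \<gamma> x - X"
proof (intro equalityI subsetI)
  let ?R = "remove_points X \<gamma>"
  have self: "x \<in> orbit \<gamma> x" by (rule permutation_self_in_orbit[OF assms(1)])
  fix y assume "y \<in> orbit ?R x"
  then show "y \<in> orbit \<gamma> x - X"
  proof induction
    case base
    show ?case using remove_points_leads_to[OF assms]
      by (auto intro: leads_to_in_orbit orbit.base dest: leads_to_notin)
  next
    case (step y)
    then have "leads_to X \<gamma> (\<gamma> y) (?R y)" using remove_points_leads_to[OF assms(1)] by auto
    then show ?case using step by (auto intro: leads_to_in_orbit orbit.step dest: leads_to_notin)
  qed
next
  let ?R = "remove_points X \<gamma>"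
  fix y assume y: "y \<in> orbit \<gamma> x - X"
  have "z \<in> orbit ?R x" if "y \<in> orbit \<gamma> x" "leads_to X \<gamma> y z" for y z
    using that
  proof (induction arbitrary: z)
    case base
    then show ?case using remove_points_eqI[OF assms] orbit.base[of ?R x] by simp
  next
    case (step y)
    show ?case
    proof (cases "y \<in> X")
      case True
      with step show ?thesis by (blast intro: leads_to.move)
    next
      case False
      then have "y \<in> orbit ?R x" using step.IH by (blast intro: leads_to.stop)
      moreover have "z = ?R y" using remove_points_eqI[OF assms(1) False step.prems] by simp
      ultimately show ?thesis by (simp add: orbit.step)
    qed
  qed
  then show "y \<in> orbit ?R x" using y by (blast intro: leads_to.stop)
qed

lemma remove_points_permutes:
  assumes "\<gamma> permutes A" "finite A"
  shows "remove_points X \<gamma> permutes (A - X)"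
proof -
  let ?R = "remove_points X \<gamma>"
  have perm: "permutation \<gamma>" using permutes_permutation[OF assms(1,2)] .
  have orb: "orbit ?R y \<subseteq> A - X" if "y \<in> A - X" for y
    using that permutes_orbit_subset[OF assms(1), of y] orbit_remove_points[OF perm, of y X] by auto
  have "?R ` (A - X) = A - X"
  proof (intro equalityI subsetI)
    fix y assume "y \<in> ?R ` (A - X)"
    then show "y \<in> A - X" using orb orbit.base[of ?R] by blast
  next
    fix y assume y: "y \<in> A - X"
    then have "y \<in> orbit ?R y"
      using orbit_remove_points[OF perm, of y X] permutation_self_in_orbit[OF perm, of y] by auto
    then show "y \<in> ?R ` (A - X)" using y orb[OF y] by cases auto
  qed
  then have "bij_betw ?R (A - X) (A - X)"
    using assms(2) by (simp add: bij_betw_def eq_card_imp_inj_on)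
  moreover have "?R x = x" if "x \<notin> A - X" for x
  proof (cases "x \<in> X")
    case False
    then have "\<gamma> x = x" using that assms(1) by (simp add: permutes_not_in)
    then show ?thesis using False by (intro remove_points_eqI perm) (simp_all add: leads_to.stop)
  qed (simp add: remove_points_in)
  ultimately show ?thesis by (rule bij_imp_permutes)
qed

text \<open>
  Points may be erased in stages: a path of the first return map outside \<open>X\<close> is a path of \<open>\<gamma>\<close>
  from which only points of \<open>X\<close> are omitted.
\<close>

lemma remove_points_Un:
  assumes "\<gamma> permutes A" "finite A" "X \<inter> Y = {}"
  shows "remove_points (X \<union> Y) \<gamma> = remove_points Y (remove_points X \<gamma>)"
proof
  let ?R = "remove_points X \<gamma>"
  have perm: "permutation \<gamma>" "permutation ?R"
    by (rule permutes_permutation[OF assms(1,2)],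
        rule permutes_permutation[OF remove_points_permutes[OF assms(1,2)] finite_Diff[OF assms(2)]])
  have *: "leads_to (X \<union> Y) \<gamma> y z" if "leads_to Y ?R y z" "y \<notin> X" for y z
    using that
  proof induction
    case (stop y)
    then show ?case by (intro leads_to.stop) simp
  next
    case (move y z)
    have l: "leads_to X \<gamma> (\<gamma> y) (?R y)" using remove_points_leads_to[OF perm(1) move.prems] .
    have "leads_to (X \<union> Y) \<gamma> (?R y) z" by (rule move.IH[OF leads_to_notin[OF l]])
    with l have "leads_to (X \<union> Y) \<gamma> (\<gamma> y) z" by (rule leads_to_trans)
    then show ?case using leads_to.move[of y "X \<union> Y" \<gamma> z] move.hyps(1) by simp
  qed
  fix x
  show "remove_points (X \<union> Y) \<gamma> x = remove_points Y ?R x"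
  proof (cases "x \<in> X \<union> Y")
    case True
    have "?R x = x" if "x \<in> X" using that by (rule remove_points_in)
    moreover have "remove_points Y ?R x = x" if "x \<notin> Y" "?R x = x"
      using that by (intro remove_points_eqI perm) (simp_all add: leads_to.stop)
    ultimately have "remove_points Y ?R x = x"
      using True remove_points_in[of x Y] by blast
    then show ?thesis using True by (simp add: remove_points_in)
  next
    case False
    then have l: "leads_to X \<gamma> (\<gamma> x) (?R x)" using remove_points_leads_to[OF perm(1)] by auto
    have "leads_to Y ?R (?R x) (remove_points Y ?R x)" using False remove_points_leads_to[OF perm(2)] by auto
    then have "leads_to (X \<union> Y) \<gamma> (?R x) (remove_points Y ?R x)" using * leads_to_notin[OF l] by simp
    with l have "leads_to (X \<union> Y) \<gamma> (\<gamma> x) (remove_points Y ?R x)" by (rule leads_to_trans)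
    then show ?thesis using False by (intro remove_points_eqI perm)
  qed
qed

text \<open>
  A permutation that moves no erased point acts only when the path has left \<open>X\<close>, so it can be
  applied after the erasure. In use, \<open>\<delta>\<close> is the involution of a second contraction or a
  permutation of the other factor. The next lemma is the mirror image for the first step.
\<close>

lemma remove_points_comp_left:
  assumes "permutation \<gamma>" "permutation \<delta>" "\<And>x. x \<in> X \<Longrightarrow> \<delta> x = x"
  shows "remove_points X (\<delta> \<circ> \<gamma>) = \<delta> \<circ> remove_points X \<gamma>"
proof
  fix x
  have inj: "inj \<delta>" using bij_is_inj[OF permutation_bijective[OF assms(2)]] .
  have notin: "\<delta> y \<notin> X" if "y \<notin> X" for y
    using that assms(3) injD[OF inj, of "\<delta> y" y] by force
  have leads: "leads_to X (\<delta> \<circ> \<gamma>) (\<delta> y) (\<delta> z)" if "leads_to X \<gamma> y z" for y z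
    using that
  proof induction
    case (stop y)
    then show ?case by (intro leads_to.stop notin)
  next
    case (move y z)
    then show ?case using leads_to.move[of y X "\<delta> \<circ> \<gamma>"] by (simp add: assms(3) o_def)
  qed
  show "remove_points X (\<delta> \<circ> \<gamma>) x = (\<delta> \<circ> remove_points X \<gamma>) x"
  proof (cases "x \<in> X")
    case True
    then show ?thesis by (simp add: remove_points_in assms(3))
  next
    case False
    from leads[OF remove_points_leads_to[OF assms(1) False]]
    show ?thesis using False assms(1,2) by (simp add: remove_points_eqI permutation_compose)
  qed
qed

lemma remove_points_comp_right:
  assumes "permutation \<gamma>" "permutation \<delta>" "\<And>x. x \<in> X \<Longrightarrow> \<delta> x = x"
  shows "remove_points X (\<gamma> \<circ> \<delta>) = remove_points X \<gamma> \<circ> \<delta>"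
proof
  fix x
  have inj: "inj \<delta>" using bij_is_inj[OF permutation_bijective[OF assms(2)]] .
  have leads: "leads_to X (\<gamma> \<circ> \<delta>) y z" if "leads_to X \<gamma> y z" for y z
    using that
  proof induction
    case (stop y)
    then show ?case by (intro leads_to.stop)
  next
    case (move y z)
    then show ?case using leads_to.move[of y X "\<gamma> \<circ> \<delta>"] by (simp add: assms(3) o_def)
  qed
  show "remove_points X (\<gamma> \<circ> \<delta>) x = (remove_points X \<gamma> \<circ> \<delta>) x"
  proof (cases "x \<in> X")
    case True
    then show ?thesis by (simp add: remove_points_in assms(3))
  next
    case False
    then have "\<delta> x \<notin> X" using assms(3) injD[OF inj, of "\<delta> x" x] by force
    from leads[OF remove_points_leads_to[OF assms(1) this]]
    show ?thesis using False assms(1,2) by (simp add: remove_points_eqI permutation_compose)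
  qed
qed

lemma remove_points_image:
  assumes "permutation \<gamma>" "permutation \<gamma>'" "inj_on f A" "X \<subseteq> A" "x \<in> A - X"
    and A: "\<And>x. x \<in> A \<Longrightarrow> \<gamma> x \<in> A" "\<And>x. x \<in> A \<Longrightarrow> \<gamma>' (f x) = f (\<gamma> x)"
  shows "remove_points (f ` X) \<gamma>' (f x) = f (remove_points X \<gamma> x)"
proof (rule remove_points_eqI)
  have notin: "f y \<notin> f ` X" if "y \<in> A" "y \<notin> X" for y
    using that assms(3,4) by (simp add: inj_on_image_mem_iff)
  then show "f x \<notin> f ` X" using assms(5) by blast
  have "leads_to (f ` X) \<gamma>' (f y) (f z)" if "leads_to X \<gamma> y z" "y \<in> A" for y z
    using that
  proof induction
    case (stop y)
    then show ?case by (intro leads_to.stop notin)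
  next
    case (move y z)
    then show ?case using leads_to.move[of "f y" "f ` X" \<gamma>'] by (simp add: A)
  qed
  from this[OF remove_points_leads_to[OF assms(1)]]
  show "leads_to (f ` X) \<gamma>' (\<gamma>' (f x)) (f (remove_points X \<gamma> x))" using assms(5) A by simp
qed fact

section \<open>Cycles inside a set\<close>

text \<open>
  The cycles that disappear when the points of \<open>X\<close> are erased.
\<close>

definition loops :: "('a \<Rightarrow> 'a) \<Rightarrow> 'a set \<Rightarrow> 'a set set" where
  "loops \<gamma> X = {orbit \<gamma> x | x. x \<in> X \<and> orbit \<gamma> x \<subseteq> X}"

lemma orbit_eq_of_mem: "permutation \<gamma> \<Longrightarrow> y \<in> orbit \<gamma> x \<Longrightarrow> orbit \<gamma> y = orbit \<gamma> x"
  using cyclic_on_orbit' orbit_cyclic_eq3 by metis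

lemma finite_loops: "finite X \<Longrightarrow> finite (loops \<gamma> X)"
  by (rule finite_subset[of _ "Pow X"]) (auto simp: loops_def)

text \<open>
  Steps that leave \<open>X\<close> do not matter, since they occur in no cycle inside \<open>X\<close>.
\<close>

lemma loops_cong:
  assumes "\<And>x. x \<in> X \<Longrightarrow> \<gamma> x \<in> X \<or> \<gamma>' x \<in> X \<Longrightarrow> \<gamma> x = \<gamma>' x"
  shows "loops \<gamma> X = loops \<gamma>' X"
proof -
  have *: "orbit f x = orbit g x"
    if "x \<in> X" "orbit f x \<subseteq> X" "\<And>x. x \<in> X \<Longrightarrow> f x \<in> X \<or> g x \<in> X \<Longrightarrow> f x = g x" for f g x
  proof (rule orbit_cong0[of x "insert x (orbit f x)"])
    show "f \<in> insert x (orbit f x) \<rightarrow> insert x (orbit f x)" by (auto intro: orbit.intros)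
    fix y assume "y \<in> insert x (orbit f x)"
    then have "y \<in> X" "f y \<in> X" using that(1,2) orbit.base[of f x] orbit.step[of y f x] by auto
    then show "f y = g y" using that(3) by blast
  qed simp
  have sub: "loops f X \<subseteq> loops g X" if "\<And>x. x \<in> X \<Longrightarrow> f x \<in> X \<or> g x \<in> X \<Longrightarrow> f x = g x" for f g
  proof
    fix O' assume "O' \<in> loops f X"
    then obtain x where x: "x \<in> X" "orbit f x \<subseteq> X" "O' = orbit f x" by (auto simp: loops_def)
    with *[OF x(1,2) that] show "O' \<in> loops g X" by (auto simp: loops_def)
  qed
  show ?thesis
  proof (rule equalityI)
    show "loops \<gamma> X \<subseteq> loops \<gamma>' X" by (rule sub) (rule assms)
    show "loops \<gamma>' X \<subseteq> loops \<gamma> X"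
      by (rule sub) (metis assms)
  qed
qed

lemma loops_comp_left:
  assumes "inj \<delta>" "\<And>x. x \<in> X \<Longrightarrow> \<delta> x = x"
  shows "loops (\<delta> \<circ> \<gamma>) X = loops \<gamma> X"
proof (rule loops_cong)
  fix x assume "(\<delta> \<circ> \<gamma>) x \<in> X \<or> \<gamma> x \<in> X"
  then show "(\<delta> \<circ> \<gamma>) x = \<gamma> x"
    using assms(2) injD[OF assms(1), of "\<delta> (\<gamma> x)" "\<gamma> x"] by auto
qed

lemma loops_comp_right:
  assumes "\<And>x. x \<in> X \<Longrightarrow> \<delta> x = x"
  shows "loops (\<gamma> \<circ> \<delta>) X = loops \<gamma> X"
  by (rule loops_cong) (simp add: assms)

text \<open>
  A cycle inside \<open>X \<union> Y\<close> either lies inside \<open>X\<close> or survives the erasure of \<open>X\<close>, as a cycle of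
  the first return map inside \<open>Y\<close>. Taking for \<open>Y\<close> all other nonzero points expresses the
  difference of the two cycle numbers in the definition of a contraction.
\<close>

lemma card_loops_Un:
  assumes "permutation \<gamma>" "finite X" "finite Y" "X \<inter> Y = {}"
  shows "card (loops \<gamma> (X \<union> Y)) = card (loops \<gamma> X) + card (loops (remove_points X \<gamma>) Y)"
proof -
  let ?R = "remove_points X \<gamma>"
  let ?L = "{C \<in> loops \<gamma> (X \<union> Y). \<not> C \<subseteq> X}"
  note self = permutation_self_in_orbit[OF assms(1)]
  have R: "orbit ?R y = orbit \<gamma> y - X" if "y \<in> Y" for y
    using that assms(4) by (intro orbit_remove_points assms(1)) auto
  have rep: "\<exists>y\<in>Y. C = orbit \<gamma> y" if C: "C \<in> ?L" for C
  proof -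
    obtain x where x: "C = orbit \<gamma> x" "C \<subseteq> X \<union> Y" using C by (auto simp: loops_def)
    moreover obtain y where "y \<in> C" "y \<notin> X" using C by auto
    ultimately show ?thesis using orbit_eq_of_mem[OF assms(1), of y x] by blast
  qed
  have "bij_betw (\<lambda>C. C - X) ?L (loops ?R Y)"
    unfolding bij_betw_def
  proof (intro conjI)
    show "inj_on (\<lambda>C. C - X) ?L"
    proof (rule inj_onI)
      fix C D assume CD: "C \<in> ?L" "D \<in> ?L" "C - X = D - X"
      obtain y z where yz: "y \<in> Y" "C = orbit \<gamma> y" "z \<in> Y" "D = orbit \<gamma> z" using rep CD(1,2) by metis
      then have "y \<in> C - X" using self[of y] assms(4) by auto
      then have "y \<in> D" using CD(3) by blast
      then show "C = D" using yz orbit_eq_of_mem[OF assms(1), of y z] by simp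
    qed
    show "(\<lambda>C. C - X) ` ?L = loops ?R Y"
    proof (intro equalityI subsetI)
      fix C' assume "C' \<in> (\<lambda>C. C - X) ` ?L"
      then obtain C where C: "C \<in> ?L" "C' = C - X" by blast
      then obtain y where y: "y \<in> Y" "C = orbit \<gamma> y" using rep by blast
      have "C \<subseteq> X \<union> Y" using C by (auto simp: loops_def)
      then have "C' \<subseteq> Y" "C' = orbit ?R y" using C y R[OF y(1)] by blast+
      then show "C' \<in> loops ?R Y" using y unfolding loops_def by blast
    next
      fix C' assume "C' \<in> loops ?R Y"
      then obtain y where y: "y \<in> Y" "C' = orbit ?R y" "C' \<subseteq> Y" by (auto simp: loops_def)
      then have "C' = orbit \<gamma> y - X" using R by simp
      moreover have "orbit \<gamma> y \<in> ?L"
        using y R[OF y(1)] self[of y] assms(4) by (auto simp: loops_def)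
      ultimately show "C' \<in> (\<lambda>C. C - X) ` ?L" by blast
    qed
  qed
  then have "card ?L = card (loops ?R Y)" by (rule bij_betw_same_card)
  moreover have "loops \<gamma> X \<union> ?L = loops \<gamma> (X \<union> Y)"
  proof (intro equalityI subsetI)
    fix C assume "C \<in> loops \<gamma> X \<union> ?L"
    then show "C \<in> loops \<gamma> (X \<union> Y)" unfolding loops_def by blast
  next
    fix C assume C: "C \<in> loops \<gamma> (X \<union> Y)"
    then obtain x where x: "C = orbit \<gamma> x" unfolding loops_def by blast
    then have "x \<in> C" using self by simp
    then show "C \<in> loops \<gamma> X \<union> ?L" using C x unfolding loops_def by blast
  qed
  moreover have "loops \<gamma> X \<inter> ?L = {}" unfolding loops_def by blast
  moreover have "finite (loops \<gamma> (X \<union> Y))" using assms by (intro finite_loops) auto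
  ultimately show ?thesis by (metis card_Un_disjoint finite_Un)
qed

lemma cyc0_eq_card_loops:
  assumes "\<gamma> permutes A" "finite A"
  shows "cyc0 A \<gamma> = card (loops \<gamma> (A - {0}))"
proof -
  have "permutation \<gamma>" using permutes_permutation[OF assms(1,2)] .
  note self = permutation_self_in_orbit[OF this]
  have "orbit \<gamma> x \<subseteq> A" if "x \<in> A" for x using permutes_orbit_subset[OF assms(1) that] .
  then have "{orbit \<gamma> x | x. x \<in> A \<and> 0 \<notin> orbit \<gamma> x} = loops \<gamma> (A - {0})"
    using self unfolding loops_def by blast
  then show ?thesis by (simp add: cyc0_def)
qed

lemma loops_image:
  assumes "permutation \<gamma>" "inj_on f A" "X \<subseteq> A"
    and A: "\<And>x. x \<in> A \<Longrightarrow> \<gamma> x \<in> A" "\<And>x. x \<in> A \<Longrightarrow> \<gamma>' (f x) = f (\<gamma> x)"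
  shows "card (loops \<gamma>' (f ` X)) = card (loops \<gamma> X)"
proof -
  have inA: "orbit \<gamma> x \<subseteq> A" if "x \<in> A" for x
  proof
    fix y assume "y \<in> orbit \<gamma> x" then show "y \<in> A" using that A(1) by induction auto
  qed
  have orb: "orbit \<gamma>' (f x) = f ` orbit \<gamma> x" if "x \<in> A" for x
    using inA[OF that] A(2) permutation_self_in_orbit[OF assms(1)] by (subst orbit_inverse) auto
  have sub: "f ` orbit \<gamma> x \<subseteq> f ` X \<longleftrightarrow> orbit \<gamma> x \<subseteq> X" if "x \<in> A" for x
    using inj_on_image_mem_iff[OF assms(2) _ assms(3)] inA[OF that] by blast
  have "loops \<gamma>' (f ` X) = (`) f ` loops \<gamma> X"
  proof (intro equalityI subsetI)
    fix C assume "C \<in> loops \<gamma>' (f ` X)"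
    then obtain x where x: "x \<in> X" "C = orbit \<gamma>' (f x)" "C \<subseteq> f ` X" by (auto simp: loops_def)
    then have "x \<in> A" using assms(3) by blast
    then have "C = f ` orbit \<gamma> x" "orbit \<gamma> x \<subseteq> X" using x orb sub by metis+
    then show "C \<in> (`) f ` loops \<gamma> X" using x(1) by (auto simp: loops_def)
  next
    fix C assume "C \<in> (`) f ` loops \<gamma> X"
    then obtain x where x: "x \<in> X" "orbit \<gamma> x \<subseteq> X" "C = f ` orbit \<gamma> x" by (auto simp: loops_def)
    then have "C = orbit \<gamma>' (f x)" using orb assms(3) by auto
    moreover have "C \<subseteq> f ` X" using x by blast
    ultimately show "C \<in> loops \<gamma>' (f ` X)" using x(1) unfolding loops_def by blast
  qed
  moreover have "inj_on ((`) f) (loops \<gamma> X)"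
    by (rule inj_on_subset[OF inj_on_image_Pow[OF inj_on_subset[OF assms(2,3)]]])
      (auto simp: loops_def)
  ultimately show ?thesis by (simp add: card_image)
qed


section \<open>Matchings\<close>

text \<open>
  A partition into singletons and pairs is recorded by its pairs alone. This makes restricting
  it, uniting two of them and transporting it along an injection plain set operations.
\<close>

definition matchings :: "'a set \<Rightarrow> 'a set set set" where
  "matchings A = {M. disjoint M \<and> (\<forall>P\<in>M. P \<subseteq> A \<and> card P = 2)}"

lemma matchings_Union: "M \<in> matchings A \<Longrightarrow> \<Union>M \<subseteq> A"
  by (auto simp: matchings_def)

lemma finite_matchings: "finite A \<Longrightarrow> finite (matchings A)"
  by (rule finite_subset[of _ "Pow (Pow A)"]) (auto simp: matchings_def)

lemma finite_matching: "finite A \<Longrightarrow> M \<in> matchings A \<Longrightarrow> finite M"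
  by (rule finite_subset[of _ "Pow A"]) (auto simp: matchings_def)

lemma matchings_subset:
  assumes "M \<in> matchings A" "N \<subseteq> M" "\<Union>N \<subseteq> B"
  shows "N \<in> matchings B"
proof -
  have "disjoint N" using assms(1,2) pairwise_subset[of disjnt M N] by (simp add: matchings_def)
  then show ?thesis using assms by (auto simp: matchings_def)
qed

lemma matchings_empty: "{} \<in> matchings A"
  by (simp add: matchings_def)

lemma matchings_unique:
  "M \<in> matchings A \<Longrightarrow> P \<in> M \<Longrightarrow> Q \<in> M \<Longrightarrow> x \<in> P \<Longrightarrow> x \<in> Q \<Longrightarrow> P = Q"
  unfolding matchings_def disjoint_def by blast

lemma matchings_edge:
  assumes "M \<in> matchings A" "P \<in> M" "x \<in> P"
  obtains y where "y \<noteq> x" "P = {x, y}"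
proof -
  have "card P = 2" using assms(1,2) by (simp add: matchings_def)
  then obtain a b where "P = {a, b}" "a \<noteq> b" by (auto simp: card_2_iff)
  then show ?thesis using that[of a] that[of b] assms(3) by (auto simp: insert_commute)
qed

lemma matchings_Un:
  assumes "M \<in> matchings A" "N \<in> matchings B" "\<Union>M \<inter> \<Union>N = {}"
  shows "M \<union> N \<in> matchings (A \<union> B)"
proof -
  have "disjoint (M \<union> N)" using assms by (intro disjoint_union) (simp_all add: matchings_def)
  then show ?thesis using assms(1,2) by (auto simp: matchings_def)
qed

lemma matchings_disjoint:
  assumes "M \<in> matchings A" "\<Union>M \<inter> \<Union>N = {}"
  shows "M \<inter> N = {}"
proof -
  have "P \<noteq> {}" if "P \<in> M" for P using that assms(1) by (auto simp: matchings_def)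
  then show ?thesis using assms(2) by blast
qed

lemma card_Union_matching:
  assumes "finite A" "M \<in> matchings A"
  shows "card (\<Union>M) = 2 * card M"
proof -
  have "card (\<Union>M) = (\<Sum>P\<in>M. card P)"
    using assms by (intro card_Union_disjoint)
      (auto simp: matchings_def intro: finite_subset[OF _ assms(1)])
  also have "\<dots> = (\<Sum>P\<in>M. 2)" using assms(2) by (intro sum.cong) (auto simp: matchings_def)
  finally show ?thesis by simp
qed

lemma pairs_matching: "M \<in> matchings A \<Longrightarrow> pairs M = M"
  by (auto simp: pairs_def matchings_def)

lemma supp_matching: "M \<in> matchings A \<Longrightarrow> supp M = \<Union>M"
  by (simp add: supp_def pairs_matching)

lemma involution_edge:
  assumes "M \<in> matchings A" "{x, y} \<in> M" "x \<noteq> y"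
  shows "involution M x = y"
proof -
  have "(THE y. y \<noteq> x \<and> {x, y} \<in> M) = y"
  proof (rule the_equality)
    fix z assume z: "z \<noteq> x \<and> {x, z} \<in> M"
    then have "{x, z} = {x, y}" using matchings_unique[OF assms(1) _ assms(2), of "{x, z}" x] by simp
    then show "z = y" using z by (metis doubleton_eq_iff)
  qed (use assms in simp)
  then show ?thesis using assms(2) by (auto simp: involution_def supp_matching[OF assms(1)])
qed

lemma involution_other: "M \<in> matchings A \<Longrightarrow> x \<notin> \<Union>M \<Longrightarrow> involution M x = x"
  by (simp add: involution_def supp_matching)

lemma involution_in:
  assumes "M \<in> matchings A" "x \<in> \<Union>M"
  shows "involution M x \<in> \<Union>M" "involution M (involution M x) = x"
proof -
  obtain P where P: "P \<in> M" "x \<in> P" using assms(2) by blast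
  obtain y where y: "y \<noteq> x" "P = {x, y}" using matchings_edge[OF assms(1) P] .
  have "involution M x = y" "involution M y = x"
    using y P by (auto intro!: involution_edge[OF assms(1)] simp: insert_commute)
  then show "involution M x \<in> \<Union>M" "involution M (involution M x) = x" using P(1) y by auto
qed

lemma involution_invol: "M \<in> matchings A \<Longrightarrow> involution M (involution M x) = x"
  by (cases "x \<in> \<Union>M") (simp_all add: involution_in involution_other)

lemma involution_permutes: "M \<in> matchings A \<Longrightarrow> involution M permutes \<Union>M"
  unfolding permutes_def by (metis involution_other involution_invol)

lemma involution_Un:
  assumes "M \<union> N \<in> matchings A" "\<Union>M \<inter> \<Union>N = {}"
  shows "involution (M \<union> N) = involution N \<circ> involution M"
proof
  have M: "M \<in> matchings A" and N: "N \<in> matchings A"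
    using assms(1) matchings_subset[OF assms(1), of M A] matchings_subset[OF assms(1), of N A]
      matchings_Union[OF assms(1)] by auto
  fix x
  consider (M) P where "P \<in> M" "x \<in> P" | (N) P where "P \<in> N" "x \<in> P" | (none) "x \<notin> \<Union>(M \<union> N)"
    by auto
  then show "involution (M \<union> N) x = (involution N \<circ> involution M) x"
  proof cases
    case M': M
    obtain y where y: "y \<noteq> x" "P = {x, y}" using matchings_edge[OF M M'] .
    have "y \<notin> \<Union>N" using y M' assms(2) by auto
    then show ?thesis using y M'(1)
      by (simp add: involution_edge[OF assms(1), of x y] involution_edge[OF M, of x y]
          involution_other[OF N])
  next
    case N': N
    obtain y where y: "y \<noteq> x" "P = {x, y}" using matchings_edge[OF N N'] .
    have "x \<notin> \<Union>M" using N' assms(2) by auto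
    then show ?thesis using y N'(1)
      by (simp add: involution_edge[OF assms(1), of x y] involution_edge[OF N, of x y]
          involution_other[OF M])
  next
    case none
    then show ?thesis using involution_other[OF assms(1) none] by (simp add: involution_other[OF M] involution_other[OF N])
  qed
qed

lemma matchings_image:
  assumes "inj_on f A" "M \<in> matchings A"
  shows "(`) f ` M \<in> matchings (f ` A)"
proof -
  have sub: "P \<subseteq> A" "card P = 2" if "P \<in> M" for P using that assms(2) by (auto simp: matchings_def)
  have "disjoint ((`) f ` M)"
    using assms(2) by (intro disjoint_image inj_on_subset[OF assms(1)] matchings_Union[OF assms(2)])
      (simp add: matchings_def)
  moreover have "card (f ` P) = 2" if "P \<in> M" for P
    using sub[OF that] inj_on_subset[OF assms(1)] by (simp add: card_image)
  ultimately show ?thesis using sub by (auto simp: matchings_def)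
qed

lemma involution_image:
  assumes "inj_on f A" "M \<in> matchings A" "x \<in> A"
  shows "involution ((`) f ` M) (f x) = f (involution M x)"
proof (cases "x \<in> \<Union>M")
  case True
  then obtain P where P: "P \<in> M" "x \<in> P" by blast
  obtain y where y: "y \<noteq> x" "P = {x, y}" using matchings_edge[OF assms(2) P] .
  have "y \<in> A" using P y matchings_Union[OF assms(2)] by auto
  then have "f x \<noteq> f y" using assms(1,3) y(1) by (auto simp: inj_on_eq_iff)
  moreover have "{f x, f y} \<in> (`) f ` M" using P y by (auto intro!: image_eqI[of _ _ P])
  moreover have "involution M x = y" using P y by (auto intro: involution_edge[OF assms(2)])
  ultimately show ?thesis using involution_edge[OF matchings_image[OF assms(1,2)]] by simp
next
  case False
  then have "f x \<notin> f ` \<Union>M"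
    using inj_on_image_mem_iff[OF assms(1,3) matchings_Union[OF assms(2)]] by simp
  then have "f x \<notin> \<Union>((`) f ` M)" by blast
  then show ?thesis
    using False involution_other[OF matchings_image[OF assms(1,2)]] involution_other[OF assms(2)] by simp
qed

section \<open>Contraction weights and residual permutations\<close>

text \<open>
  The permutation left by the contraction along \<open>M\<close>, on the labels not in \<open>M\<close> and not yet
  relabelled by an initial segment.
\<close>

definition residual :: "nat set set \<Rightarrow> (nat \<Rightarrow> nat) \<Rightarrow> nat \<Rightarrow> nat" where
  "residual M \<gamma> = remove_points (\<Union>M) (involution M \<circ> \<gamma>)"

text \<open>
  The scalar produced by the contraction along \<open>M\<close> of a monomial with letters \<open>h\<close>. The exponent
  of \<open>q\<close> is the one in the definition of a contraction, by \<open>card_loops_Un\<close>.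
\<close>

definition weight :: "real \<Rightarrow> nat set set \<Rightarrow> (nat \<Rightarrow> nat) \<Rightarrow> (nat \<Rightarrow> 'a::real_inner) \<Rightarrow> complex" where
  "weight q M \<gamma> h = complex_of_real
     (q powi (int (card M) - int (card (loops (involution M \<circ> \<gamma>) (\<Union>M)))) *
      (\<Prod>P\<in>M. inner (h (Min P)) (h (Max P))))"

context
  fixes A :: "nat set" and M :: "nat set set" and \<gamma> :: "nat \<Rightarrow> nat"
  assumes fin: "finite A" and zero: "0 \<notin> A" and M: "M \<in> matchings A"
    and \<gamma>: "\<gamma> permutes insert 0 A"
begin

lemma involution_comp_permutes: "involution M \<circ> \<gamma> permutes insert 0 A"
  using permutes_compose[OF \<gamma> permutes_subset[OF involution_permutes[OF M]]] matchings_Union[OF M] by auto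

lemma involution_comp_permutation: "permutation (involution M \<circ> \<gamma>)"
  using permutes_permutation[OF involution_comp_permutes] fin by simp

lemma residual_permutes: "residual M \<gamma> permutes insert 0 (A - \<Union>M)"
proof -
  have "0 \<notin> \<Union>M" using matchings_Union[OF M] zero by blast
  then have "insert 0 (A - \<Union>M) = insert 0 A - \<Union>M" by blast
  then show ?thesis
    unfolding residual_def using remove_points_permutes[OF involution_comp_permutes] fin by simp
qed

end

lemma involution_permutation: "finite A \<Longrightarrow> M \<in> matchings A \<Longrightarrow> permutation (involution M)"
  using permutes_permutation[OF involution_permutes] matchings_Union finite_subset by metis

text \<open>
  The involution of \<open>N\<close> fixes the points of \<open>M\<close>. It therefore neither changes which cycles lie
  inside them nor interferes with their erasure, and the two contractions can be performed one
  after the other.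
\<close>

lemma
  assumes q: "q \<noteq> 0" and fin: "finite A" and zero: "0 \<notin> A" and \<gamma>: "\<gamma> permutes insert 0 A"
    and MN: "M \<union> N \<in> matchings A" "\<Union>M \<inter> \<Union>N = {}"
  shows residual_Un: "residual (M \<union> N) \<gamma> = residual N (residual M \<gamma>)"
    and weight_Un: "weight q (M \<union> N) \<gamma> h = weight q M \<gamma> h * weight q N (residual M \<gamma>) h"
proof -
  have M: "M \<in> matchings A" and N: "N \<in> matchings A"
    using matchings_subset[OF MN(1), of M A] matchings_subset[OF MN(1), of N A]
      matchings_Union[OF MN(1)] by auto
  have inv: "involution (M \<union> N) \<circ> \<gamma> = involution N \<circ> (involution M \<circ> \<gamma>)"
    using involution_Un[OF MN] by (simp add: o_assoc)
  have other: "involution N x = x" if "x \<in> \<Union>M" for x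
    using involution_other[OF N] that MN(2) by blast
  have res: "remove_points (\<Union>M) (involution N \<circ> (involution M \<circ> \<gamma>)) = involution N \<circ> residual M \<gamma>"
    unfolding residual_def
    by (intro remove_points_comp_left involution_comp_permutation[OF fin zero M \<gamma>]
        involution_permutation[OF fin N] other)
  have perm: "involution N \<circ> (involution M \<circ> \<gamma>) permutes insert 0 A"
    using involution_comp_permutes[OF fin zero MN(1) \<gamma>] inv by simp
  have fins: "finite (\<Union>M)" "finite (\<Union>N)" "finite M" "finite N"
    using matchings_Union[OF M] matchings_Union[OF N] finite_subset[OF _ fin]
      finite_matching[OF fin] M N by auto
  show "residual (M \<union> N) \<gamma> = residual N (residual M \<gamma>)"
    unfolding residual_def[of "M \<union> N"] residual_def[of N] inv Union_Un_distrib
    using remove_points_Un[OF perm _ MN(2)] fin by (simp add: res)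
  have "card (loops (involution (M \<union> N) \<circ> \<gamma>) (\<Union>(M \<union> N))) =
      card (loops (involution M \<circ> \<gamma>) (\<Union>M)) + card (loops (involution N \<circ> residual M \<gamma>) (\<Union>N))"
    unfolding inv Union_Un_distrib
      card_loops_Un[OF permutes_permutation[OF perm finite.insertI[OF fin]] fins(1,2) MN(2)] res
    by (subst loops_comp_left)
      (use other bij_is_inj[OF permutation_bijective[OF involution_permutation[OF fin N]]] in auto)
  moreover have "card (M \<union> N) = card M + card N"
    using matchings_disjoint[OF M MN(2)] fins by (simp add: card_Un_disjoint)
  moreover have "(\<Prod>P\<in>M \<union> N. inner (h (Min P)) (h (Max P))) =
      (\<Prod>P\<in>M. inner (h (Min P)) (h (Max P))) * (\<Prod>P\<in>N. inner (h (Min P)) (h (Max P)))"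
    using matchings_disjoint[OF M MN(2)] fins by (intro prod.union_disjoint)
  ultimately show "weight q (M \<union> N) \<gamma> h = weight q M \<gamma> h * weight q N (residual M \<gamma>) h"
    using power_int_add[of q "int (card M) - int (card (loops (involution M \<circ> \<gamma>) (\<Union>M)))"
        "int (card N) - int (card (loops (involution N \<circ> residual M \<gamma>) (\<Union>N)))"] q
    by (simp add: weight_def algebra_simps)
qed

lemma permutes_other_in:
  assumes "\<delta> permutes insert 0 B" "A \<inter> B = {}" "0 \<notin> A" "x \<in> A"
  shows "\<delta> x = x"
  using assms by (intro permutes_not_in[OF assms(1)]) auto

text \<open>
  Permutations of \<open>insert 0 A\<close> and of \<open>insert 0 B\<close> share only the point \<open>0\<close>, which is never
  contracted. A contraction inside one factor of the product \<open>\<delta> \<circ> \<gamma>\<close> thus ignores the other.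
\<close>

lemma
  assumes fin: "finite A" "finite B" and zero: "0 \<notin> A" "0 \<notin> B" and AB: "A \<inter> B = {}"
    and \<gamma>: "\<gamma> permutes insert 0 A" and \<delta>: "\<delta> permutes insert 0 B" and M: "M \<in> matchings A"
  shows residual_comp_left: "residual M (\<delta> \<circ> \<gamma>) = \<delta> \<circ> residual M \<gamma>"
    and weight_comp_left: "weight q M (\<delta> \<circ> \<gamma>) h = weight q M \<gamma> h"
proof -
  have fixed: "\<delta> x = x" if "x \<in> \<Union>M" for x
    using permutes_other_in[OF \<delta> AB zero(1)] that matchings_Union[OF M] by blast
  have "inj \<delta>" using permutes_inj[OF \<delta>] .
  have comm: "involution M (\<delta> x) = \<delta> (involution M x)" for x
  proof (cases "x \<in> \<Union>M")
    case True
    then show ?thesis using fixed involution_in(1)[OF M True] by simp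
  next
    case False
    then have "\<delta> x \<notin> \<Union>M" using fixed injD[OF \<open>inj \<delta>\<close>, of "\<delta> x" x] by force
    then show ?thesis using False by (simp add: involution_other[OF M])
  qed
  then have *: "involution M \<circ> (\<delta> \<circ> \<gamma>) = \<delta> \<circ> (involution M \<circ> \<gamma>)" by (simp add: fun_eq_iff)
  have "permutation \<delta>" using permutes_permutation[OF \<delta>] fin by simp
  then show "residual M (\<delta> \<circ> \<gamma>) = \<delta> \<circ> residual M \<gamma>"
    unfolding residual_def * using fixed by (intro remove_points_comp_left involution_comp_permutation[OF fin(1) zero(1) M \<gamma>])
  show "weight q M (\<delta> \<circ> \<gamma>) h = weight q M \<gamma> h"
    unfolding weight_def * using loops_comp_left[OF \<open>inj \<delta>\<close>, of "\<Union>M" "involution M \<circ> \<gamma>"] fixed by simp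
qed

lemma
  assumes fin: "finite A" "finite B" and zero: "0 \<notin> A" "0 \<notin> B" and AB: "A \<inter> B = {}"
    and \<gamma>: "\<gamma> permutes insert 0 A" and \<delta>: "\<delta> permutes insert 0 B" and M: "M \<in> matchings B"
  shows residual_comp_right: "residual M (\<delta> \<circ> \<gamma>) = residual M \<delta> \<circ> \<gamma>"
    and weight_comp_right: "weight q M (\<delta> \<circ> \<gamma>) h = weight q M \<delta> h"
proof -
  have fixed: "\<gamma> x = x" if "x \<in> \<Union>M" for x
    using permutes_other_in[OF \<gamma> _ zero(2)] AB that matchings_Union[OF M] by blast
  have *: "involution M \<circ> (\<delta> \<circ> \<gamma>) = (involution M \<circ> \<delta>) \<circ> \<gamma>" by (simp add: fun_eq_iff)
  have "permutation \<gamma>" using permutes_permutation[OF \<gamma>] fin by simp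
  then show "residual M (\<delta> \<circ> \<gamma>) = residual M \<delta> \<circ> \<gamma>"
    unfolding residual_def * using fixed by (intro remove_points_comp_right involution_comp_permutation[OF fin(2) zero(2) M \<delta>])
  show "weight q M (\<delta> \<circ> \<gamma>) h = weight q M \<delta> h"
    unfolding weight_def * using loops_comp_right[of "\<Union>M" \<gamma> "involution M \<circ> \<delta>"] fixed by simp
qed

text \<open>
  A relabelling may exchange the smaller and the larger element of a pair; the symmetry of the
  inner product makes this harmless.
\<close>

lemma inner_edge:
  fixes x y :: "'b::linorder" and h :: "'b \<Rightarrow> 'a::real_inner"
  shows "x \<noteq> y \<Longrightarrow> inner (h (Min {x, y})) (h (Max {x, y})) = inner (h x) (h y)"
  by (cases "x < y") (auto simp: inner_commute min_def max_def)

text \<open>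
  Weights and residual permutations do not depend on the names of the labels: \<open>f\<close> carries
  pairs to pairs and paths to paths. Only \<open>0\<close> is distinguished.
\<close>

lemma
  assumes fin: "finite A" and zero: "0 \<notin> A" and M: "M \<in> matchings A"
    and \<gamma>: "\<gamma> permutes insert 0 A" and \<gamma>': "\<gamma>' permutes insert 0 (f ` A)"
    and f: "inj_on f (insert 0 A)" "f 0 = 0"
    and eq: "\<And>x. x \<in> insert 0 A \<Longrightarrow> \<gamma>' (f x) = f (\<gamma> x)"
  shows residual_image: "x \<in> insert 0 (A - \<Union>M) \<Longrightarrow> residual ((`) f ` M) \<gamma>' (f x) = f (residual M \<gamma> x)"
    and weight_image: "(\<And>x. x \<in> A \<Longrightarrow> h' (f x) = h x) \<Longrightarrow> weight q ((`) f ` M) \<gamma>' h' = weight q M \<gamma> h"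
proof -
  have injA: "inj_on f A" using f(1) by (rule inj_on_subset) auto
  have zero': "0 \<notin> f ` A" using f zero by (force simp: inj_on_def)
  have M0: "M \<in> matchings (insert 0 A)" using M by (auto simp: matchings_def)
  have sub: "\<Union>M \<subseteq> insert 0 A" using matchings_Union[OF M] by blast
  have fM: "(`) f ` M \<in> matchings (f ` A)" by (rule matchings_image[OF injA M])
  have perm: "permutation (involution M \<circ> \<gamma>)"
    by (rule involution_comp_permutation[OF fin zero M \<gamma>])
  have perm': "permutation (involution ((`) f ` M) \<circ> \<gamma>')"
    by (rule involution_comp_permutation[OF finite_imageI[OF fin] zero' fM \<gamma>'])
  have in_A: "(involution M \<circ> \<gamma>) x \<in> insert 0 A" if "x \<in> insert 0 A" for x
    by (rule iffD2[OF permutes_in_image[OF involution_comp_permutes[OF fin zero M \<gamma>]] that])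
  have comm: "(involution ((`) f ` M) \<circ> \<gamma>') (f x) = f ((involution M \<circ> \<gamma>) x)" if "x \<in> insert 0 A" for x
    using involution_image[OF f(1) M0, of "\<gamma> x"] eq[OF that] permutes_in_image[OF \<gamma>, of x] that by simp
  have Un: "\<Union>((`) f ` M) = f ` \<Union>M" by blast
  show "residual ((`) f ` M) \<gamma>' (f x) = f (residual M \<gamma> x)" if "x \<in> insert 0 (A - \<Union>M)"
  proof -
    have "x \<in> insert 0 A - \<Union>M" using that zero matchings_Union[OF M] by blast
    then show ?thesis
      unfolding residual_def Un
      by (rule remove_points_image[OF perm perm' f(1) sub]) (fact in_A, fact comm)
  qed
  assume h: "\<And>x. x \<in> A \<Longrightarrow> h' (f x) = h x"
  have "inj_on ((`) f) M"
    using matchings_Union[OF M] by (intro inj_on_subset[OF inj_on_image_Pow[OF injA]]) auto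
  moreover have "inner (h' (Min (f ` P))) (h' (Max (f ` P))) = inner (h (Min P)) (h (Max P))"
    if P: "P \<in> M" for P
  proof -
    have "card P = 2" using P M by (simp add: matchings_def)
    then obtain x y where xy: "P = {x, y}" "x \<noteq> y" by (auto simp: card_2_iff)
    then have A: "x \<in> A" "y \<in> A" using P matchings_Union[OF M] by auto
    then have "f x \<noteq> f y" using xy injA by (auto simp: inj_on_eq_iff)
    then show ?thesis using inner_edge[OF xy(2), of h] inner_edge[of "f x" "f y" h'] h A
      by (simp add: xy(1))
  qed
  ultimately have "(\<Prod>P\<in>(`) f ` M. inner (h' (Min P)) (h' (Max P))) =
      (\<Prod>P\<in>M. inner (h (Min P)) (h (Max P)))" and "card ((`) f ` M) = card M"
    by (simp_all add: prod.reindex card_image)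
  moreover have "card (loops (involution ((`) f ` M) \<circ> \<gamma>') (f ` \<Union>M)) =
      card (loops (involution M \<circ> \<gamma>) (\<Union>M))"
    by (rule loops_image[OF perm f(1) sub]) (fact in_A, fact comm)
  ultimately show "weight q ((`) f ` M) \<gamma>' h' = weight q M \<gamma> h"
    unfolding weight_def Un by simp
qed

section \<open>Matchings of a disjoint union\<close>

definition cross_matchings :: "'a set \<Rightarrow> 'a set \<Rightarrow> 'a set set set" where
  "cross_matchings A B = {M \<in> matchings (A \<union> B). \<forall>P\<in>M. \<not> P \<subseteq> A \<and> \<not> P \<subseteq> B}"

text \<open>
  The pairs inside \<open>A\<close>, the pairs inside \<open>B\<close>, and the others, which join points of \<open>A\<close> and \<open>B\<close>
  not covered by the first two kinds.
\<close>

lemma bij_betw_split_matchings: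
  assumes "A \<inter> B = {}"
  shows "bij_betw (\<lambda>((M, N), K). M \<union> N \<union> K)
    (SIGMA MN:matchings A \<times> matchings B.
       cross_matchings (A - \<Union>(fst MN)) (B - \<Union>(snd MN)))
    (matchings (A \<union> B))"
proof (rule bij_betw_byWitness[where
      f' = "\<lambda>M. (({P \<in> M. P \<subseteq> A}, {P \<in> M. P \<subseteq> B}), {P \<in> M. \<not> P \<subseteq> A \<and> \<not> P \<subseteq> B})"])
  let ?S = "SIGMA MN:matchings A \<times> matchings B.
       cross_matchings (A - \<Union>(fst MN)) (B - \<Union>(snd MN))"
  have ne: "P \<noteq> {}" if "P \<in> M" "M \<in> matchings C" for P M and C :: "'a set"
    using that by (auto simp: matchings_def)
  have *: "{P \<in> M \<union> N \<union> K. P \<subseteq> A} = M \<and> {P \<in> M \<union> N \<union> K. P \<subseteq> B} = N \<and>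
      {P \<in> M \<union> N \<union> K. \<not> P \<subseteq> A \<and> \<not> P \<subseteq> B} = K \<and> M \<union> N \<union> K \<in> matchings (A \<union> B)"
    if M: "M \<in> matchings A" and N: "N \<in> matchings B"
      and K: "K \<in> cross_matchings (A - \<Union>M) (B - \<Union>N)" for M N K
  proof -
    have K': "K \<in> matchings ((A - \<Union>M) \<union> (B - \<Union>N))" using K by (simp add: cross_matchings_def)
    note sub = matchings_Union[OF M] matchings_Union[OF N] matchings_Union[OF K']
    have k: "\<not> P \<subseteq> A \<and> \<not> P \<subseteq> B" if "P \<in> K" for P
    proof -
      have "\<not> P \<subseteq> A - \<Union>M" "\<not> P \<subseteq> B - \<Union>N" using that K by (simp_all add: cross_matchings_def)
      moreover have "P \<subseteq> (A - \<Union>M) \<union> (B - \<Union>N)" using that sub(3) by blast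
      ultimately obtain x y where "x \<in> P" "x \<in> B" "y \<in> P" "y \<in> A" by blast
      then show ?thesis using assms by blast
    qed
    have mn: "P \<subseteq> A \<and> \<not> P \<subseteq> B" if "P \<in> M" for P
    proof -
      have "P \<subseteq> A" using that sub(1) by blast
      then show ?thesis using assms ne[OF that M] by blast
    qed
    have nm: "P \<subseteq> B \<and> \<not> P \<subseteq> A" if "P \<in> N" for P
    proof -
      have "P \<subseteq> B" using that sub(2) by blast
      then show ?thesis using assms ne[OF that N] by blast
    qed
    have "M \<union> N \<in> matchings (A \<union> B)"
      using sub assms by (intro matchings_Un[OF M N]) blast
    then have "M \<union> N \<union> K \<in> matchings ((A \<union> B) \<union> ((A - \<Union>M) \<union> (B - \<Union>N)))"
      using sub assms by (intro matchings_Un[OF _ K']) blast+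
    moreover have "(A \<union> B) \<union> ((A - \<Union>M) \<union> (B - \<Union>N)) = A \<union> B" by blast
    ultimately have mem: "M \<union> N \<union> K \<in> matchings (A \<union> B)" by simp
    have "{P \<in> M \<union> N \<union> K. P \<subseteq> A} = M" using k mn nm by blast
    moreover have "{P \<in> M \<union> N \<union> K. P \<subseteq> B} = N" using k mn nm by blast
    moreover have "{P \<in> M \<union> N \<union> K. \<not> P \<subseteq> A \<and> \<not> P \<subseteq> B} = K" using k mn nm by blast
    ultimately show ?thesis using mem by blast
  qed
  let ?f = "\<lambda>((M, N), K). M \<union> N \<union> K"
    and ?f' = "\<lambda>M. (({P \<in> M. P \<subseteq> A}, {P \<in> M. P \<subseteq> B}), {P \<in> M. \<not> P \<subseteq> A \<and> \<not> P \<subseteq> B})"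
  show "\<forall>a\<in>?S. ?f' (?f a) = a"
  proof
    fix a assume "a \<in> ?S"
    then obtain M N K where "a = ((M, N), K)" "M \<in> matchings A" "N \<in> matchings B"
        "K \<in> cross_matchings (A - \<Union>M) (B - \<Union>N)" by auto
    with *[of M N K] show "?f' (?f a) = a" by (simp only: prod.case)
  qed
  show "?f ` ?S \<subseteq> matchings (A \<union> B)"
  proof (rule image_subsetI)
    fix a assume "a \<in> ?S"
    then obtain M N K where "a = ((M, N), K)" "M \<in> matchings A" "N \<in> matchings B"
        "K \<in> cross_matchings (A - \<Union>M) (B - \<Union>N)" by auto
    with *[of M N K] show "?f a \<in> matchings (A \<union> B)" by (simp only: prod.case)
  qed
  show "\<forall>M\<in>matchings (A \<union> B). ?f (?f' M) = M"
    by auto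
  show "?f' ` matchings (A \<union> B) \<subseteq> ?S"
  proof (rule image_subsetI)
    fix M assume M: "M \<in> matchings (A \<union> B)"
    let ?M = "{P \<in> M. P \<subseteq> A}" and ?N = "{P \<in> M. P \<subseteq> B}" and ?K = "{P \<in> M. \<not> P \<subseteq> A \<and> \<not> P \<subseteq> B}"
    have "P \<subseteq> (A - \<Union>?M) \<union> (B - \<Union>?N)" if P: "P \<in> ?K" for P
    proof
      fix x assume x: "x \<in> P"
      then have "x \<notin> Q" if "Q \<in> ?M \<union> ?N" for Q
        using that P matchings_unique[OF M, of P Q x] by blast
      then show "x \<in> (A - \<Union>?M) \<union> (B - \<Union>?N)"
        using x P matchings_Union[OF M] by blast
    qed
    then have "?K \<in> matchings ((A - \<Union>?M) \<union> (B - \<Union>?N))"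
      by (intro matchings_subset[OF M]) blast+
    then have "?K \<in> cross_matchings (A - \<Union>?M) (B - \<Union>?N)"
      unfolding cross_matchings_def by blast
    moreover have "?M \<in> matchings A" "?N \<in> matchings B"
      by (intro matchings_subset[OF M]; blast)+
    ultimately show "((?M, ?N), ?K) \<in> ?S" by simp
  qed
qed

lemma bij_betw_matchings_image:
  assumes "inj_on f A"
  shows "bij_betw ((`) ((`) f)) (matchings A) (matchings (f ` A))"
proof -
  have "inj_on ((`) ((`) f)) (matchings A)"
    using matchings_Union
    by (intro inj_on_subset[OF inj_on_image_Pow[OF inj_on_image_Pow[OF assms]]]) fastforce
  moreover have "N \<in> (`) ((`) f) ` matchings A" if N: "N \<in> matchings (f ` A)" for N
  proof
    let ?g = "inv_into A f"
    have fg: "f ` ?g ` P = P" if "P \<in> N" for P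
    proof -
      have "P \<subseteq> f ` A" using that matchings_Union[OF N] by blast
      then show ?thesis by (rule image_inv_into_cancel[OF refl])
    qed
    have "(\<lambda>P. f ` ?g ` P) ` N = (\<lambda>P. P) ` N" by (rule image_cong[OF refl fg])
    then show "N = (`) f ` (`) ?g ` N" by (subst image_image) simp
    have "(`) ?g ` N \<in> matchings (?g ` (f ` A))"
      by (rule matchings_image[OF inj_on_inv_into[OF order_refl] N])
    then show "(`) ?g ` N \<in> matchings A" using inv_into_image_cancel[OF assms order_refl] by simp
  qed
  ultimately show ?thesis using matchings_image[OF assms] unfolding bij_betw_def by blast
qed

lemma bij_betw_cross_matchings_image:
  assumes "inj_on f (A \<union> B)"
  shows "bij_betw ((`) ((`) f)) (cross_matchings A B) (cross_matchings (f ` A) (f ` B))"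
proof -
  have sub: "f ` P \<subseteq> f ` C \<longleftrightarrow> P \<subseteq> C" if "P \<subseteq> A \<union> B" "C \<subseteq> A \<union> B" for P C
    using inj_on_image_mem_iff[OF assms _ that(2)] that(1) by blast
  have iff: "(`) f ` M \<in> cross_matchings (f ` A) (f ` B) \<longleftrightarrow> M \<in> cross_matchings A B"
    if M: "M \<in> matchings (A \<union> B)" for M
  proof -
    have "\<not> f ` P \<subseteq> f ` A \<and> \<not> f ` P \<subseteq> f ` B \<longleftrightarrow> \<not> P \<subseteq> A \<and> \<not> P \<subseteq> B" if "P \<in> M" for P
    proof -
      have "P \<subseteq> A \<union> B" using matchings_Union[OF M] that by blast
      then show ?thesis using sub[of P A] sub[of P B] by simp
    qed
    then show ?thesis
      using M matchings_image[OF assms M] by (simp add: cross_matchings_def image_Un)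
  qed
  have bij: "bij_betw ((`) ((`) f)) (matchings (A \<union> B)) (matchings (f ` A \<union> f ` B))"
    using bij_betw_matchings_image[OF assms] by (simp add: image_Un)
  have "(`) ((`) f) ` cross_matchings A B = cross_matchings (f ` A) (f ` B)"
  proof (intro equalityI subsetI)
    fix N assume "N \<in> (`) ((`) f) ` cross_matchings A B"
    then obtain M where "M \<in> cross_matchings A B" "N = (`) f ` M" by blast
    then show "N \<in> cross_matchings (f ` A) (f ` B)" using iff[of M] by (simp add: cross_matchings_def)
  next
    fix N assume N: "N \<in> cross_matchings (f ` A) (f ` B)"
    then have "N \<in> matchings (f ` A \<union> f ` B)" by (simp add: cross_matchings_def)
    then obtain M where "M \<in> matchings (A \<union> B)" "N = (`) f ` M"
      using bij unfolding bij_betw_def by blast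
    then show "N \<in> (`) ((`) f) ` cross_matchings A B" using iff[of M] N by blast
  qed
  moreover have "inj_on ((`) ((`) f)) (cross_matchings A B)"
    using bij_betw_imp_inj_on[OF bij] by (rule inj_on_subset) (auto simp: cross_matchings_def)
  ultimately show ?thesis by (simp add: bij_betw_def)
qed

lemma card_cross_matching:
  fixes A B :: "'a::linorder set"
  assumes "finite A" "finite B" "M \<in> cross_matchings A B"
  shows "card M \<le> card A" "card M \<le> card B"
proof -
  have M: "M \<in> matchings (A \<union> B)" using assms(3) by (simp add: cross_matchings_def)
  have bound: "card M \<le> card C" if C: "finite C" "\<And>P. P \<in> M \<Longrightarrow> P \<inter> C \<noteq> {}" for C
  proof (rule card_inj_on_le[of "\<lambda>P. Min (P \<inter> C)"])
    have in_C: "Min (P \<inter> C) \<in> P \<inter> C" if "P \<in> M" for P using C that by (intro Min_in) auto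
    show "inj_on (\<lambda>P. Min (P \<inter> C)) M"
      using in_C matchings_unique[OF M] by (intro inj_onI) (metis IntD1)
    show "(\<lambda>P. Min (P \<inter> C)) ` M \<subseteq> C" using in_C by blast
  qed (rule C(1))
  have "P \<subseteq> A \<union> B" if "P \<in> M" for P using matchings_Union[OF M] that by blast
  then have "P \<inter> A \<noteq> {}" "P \<inter> B \<noteq> {}" if "P \<in> M" for P
    using assms(3) that unfolding cross_matchings_def by blast+
  then show "card M \<le> card A" "card M \<le> card B" using bound assms(1,2) by simp_all
qed


section \<open>Linear maps on tensors and group tensors\<close>

lemmas clinear_add = module_hom.add[OF module_hom_iff_linear[THEN iffD2]]
  and clinear_scale = module_hom.scale[OF module_hom_iff_linear[THEN iffD2]]
  and clinear_zero = module_hom.zero[OF module_hom_iff_linear[THEN iffD2]]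
  and clinear_sum = module_hom.sum[OF module_hom_iff_linear[THEN iffD2]]

lemma clinear_compose: "clinear f \<Longrightarrow> clinear g \<Longrightarrow> clinear (\<lambda>x. g (f x))"
  by (rule clinearI) (simp_all add: clinear_add clinear_scale)

lemma clinear_sum_fun:
  assumes "\<And>i. i \<in> I \<Longrightarrow> clinear (f i)"
  shows "clinear (\<lambda>x. \<Sum>i\<in>I. f i x)"
  by (rule clinearI)
    (simp_all add: clinear_add[OF assms] clinear_scale[OF assms] sum.distrib cv.scale_sum_right cong: sum.cong)

lemma clinear_scale_fun: "clinear f \<Longrightarrow> clinear (\<lambda>x. c *\<^sub>C f x)"
  by (rule clinearI) (simp_all add: clinear_add clinear_scale scaleC_add_right mult.commute)

lemma clinear_single: "clinear (Poly_Mapping.single k)"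
  by (rule clinearI) (auto intro!: poly_mapping_eqI simp: lookup_add lookup_single when_def)

lemma clinear_eq_on_span:
  assumes "clinear f" "clinear g" "\<And>x. x \<in> S \<Longrightarrow> f x = g x" "x \<in> cv.span S"
  shows "f x = g x"
  using assms(4)
proof (induction rule: cv.span_induct)
  case base
  show ?case
    by (auto simp: cv.subspace_def clinear_zero[OF assms(1)] clinear_zero[OF assms(2)]
        clinear_add[OF assms(1)] clinear_add[OF assms(2)] clinear_scale[OF assms(1)] clinear_scale[OF assms(2)])
qed (rule assms(3))

lemma tensor_in_span_pure: "F \<in> cv.span (range pure_tensor)"
proof (induction F)
  case (1 p)
  have lin: "clinear (abs_tensor :: ('a list \<Rightarrow>\<^sub>0 complex) \<Rightarrow> 'a tensor)"
    by (rule clinearI) (simp_all add: plus_tensor.abs_eq scaleC_tensor.abs_eq)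
  have "p = lin_ext (\<lambda>k. Poly_Mapping.single k 1) p"
    by (rule poly_mapping_eqI)
      (auto simp: lin_ext_def lookup_sum lookup_single when_def scaleC_complex_def in_keys_iff sum.delta
        if_distrib[of "(*) _"] cong: if_cong)
  then have "abs_tensor p = (\<Sum>k\<in>Poly_Mapping.keys p. Poly_Mapping.lookup p k *\<^sub>C pure_tensor k)"
    by (metis (no_types, lifting) lin_ext_def clinear_sum[OF lin] clinear_scale[OF lin] pure_tensor.abs_eq sum.cong)
  then show ?case by (simp only:) (intro cv.span_sum cv.span_scale cv.span_base rangeI)
qed

lemma tpow_subset_span: "tpow n \<subseteq> cv.span {pure_tensor hs | hs. length hs = n}"
  unfolding tpow_def
  by (rule rv.span_minimal[OF cv.span_superset])
    (auto simp: rv.subspace_def intro: cv.span_zero cv.span_add cv.span_scale)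

lemma clinear_eq_on_tpow:
  fixes F :: "'a::real_vector tensor"
  assumes "clinear f" "clinear g" "\<And>hs. length hs = n \<Longrightarrow> f (pure_tensor hs) = g (pure_tensor hs)"
    and "F \<in> tpow n"
  shows "f F = g F"
proof -
  have "F \<in> cv.span {pure_tensor hs | hs. length hs = n}" using assms(4) tpow_subset_span by blast
  then show ?thesis
  proof (rule clinear_eq_on_span[OF assms(1,2), rotated])
    fix x :: "'a tensor" assume "x \<in> {pure_tensor hs | hs. length hs = n}"
    then show "f x = g x" using assms(3) by blast
  qed
qed

lemma pure_in_tpow: "length hs = n \<Longrightarrow> pure_tensor hs \<in> tpow n"
  unfolding tpow_def by (rule rv.span_base) blast

text \<open>
  Stating multilinearity with list updates lets the remaining letters keep their positions.
\<close>

lemma multilinear_updateI: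
  assumes "\<And>hs i a b. i < length hs \<Longrightarrow> f (hs[i := a + b]) = f (hs[i := a]) + f (hs[i := b])"
    and "\<And>hs i r a. i < length hs \<Longrightarrow> f (hs[i := r *\<^sub>R a]) = complex_of_real r *\<^sub>C f (hs[i := a])"
  shows "multilinear f"
  unfolding multilinear_def
proof (intro conjI allI)
  fix us vs :: "'a list" and a b r
  have *: "us @ c # vs = (us @ a # vs)[length us := c]" for c by simp
  show "f (us @ (a + b) # vs) = f (us @ a # vs) + f (us @ b # vs)"
    unfolding *[of "a + b"] *[of b] using assms(1)[of "length us" "us @ a # vs" a b] by simp
  show "f (us @ (r *\<^sub>R a) # vs) = complex_of_real r *\<^sub>C f (us @ a # vs)"
    unfolding *[of "r *\<^sub>R a"] using assms(2)[of "length us" "us @ a # vs" r a] by simp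
qed

lemma pure_tensor_lookups:
  assumes "distinct js" "inj_on g (set js)" "i \<in> g ` set js" "i < length hs"
  shows "pure_tensor (map (\<lambda>j. hs[i := a + b] ! g j) js) =
      pure_tensor (map (\<lambda>j. hs[i := a] ! g j) js) + pure_tensor (map (\<lambda>j. hs[i := b] ! g j) js)"
    and "pure_tensor (map (\<lambda>j. hs[i := r *\<^sub>R a] ! g j) js) =
      complex_of_real r *\<^sub>C pure_tensor (map (\<lambda>j. hs[i := a] ! g j) js)"
proof -
  have len: "length (take i hs) \<in> g ` set js" using assms(3,4) by simp
  note ml = multilinear_lookups[OF assms(1,2) len, where vs = "drop (Suc i) hs"]
  show "pure_tensor (map (\<lambda>j. hs[i := a + b] ! g j) js) =
      pure_tensor (map (\<lambda>j. hs[i := a] ! g j) js) + pure_tensor (map (\<lambda>j. hs[i := b] ! g j) js)"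
    using ml(1)[of a b] by (simp add: upd_conv_take_nth_drop[OF assms(4)])
  show "pure_tensor (map (\<lambda>j. hs[i := r *\<^sub>R a] ! g j) js) =
      complex_of_real r *\<^sub>C pure_tensor (map (\<lambda>j. hs[i := a] ! g j) js)"
    using ml(2)[of r a] by (simp add: upd_conv_take_nth_drop[OF assms(4)])
qed

lemma
  fixes hs :: "'a::real_vector list"
  assumes "\<sigma> \<in> S1 n"
  shows clinear_U: "clinear (U n \<sigma> :: 'a tensor \<Rightarrow> 'a tensor)"
    and U_pure_other: "length hs \<noteq> n \<Longrightarrow> U n \<sigma> (pure_tensor hs) = 0"
proof -
  let ?f = "\<lambda>hs :: 'a list. if length hs = n
     then pure_tensor (map (\<lambda>i. hs ! (inv \<sigma> i - 1)) [1..<Suc n]) else 0"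
  have p: "inv \<sigma> permutes {1..n}" using assms by (simp add: S1_def permutes_inv)
  have set: "set [1..<Suc n] = {1..n}" by auto
  have "inj_on ((\<lambda>i. i - 1) \<circ> inv \<sigma>) {1..n}"
  proof (rule comp_inj_on[OF permutes_inj_on[OF p]])
    show "inj_on (\<lambda>i. i - 1) (inv \<sigma> ` {1..n})" unfolding permutes_image[OF p] by (auto simp: inj_on_def)
  qed
  then have inj: "inj_on (\<lambda>i. inv \<sigma> i - 1) (set [1..<Suc n])" by (simp only: set o_def)
  have im: "i \<in> (\<lambda>i. inv \<sigma> i - 1) ` set [1..<Suc n]" if "i < n" for i
  proof -
    have "Suc i \<in> inv \<sigma> ` {1..n}" using that permutes_image[OF p] by auto
    then obtain x where "x \<in> {1..n}" "Suc i = inv \<sigma> x" by blast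
    then show ?thesis unfolding set by (intro image_eqI[of _ _ x]) auto
  qed
  have ml: "multilinear ?f"
  proof (rule multilinear_updateI)
    fix hs :: "'a list" and i a b r assume i: "i < length hs"
    show "?f (hs[i := a + b]) = ?f (hs[i := a]) + ?f (hs[i := b])"
      using pure_tensor_lookups(1)[OF distinct_upt inj im i, of a b] i
      by (cases "length hs = n") (simp_all del: upt_Suc One_nat_def)
    show "?f (hs[i := r *\<^sub>R a]) = complex_of_real r *\<^sub>C ?f (hs[i := a])"
      using pure_tensor_lookups(2)[OF distinct_upt inj im i, of r a] i
      by (cases "length hs = n") (simp_all del: upt_Suc One_nat_def)
  qed
  show "clinear (U n \<sigma> :: 'a tensor \<Rightarrow> 'a tensor)"
    unfolding U_def by (rule tensor_lift_linear[OF ml])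
  show "length hs \<noteq> n \<Longrightarrow> U n \<sigma> (pure_tensor hs) = 0"
    using tensor_lift_pure[OF ml, of hs] by (simp add: U_def)
qed

subsection \<open>Partitions into singletons and pairs as matchings\<close>

lemma pairs_P12: "\<pi> \<in> P12 n \<Longrightarrow> pairs \<pi> \<in> matchings {1..n}"
  unfolding P12_def pairs_def matchings_def partition_on_def
  by (auto intro: pairwise_subset)

lemma involution_pairs: "involution (pairs \<pi>) = involution \<pi>"
proof
  fix x
  have "pairs (pairs \<pi>) = pairs \<pi>" by (auto simp: pairs_def)
  moreover have "y \<noteq> x \<and> {x, y} \<in> pairs \<pi> \<longleftrightarrow> y \<noteq> x \<and> {x, y} \<in> \<pi>" for y by (auto simp: pairs_def)
  ultimately show "involution (pairs \<pi>) x = involution \<pi> x" by (simp add: involution_def supp_def)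
qed

lemma bij_betw_pairs: "bij_betw pairs (P12 n) (matchings {1..n})"
proof (rule bij_betw_byWitness[where f' = "\<lambda>M. M \<union> (\<lambda>x. {x}) ` ({1..n} - \<Union>M)"])
  show "\<forall>\<pi>\<in>P12 n. pairs \<pi> \<union> (\<lambda>x. {x}) ` ({1..n} - \<Union>(pairs \<pi>)) = \<pi>"
  proof
    fix \<pi> assume "\<pi> \<in> P12 n"
    then have part: "partition_on {1..n} \<pi>" and card: "\<And>B. B \<in> \<pi> \<Longrightarrow> card B = 1 \<or> card B = 2"
      by (auto simp: P12_def)
    have disj: "B = C" if "B \<in> \<pi>" "C \<in> \<pi>" "x \<in> B" "x \<in> C" for B C x
      using partition_onD2[OF part] that unfolding disjoint_def by blast
    have "B \<in> pairs \<pi> \<union> (\<lambda>x. {x}) ` ({1..n} - \<Union>(pairs \<pi>))" if B: "B \<in> \<pi>" for B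
    proof (cases "card B = 2")
      case False
      then have "card B = 1" using card[OF B] by simp
      then obtain x where x: "B = {x}" by (auto simp: card_1_singleton_iff)
      have "x \<in> {1..n}" using partition_onD1[OF part] B x by blast
      moreover have "x \<notin> C" if "C \<in> pairs \<pi>" for C
        using disj[OF B, of C x] that x by (auto simp: pairs_def)
      ultimately show ?thesis using x by blast
    qed (use B in \<open>simp add: pairs_def\<close>)
    moreover have "{x} \<in> \<pi>" if x: "x \<in> {1..n}" "x \<notin> \<Union>(pairs \<pi>)" for x
    proof -
      obtain B where B: "B \<in> \<pi>" "x \<in> B" using partition_onD1[OF part] x(1) by blast
      then have "card B = 1" using card[OF B(1)] x(2) by (auto simp: pairs_def)
      then have "B = {x}" using B(2) by (auto simp: card_1_singleton_iff)
      then show ?thesis using B(1) by simp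
    qed
    ultimately show "pairs \<pi> \<union> (\<lambda>x. {x}) ` ({1..n} - \<Union>(pairs \<pi>)) = \<pi>"
      by (auto simp: pairs_def)
  qed
  show "\<forall>M\<in>matchings {1..n}. pairs (M \<union> (\<lambda>x. {x}) ` ({1..n} - \<Union>M)) = M"
    by (auto simp: pairs_def matchings_def)
  show "pairs ` P12 n \<subseteq> matchings {1..n}" using pairs_P12 by blast
  show "(\<lambda>M. M \<union> (\<lambda>x. {x}) ` ({1..n} - \<Union>M)) ` matchings {1..n} \<subseteq> P12 n"
  proof (rule image_subsetI)
    fix M assume M: "M \<in> matchings {1..n}"
    let ?S = "(\<lambda>x. {x}) ` ({1..n} - \<Union>M)"
    have "disjoint (M \<union> ?S)"
      using M by (intro disjoint_union) (auto simp: matchings_def disjoint_def)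
    moreover have "\<Union>(M \<union> ?S) = {1..n}" using matchings_Union[OF M] by auto
    moreover have "{} \<notin> M \<union> ?S" using M by (auto simp: matchings_def)
    ultimately show "M \<union> ?S \<in> P12 n" using M by (auto simp: P12_def partition_on_def matchings_def)
  qed
qed

lemma bij_betw_pairs_bip: "bij_betw pairs (P12_bip n k) (cross_matchings {1..n} {n + 1..n + k})"
proof -
  have eq: "{1..n} \<union> {n + 1..n + k} = {1..n + k}" by auto
  have "bij_betw pairs (P12_bip n k) (pairs ` P12_bip n k)"
    by (rule inj_on_imp_bij_betw[OF inj_on_subset[OF bij_betw_imp_inj_on[OF bij_betw_pairs[of "n + k"]]]])
      (auto simp: P12_bip_def)
  moreover have "(\<forall>i j. i < j \<and> {i, j} \<in> \<pi> \<longrightarrow> i \<le> n \<and> n < j) \<longleftrightarrow>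
      (\<forall>P\<in>pairs \<pi>. \<not> P \<subseteq> {1..n} \<and> \<not> P \<subseteq> {n + 1..n + k})" if \<pi>: "\<pi> \<in> P12 (n + k)" for \<pi>
  proof
    assume *: "\<forall>i j. i < j \<and> {i, j} \<in> \<pi> \<longrightarrow> i \<le> n \<and> n < j"
    show "\<forall>P\<in>pairs \<pi>. \<not> P \<subseteq> {1..n} \<and> \<not> P \<subseteq> {n + 1..n + k}"
    proof
      fix P assume P: "P \<in> pairs \<pi>"
      then obtain a b where "P = {a, b}" "a \<noteq> b" "P \<in> \<pi>" by (auto simp: pairs_def card_2_iff)
      then obtain i j where ij: "P = {i, j}" "i < j" by (metis insert_commute linorder_neqE)
      then have "i \<le> n" "n < j" using * \<open>P \<in> \<pi>\<close> by auto
      then show "\<not> P \<subseteq> {1..n} \<and> \<not> P \<subseteq> {n + 1..n + k}" using ij by auto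
    qed
  next
    assume *: "\<forall>P\<in>pairs \<pi>. \<not> P \<subseteq> {1..n} \<and> \<not> P \<subseteq> {n + 1..n + k}"
    show "\<forall>i j. i < j \<and> {i, j} \<in> \<pi> \<longrightarrow> i \<le> n \<and> n < j"
    proof (intro allI impI)
      fix i j assume ij: "i < j \<and> {i, j} \<in> \<pi>"
      then have P: "{i, j} \<in> pairs \<pi>" by (simp add: pairs_def)
      then have sub: "{i, j} \<subseteq> {1..n + k}" using matchings_Union[OF pairs_P12[OF \<pi>]] by blast
      have "\<not> {i, j} \<subseteq> {1..n}" "\<not> {i, j} \<subseteq> {n + 1..n + k}" using * P by blast+
      then show "i \<le> n \<and> n < j" using sub ij by auto
    qed
  qed
  then have "pairs ` P12_bip n k = {M \<in> pairs ` P12 (n + k). \<forall>P\<in>M. \<not> P \<subseteq> {1..n} \<and> \<not> P \<subseteq> {n + 1..n + k}}"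
    unfolding P12_bip_def by blast
  then have "pairs ` P12_bip n k = cross_matchings {1..n} {n + 1..n + k}"
    using bij_betw_imp_surj_on[OF bij_betw_pairs[of "n + k"]] by (simp only: cross_matchings_def eq)
  ultimately show ?thesis by simp
qed

subsection \<open>Linearity of the operators\<close>

text \<open>
  Each letter enters a contracted word exactly once: in one inner product if its position
  belongs to a pair, and otherwise as a letter of the remaining word.
\<close>

lemma multilinear_contract_word:
  assumes "\<pi> \<in> P12 n"
  shows "multilinear (contract_word n \<pi> :: 'a::real_inner list \<Rightarrow> 'a tensor)"
proof -
  let ?M = "pairs \<pi>" and ?js = "sorted_list_of_set ({1..n} - supp \<pi>)"
  let ?h = "\<lambda>hs u. hs ! (u - 1)"
  let ?c = "\<lambda>hs B. inner (hs ! (Min B - 1)) (hs ! (Max B - 1))"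
  let ?w = "\<lambda>hs. pure_tensor (map (\<lambda>u. hs ! (u - 1)) ?js)"
  have M: "?M \<in> matchings {1..n}" by (rule pairs_P12[OF assms])
  have fin: "finite ?M" by (rule finite_matching[OF _ M]) simp
  have edge: "\<exists>x y. B = {x, y} \<and> x \<noteq> y \<and> x \<in> {1..n} \<and> y \<in> {1..n}" if B: "B \<in> ?M" for B
  proof -
    have "card B = 2" "B \<subseteq> {1..n}" using B M by (simp_all add: matchings_def)
    then show ?thesis unfolding card_2_iff by blast
  qed
  have const: "?c (hs[i := c]) B = ?c hs B" if B: "B \<in> ?M" "Suc i \<notin> B" for i c B and hs :: "'a list"
  proof -
    obtain x y where xy: "B = {x, y}" "x \<noteq> y" "x \<in> {1..n}" "y \<in> {1..n}" using edge[OF B(1)] by blast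
    then have "x - 1 \<noteq> i" "y - 1 \<noteq> i" using B(2) by auto
    then show ?thesis
      using inner_edge[OF xy(2), of "?h hs"] inner_edge[OF xy(2), of "?h (hs[i := c])"] xy(1) by simp
  qed
  have expand: "contract_word n \<pi> hs = complex_of_real (\<Prod>B\<in>?M. ?c hs B) *\<^sub>C ?w hs"
    if "length hs = n" for hs :: "'a list"
    using that by (simp add: contract_word_def)
  have "contract_word n \<pi> (hs[i := a + b]) = contract_word n \<pi> (hs[i := a]) + contract_word n \<pi> (hs[i := b]) \<and>
      contract_word n \<pi> (hs[i := r *\<^sub>R a]) = complex_of_real r *\<^sub>C contract_word n \<pi> (hs[i := a])"
    if i: "i < length hs" for hs :: "'a list" and i a b r
  proof (cases "length hs = n")
    case False
    then show ?thesis by (simp add: contract_word_def)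
  next
    case len: True
    show ?thesis
    proof (cases "Suc i \<in> \<Union>?M")
      case True
      then obtain B where B: "B \<in> ?M" "Suc i \<in> B" by blast
      obtain y where y: "y \<noteq> Suc i" "B = {Suc i, y}" using matchings_edge[OF M B] .
      have "y \<in> {1..n}" using B(1) y(2) matchings_Union[OF M] by blast
      then have "y - 1 \<noteq> i" using y(1) by (cases y) auto
      have "?c (hs[i := c]) B = inner c (hs ! (y - 1))" for c
        using inner_edge[OF y(1), of "?h (hs[i := c])"] i \<open>y - 1 \<noteq> i\<close>
        by (simp add: y(2) insert_commute inner_commute)
      moreover have "(\<Prod>B\<in>?M - {B}. ?c (hs[i := c]) B) = (\<Prod>B\<in>?M - {B}. ?c hs B)" for c
        using matchings_unique[OF M _ B(1) _ B(2)] by (intro prod.cong refl const) auto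
      ultimately have prod: "(\<Prod>B\<in>?M. ?c (hs[i := c]) B) = inner c (hs ! (y - 1)) * (\<Prod>B\<in>?M - {B}. ?c hs B)" for c
        by (simp add: prod.remove[OF fin B(1)])
      have "map (\<lambda>u. hs[i := c] ! (u - 1)) ?js = map (\<lambda>u. hs ! (u - 1)) ?js" for c
      proof (rule map_cong[OF refl])
        fix u assume "u \<in> set ?js"
        then have "u \<in> {1..n} - \<Union>?M" by (simp add: supp_def)
        then have "u - 1 \<noteq> i" using True by (cases u) auto
        then show "hs[i := c] ! (u - 1) = hs ! (u - 1)" by simp
      qed
      then have word: "?w (hs[i := c]) = ?w hs" for c by (rule arg_cong)
      show ?thesis
        using len by (simp only: expand length_list_update prod word)
          (simp add: inner_add_left distrib_right scaleC_add_left scaleC_scaleC mult.assoc)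
    next
      case False
      have prod: "(\<Prod>B\<in>?M. ?c (hs[i := c]) B) = (\<Prod>B\<in>?M. ?c hs B)" for c
        using False by (intro prod.cong refl const) auto
      have inj: "inj_on (\<lambda>u. u - 1) (set ?js)" by (auto simp: inj_on_def)
      have mem: "i \<in> (\<lambda>u. u - 1) ` set ?js"
        using False i len by (auto simp: image_iff supp_def intro!: bexI[of _ "Suc i"])
      note word = pure_tensor_lookups[OF distinct_sorted_list_of_set inj mem i]
      show ?thesis
        using len by (simp only: expand length_list_update prod word)
          (simp add: scaleC_add_right scaleC_scaleC mult.commute)
    qed
  qed
  then show ?thesis by (intro multilinear_updateI) blast+
qed

lemma clinear_contract_tensor: "\<pi> \<in> P12 n \<Longrightarrow> clinear (contract_tensor n \<pi>)"
  unfolding contract_tensor_def by (intro tensor_lift_linear multilinear_contract_word)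

text \<open>
  The linear map on group tensors with prescribed restrictions to the summands of the
  permutations. Symmetrization and contraction are of this form.
\<close>

definition on_coeffs ::
    "('k \<Rightarrow> 'b \<Rightarrow> 'c::complex_vector) \<Rightarrow> ('k \<Rightarrow>\<^sub>0 'b::complex_vector) \<Rightarrow> 'c" where
  "on_coeffs f \<xi> = (\<Sum>\<alpha>\<in>Poly_Mapping.keys \<xi>. f \<alpha> (Poly_Mapping.lookup \<xi> \<alpha>))"

lemma on_coeffs_superset:
  assumes "\<And>\<alpha>. clinear (f \<alpha>)" "finite A" "Poly_Mapping.keys \<xi> \<subseteq> A"
  shows "on_coeffs f \<xi> = (\<Sum>\<alpha>\<in>A. f \<alpha> (Poly_Mapping.lookup \<xi> \<alpha>))"
  unfolding on_coeffs_def using assms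
  by (intro sum.mono_neutral_left) (auto simp: in_keys_iff clinear_zero[OF assms(1)])

lemma on_coeffs_single: "(\<And>\<alpha>. clinear (f \<alpha>)) \<Longrightarrow> on_coeffs f (Poly_Mapping.single \<alpha> F) = f \<alpha> F"
  by (subst on_coeffs_superset[of f "{\<alpha>}"]) auto

lemma clinear_on_coeffs:
  assumes "\<And>\<alpha>. clinear (f \<alpha>)"
  shows "clinear (on_coeffs f)"
proof (rule clinearI)
  fix \<xi> \<eta> :: "'a \<Rightarrow>\<^sub>0 'b" and c
  let ?A = "Poly_Mapping.keys \<xi> \<union> Poly_Mapping.keys \<eta>"
  show "on_coeffs f (\<xi> + \<eta>) = on_coeffs f \<xi> + on_coeffs f \<eta>"
    by (subst (1 2 3) on_coeffs_superset[OF assms, of ?A])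
      (auto simp: lookup_add clinear_add[OF assms] sum.distrib dest: set_mp[OF Poly_Mapping.keys_add])
  show "on_coeffs f (c *\<^sub>C \<xi>) = c *\<^sub>C on_coeffs f \<xi>"
    by (subst (1 2) on_coeffs_superset[OF assms, of "Poly_Mapping.keys \<xi>"])
      (auto simp: in_keys_iff cv.scale_sum_right clinear_scale[OF assms])
qed

lemma gtens_single: "Poly_Mapping.single \<alpha> c \<otimes>\<^sub>G F = Poly_Mapping.single \<alpha> (c *\<^sub>C F)"
  by (simp add: gtens_def clinear_scale[OF clinear_single])

lemma gtens_gr: "gr \<alpha> \<otimes>\<^sub>G F = Poly_Mapping.single \<alpha> F"
  by (simp add: gr_def gtens_single scaleC_one)

lemma symmetrize_on_coeffs:
  "symmetrize n = on_coeffs (\<lambda>\<alpha> F. (1 / fact n) *\<^sub>C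
     (\<Sum>\<sigma>\<in>S1 n. Poly_Mapping.single (\<sigma> \<circ> \<alpha> \<circ> inv \<sigma>) (U n \<sigma> F)))"
  unfolding symmetrize_def[abs_def] on_coeffs_def[abs_def] cv.scale_sum_right[symmetric]
  by (subst sum.swap) (rule refl)

lemma clinear_symmetrize_coeff:
  "clinear (\<lambda>F. (1 / fact n) *\<^sub>C (\<Sum>\<sigma>\<in>S1 n. Poly_Mapping.single (\<sigma> \<circ> \<alpha> \<circ> inv \<sigma>) (U n \<sigma> F)))"
  by (intro clinear_scale_fun clinear_sum_fun clinear_compose[OF clinear_U clinear_single])

lemma clinear_symmetrize: "clinear (symmetrize n)"
  unfolding symmetrize_on_coeffs by (intro clinear_on_coeffs clinear_symmetrize_coeff)

lemma symmetrize_single: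
  "symmetrize n (Poly_Mapping.single \<alpha> F) =
    (1 / fact n) *\<^sub>C (\<Sum>\<sigma>\<in>S1 n. Poly_Mapping.single (\<sigma> \<circ> \<alpha> \<circ> inv \<sigma>) (U n \<sigma> F))"
  unfolding symmetrize_on_coeffs by (rule on_coeffs_single[OF clinear_symmetrize_coeff])

lemma contract_alg_gr: "contract_alg q n \<pi> (gr \<alpha>) = contract_perm q n \<pi> \<alpha>"
  by (simp add: contract_alg_def gr_def scaleC_one)

lemma contract_on_coeffs:
  "contract q n \<pi> = on_coeffs (\<lambda>\<alpha> F. contract_perm q n \<pi> \<alpha> \<otimes>\<^sub>G contract_tensor n \<pi> F)"
  unfolding contract_def[abs_def] on_coeffs_def[abs_def] contract_alg_gr ..

lemma clinear_gtens: "clinear (\<lambda>F. a \<otimes>\<^sub>G F)"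
  unfolding gtens_def lin_ext_def by (intro clinear_sum_fun clinear_scale_fun clinear_single)

lemma clinear_contract:
  assumes "\<pi> \<in> P12 n"
  shows "clinear (contract q n \<pi>)"
  unfolding contract_on_coeffs
  by (intro clinear_on_coeffs clinear_compose[OF clinear_contract_tensor[OF assms] clinear_gtens])

lemma contract_single:
  assumes "\<pi> \<in> P12 n"
  shows "contract q n \<pi> (Poly_Mapping.single \<alpha> F) = contract_perm q n \<pi> \<alpha> \<otimes>\<^sub>G contract_tensor n \<pi> F"
  unfolding contract_on_coeffs
  by (intro on_coeffs_single clinear_compose[OF clinear_contract_tensor[OF assms] clinear_gtens])


section \<open>Classes of monomials\<close>

text \<open>
  On these group tensors \<open>W n\<close> is linear; elsewhere it need not be, since \<open>Abs_TP\<close> is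
  unspecified outside the span of the symmetrized tensors.
\<close>

definition S0_supported :: "nat \<Rightarrow> 'a::real_vector group_tensor set" where
  "S0_supported n = {\<xi>. Poly_Mapping.keys \<xi> \<subseteq> S0 n}"

lemma subspace_S0_supported: "cv.subspace (S0_supported n)"
  unfolding cv.subspace_def
proof (intro conjI ballI allI)
  fix \<xi> \<eta> :: "'a group_tensor" and c assume \<xi>: "\<xi> \<in> S0_supported n"
  show "\<xi> + \<eta> \<in> S0_supported n" if "\<eta> \<in> S0_supported n"
    using \<xi> that Poly_Mapping.keys_add[of \<xi> \<eta>] by (auto simp: S0_supported_def)
  have "Poly_Mapping.keys (c *\<^sub>C \<xi>) \<subseteq> Poly_Mapping.keys \<xi>" by (auto simp: in_keys_iff)
  then show "c *\<^sub>C \<xi> \<in> S0_supported n" using \<xi> by (auto simp: S0_supported_def)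
qed (simp add: S0_supported_def)

lemma single_S0_supported: "\<alpha> \<in> S0 n \<Longrightarrow> Poly_Mapping.single \<alpha> F \<in> S0_supported n"
  by (simp add: S0_supported_def)

lemma S0_iff_permutes: "\<alpha> \<in> S0 n \<longleftrightarrow> \<alpha> permutes insert 0 {1..n}"
proof -
  have "insert 0 {1..n} = {0..n}" by auto
  then show ?thesis by (simp add: S0_def)
qed

lemma S1_S0: "\<sigma> \<in> S1 n \<Longrightarrow> \<sigma> \<in> S0 n"
  unfolding S0_def S1_def by (auto intro: permutes_subset)

lemma conj_S0:
  assumes "\<alpha> \<in> S0 n" "\<sigma> \<in> S1 n"
  shows "\<sigma> \<circ> \<alpha> \<circ> inv \<sigma> \<in> S0 n"
  using assms S1_S0[OF assms(2)] unfolding S0_def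
  by (auto intro!: permutes_compose permutes_inv)

lemma finite_S1: "finite (S1 n)" and card_S1: "card (S1 n) = fact n"
  unfolding S1_def by (simp_all add: finite_permutations card_permutations)

definition permute_word :: "nat \<Rightarrow> (nat \<Rightarrow> nat) \<Rightarrow> 'a list \<Rightarrow> 'a list" where
  "permute_word n \<sigma> hs = map (\<lambda>i. hs ! (inv \<sigma> i - 1)) [1..<Suc n]"

lemma length_permute_word [simp]: "length (permute_word n \<sigma> hs) = n"
  by (simp add: permute_word_def)

lemma permute_word_nth: "i \<in> {1..n} \<Longrightarrow> permute_word n \<sigma> hs ! (i - 1) = hs ! (inv \<sigma> i - 1)"
  by (cases i) (auto simp: permute_word_def nth_map simp del: upt_Suc)

lemma symmetrize_pure:
  assumes "length hs = n"
  shows "symmetrize n (Poly_Mapping.single \<alpha> (pure_tensor hs)) =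
    (1 / fact n) *\<^sub>C (\<Sum>\<sigma>\<in>S1 n. Poly_Mapping.single (\<sigma> \<circ> \<alpha> \<circ> inv \<sigma>) (pure_tensor (permute_word n \<sigma> hs)))"
  unfolding symmetrize_single permute_word_def using U_pure[OF _ assms]
  by (intro arg_cong[where f = "scaleC _"] sum.cong refl) (simp del: upt_Suc)

lemma symmetrize_pure_other:
  assumes "length hs \<noteq> n"
  shows "symmetrize n (Poly_Mapping.single \<alpha> (pure_tensor hs)) = 0"
proof -
  have "(\<Sum>\<sigma>\<in>S1 n. Poly_Mapping.single (\<sigma> \<circ> \<alpha> \<circ> inv \<sigma>) (U n \<sigma> (pure_tensor hs))) = 0"
    by (intro sum.neutral) (simp add: U_pure_other[OF _ assms])
  then show ?thesis by (simp add: symmetrize_single)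
qed

definition carrier_TP :: "'a::real_vector group_tensor set" where
  "carrier_TP = cv.span {sym_tens n (gr \<alpha>) F | n \<alpha> F. \<alpha> \<in> S0 n \<and> F \<in> tpow n}"

text \<open>
  The coefficients may be any tensors: words whose length is not \<open>n\<close> are sent to \<open>0\<close>.
\<close>

lemma symmetrize_in_carrier:
  assumes "\<xi> \<in> S0_supported n"
  shows "symmetrize n \<xi> \<in> carrier_TP"
proof -
  have "symmetrize n (Poly_Mapping.single \<alpha> F) \<in> carrier_TP" if "\<alpha> \<in> S0 n" for \<alpha> and F :: "'a tensor"
    using tensor_in_span_pure[of F]
  proof (induction rule: cv.span_induct)
    case base
    note lin = clinear_compose[of "Poly_Mapping.single \<alpha>" "symmetrize n", OF clinear_single clinear_symmetrize]
    show ?case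
      unfolding cv.subspace_def carrier_TP_def
      by (simp add: clinear_zero[OF clinear_symmetrize] clinear_add[OF lin] clinear_scale[OF lin]
          cv.span_zero cv.span_add cv.span_scale)
  next
    case (step F)
    then obtain hs where F: "F = pure_tensor hs" by blast
    show ?case
    proof (cases "length hs = n")
      case True
      then have "F \<in> tpow n" using F pure_in_tpow by blast
      then show ?thesis using that unfolding carrier_TP_def
        by (intro cv.span_base) (auto simp: sym_tens_def gtens_gr)
    next
      case False
      then have "symmetrize n (Poly_Mapping.single \<alpha> F) = 0"
        unfolding F by (rule symmetrize_pure_other)
      then show ?thesis by (simp add: carrier_TP_def cv.span_zero)
    qed
  qed
  moreover have "\<xi> = on_coeffs Poly_Mapping.single \<xi>"
    by (rule poly_mapping_eqI)
      (auto simp: on_coeffs_def lookup_sum lookup_single when_def in_keys_iff)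
  then have "symmetrize n \<xi> = (\<Sum>\<alpha>\<in>Poly_Mapping.keys \<xi>.
      symmetrize n (Poly_Mapping.single \<alpha> (Poly_Mapping.lookup \<xi> \<alpha>)))"
    using clinear_sum[OF clinear_symmetrize] unfolding on_coeffs_def by metis
  ultimately show ?thesis
    using assms unfolding S0_supported_def carrier_TP_def by (auto intro!: cv.span_sum)
qed

lemma Rep_W: "\<xi> \<in> S0_supported n \<Longrightarrow> Rep_TP (W n \<xi>) = symmetrize n \<xi>"
  using symmetrize_in_carrier unfolding W_def carrier_TP_def by (intro Abs_TP_inverse)

lemma W_add: "\<xi> \<in> S0_supported n \<Longrightarrow> \<eta> \<in> S0_supported n \<Longrightarrow> W n (\<xi> + \<eta>) = W n \<xi> + W n \<eta>"
  using cv.subspace_add[OF subspace_S0_supported, of \<xi> n \<eta>]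
  by (simp add: Rep_TP_inject[symmetric] plus_TP.rep_eq Rep_W clinear_add[OF clinear_symmetrize])

lemma W_scale: "\<xi> \<in> S0_supported n \<Longrightarrow> W n (c *\<^sub>C \<xi>) = c *\<^sub>C W n \<xi>"
  using cv.subspace_scale[OF subspace_S0_supported, of \<xi> n c]
  by (simp add: Rep_TP_inject[symmetric] scaleC_TP.rep_eq Rep_W clinear_scale[OF clinear_symmetrize])

lemma clinear_W:
  assumes "clinear f" "\<And>x. f x \<in> S0_supported n"
  shows "clinear (\<lambda>x. W n (f x))"
  by (rule clinearI) (simp_all add: clinear_add[OF assms(1)] clinear_scale[OF assms(1)] W_add W_scale assms(2))

text \<open>
  Replacing a monomial by a conjugate one permutes the summands of its symmetrization.
\<close>

lemma W_conj:
  assumes \<alpha>: "\<alpha> \<in> S0 n" and hs: "length hs = n" and \<tau>: "\<tau> \<in> S1 n"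
  shows "W n (Poly_Mapping.single (\<tau> \<circ> \<alpha> \<circ> inv \<tau>) (pure_tensor (permute_word n \<tau> hs))) =
    W n (Poly_Mapping.single \<alpha> (pure_tensor hs))"
proof -
  let ?p = "\<lambda>\<sigma>. Poly_Mapping.single (\<sigma> \<circ> \<alpha> \<circ> inv \<sigma>) (pure_tensor (permute_word n \<sigma> hs))"
  have \<tau>': "\<tau> permutes {1..n}" using \<tau> by (simp add: S1_def)
  have *: "Poly_Mapping.single (\<sigma> \<circ> (\<tau> \<circ> \<alpha> \<circ> inv \<tau>) \<circ> inv \<sigma>) (pure_tensor (permute_word n \<sigma> (permute_word n \<tau> hs))) = ?p (\<sigma> \<circ> \<tau>)"
    if "\<sigma> \<in> S1 n" for \<sigma>
  proof -
    have \<sigma>: "\<sigma> permutes {1..n}" using that by (simp add: S1_def)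
    have inv: "inv (\<sigma> \<circ> \<tau>) = inv \<tau> \<circ> inv \<sigma>"
      using permutes_bij[OF \<sigma>] permutes_bij[OF \<tau>'] by (simp add: o_inv_distrib)
    have "permute_word n \<sigma> (permute_word n \<tau> hs) = permute_word n (\<sigma> \<circ> \<tau>) hs"
    proof (rule nth_equalityI)
      fix j assume "j < length (permute_word n \<sigma> (permute_word n \<tau> hs))"
      then have i: "Suc j \<in> {1..n}" by simp
      then have "inv \<sigma> (Suc j) \<in> {1..n}" using permutes_in_image[OF permutes_inv[OF \<sigma>]] by blast
      then show "permute_word n \<sigma> (permute_word n \<tau> hs) ! j = permute_word n (\<sigma> \<circ> \<tau>) hs ! j"
        using permute_word_nth[OF i, of \<sigma> "permute_word n \<tau> hs"] permute_word_nth[OF i, of "\<sigma> \<circ> \<tau>" hs] permute_word_nth[of "inv \<sigma> (Suc j)" n \<tau> hs]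
        by (simp add: inv)
    qed simp
    then show ?thesis by (simp add: inv o_assoc)
  qed
  have "(\<Sum>\<sigma>\<in>S1 n. ?p (\<sigma> \<circ> \<tau>)) = (\<Sum>\<sigma>\<in>S1 n. ?p \<sigma>)"
  proof (rule sum.reindex_bij_witness[of _ "\<lambda>\<sigma>. \<sigma> \<circ> inv \<tau>" "\<lambda>\<sigma>. \<sigma> \<circ> \<tau>"])
    fix \<sigma> assume "\<sigma> \<in> S1 n"
    then show "\<sigma> \<circ> \<tau> \<in> S1 n" "\<sigma> \<circ> inv \<tau> \<in> S1 n"
      using \<tau>' by (simp_all add: S1_def permutes_compose permutes_inv)
  qed (simp_all add: comp_assoc permutes_inv_o[OF \<tau>'])
  then have "symmetrize n (Poly_Mapping.single (\<tau> \<circ> \<alpha> \<circ> inv \<tau>) (pure_tensor (permute_word n \<tau> hs))) =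
      symmetrize n (Poly_Mapping.single \<alpha> (pure_tensor hs))"
    using * by (simp add: symmetrize_pure hs)
  then show ?thesis by (simp add: W_def)
qed

text \<open>
  A linear map that takes the same value on all conjugates of a monomial takes this value on
  its symmetrization. This is how identities verified for monomials pass to \<open>'a TP\<close>.
\<close>

lemma symmetrize_average:
  assumes \<alpha>: "\<alpha> \<in> S0 n" and hs: "length hs = n"
    and add: "\<And>\<xi> \<eta>. \<xi> \<in> S0_supported n \<Longrightarrow> \<eta> \<in> S0_supported n \<Longrightarrow> G (\<xi> + \<eta>) = G \<xi> + G \<eta>"
    and scale: "\<And>c \<xi>. \<xi> \<in> S0_supported n \<Longrightarrow> G (c *\<^sub>C \<xi>) = c *\<^sub>C (G \<xi> :: 'b::complex_vector)"
    and G: "\<And>\<sigma>. \<sigma> \<in> S1 n \<Longrightarrow>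
      G (Poly_Mapping.single (\<sigma> \<circ> \<alpha> \<circ> inv \<sigma>) (pure_tensor (permute_word n \<sigma> hs))) = v"
  shows "G (symmetrize n (Poly_Mapping.single \<alpha> (pure_tensor hs))) = v"
proof -
  define p where "p \<sigma> = Poly_Mapping.single (\<sigma> \<circ> \<alpha> \<circ> inv \<sigma>) (pure_tensor (permute_word n \<sigma> hs))" for \<sigma>
  have mem: "p \<sigma> \<in> S0_supported n" if "\<sigma> \<in> S1 n" for \<sigma>
    unfolding p_def by (rule single_S0_supported[OF conj_S0[OF \<alpha> that]])
  have zero: "G 0 = 0" using scale[of 0 0] cv.subspace_0[OF subspace_S0_supported, of n] by simp
  have "G (sum p I) = of_nat (card I) *\<^sub>C v \<and> sum p I \<in> S0_supported n" if "finite I" "I \<subseteq> S1 n" for I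
    using that
  proof (induction I)
    case empty
    then show ?case using zero cv.subspace_0[OF subspace_S0_supported] by simp
  next
    case (insert \<sigma> I)
    then show ?case
      using mem[of \<sigma>] G[of \<sigma>, folded p_def] cv.subspace_add[OF subspace_S0_supported, of "p \<sigma>" n "sum p I"]
      by (simp add: add scaleC_add_left scaleC_one)
  qed
  from this[OF finite_S1 order_refl] show ?thesis
    by (simp add: symmetrize_pure[OF hs] p_def[symmetric] scale scaleC_scaleC card_S1 scaleC_one)
qed

lemma W_symmetrize:
  assumes "\<alpha> \<in> S0 n"
  shows "W n (sym_tens n (gr \<alpha>) F) = W n (Poly_Mapping.single \<alpha> F)"
proof -
  have mem: "symmetrize n (Poly_Mapping.single \<alpha> F) \<in> S0_supported n" for F
    unfolding symmetrize_single using conj_S0[OF assms]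
    by (intro cv.subspace_scale[OF subspace_S0_supported] cv.subspace_sum[OF subspace_S0_supported] single_S0_supported)
  have "W n (symmetrize n (Poly_Mapping.single \<alpha> F)) = W n (Poly_Mapping.single \<alpha> F)"
  proof (rule clinear_eq_on_span[OF _ _ _ tensor_in_span_pure])
    show "clinear (\<lambda>F. W n (symmetrize n (Poly_Mapping.single \<alpha> F)))"
      by (rule clinear_W[OF clinear_compose[OF clinear_single clinear_symmetrize] mem])
    show "clinear (\<lambda>F. W n (Poly_Mapping.single \<alpha> F))"
      by (rule clinear_W[OF clinear_single single_S0_supported[OF assms]])
    fix F :: "'a tensor" assume "F \<in> range pure_tensor"
    then obtain hs where F: "F = pure_tensor hs" by blast
    show "W n (symmetrize n (Poly_Mapping.single \<alpha> F)) = W n (Poly_Mapping.single \<alpha> F)"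
    proof (cases "length hs = n")
      case True
      show ?thesis unfolding F
        by (rule symmetrize_average[OF assms True W_add W_scale W_conj[OF assms True]])
    next
      case False
      then show ?thesis
        by (simp add: W_def F symmetrize_pure_other clinear_zero[OF clinear_symmetrize])
    qed
  qed
  then show ?thesis by (simp add: sym_tens_def gtens_gr)
qed

subsection \<open>Labelled monomials\<close>

text \<open>
  \<open>\<phi>\<close> enumerates the label set \<open>A\<close> in such a way that the permutation \<open>\<gamma>\<close> of \<open>insert 0 A\<close> and
  the letters \<open>h\<close> on \<open>A\<close> become the permutation \<open>\<alpha>\<close> and the word \<open>hs\<close>.
\<close>

definition labelling ::
    "(nat \<Rightarrow> nat) \<Rightarrow> nat \<Rightarrow> (nat \<Rightarrow> nat) \<Rightarrow> 'a list \<Rightarrow> nat set \<Rightarrow> (nat \<Rightarrow> nat) \<Rightarrow> (nat \<Rightarrow> 'a) \<Rightarrow> bool" where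
  "labelling \<phi> n \<alpha> hs A \<gamma> h \<longleftrightarrow>
     bij_betw \<phi> {0..n} (insert 0 A) \<and> \<phi> 0 = 0 \<and> 0 \<notin> A \<and> \<alpha> \<in> S0 n \<and> length hs = n \<and>
     (\<forall>i\<in>{0..n}. \<phi> (\<alpha> i) = \<gamma> (\<phi> i)) \<and> (\<forall>i\<in>{1..n}. hs ! (i - 1) = h (\<phi> i))"

lemma labelling_bij: "labelling \<phi> n \<alpha> hs A \<gamma> h \<Longrightarrow> bij_betw \<phi> {1..n} A"
proof -
  assume l: "labelling \<phi> n \<alpha> hs A \<gamma> h"
  then have "bij_betw \<phi> ({0..n} - {0}) (insert 0 A - {\<phi> 0})"
    unfolding labelling_def by (intro bij_betw_DiffI) auto
  moreover have "{0..n} - {0} = {1..n}" by auto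
  ultimately show ?thesis using l by (simp add: labelling_def)
qed

lemma labelling_permute_word:
  assumes l: "labelling \<phi> n \<alpha> hs A \<gamma> h" and "\<sigma> \<in> S1 n"
  shows "labelling (\<phi> \<circ> inv \<sigma>) n (\<sigma> \<circ> \<alpha> \<circ> inv \<sigma>) (permute_word n \<sigma> hs) A \<gamma> h"
proof -
  have \<sigma>: "\<sigma> permutes {1..n}" "\<sigma> permutes {0..n}" using assms(2) S1_S0[OF assms(2)] by (simp_all add: S1_def S0_def)
  have in0: "inv \<sigma> i \<in> {0..n}" if "i \<in> {0..n}" for i
    using that permutes_in_image[OF permutes_inv[OF \<sigma>(2)]] by blast
  have in1: "inv \<sigma> i \<in> {1..n}" if "i \<in> {1..n}" for i
    using that permutes_in_image[OF permutes_inv[OF \<sigma>(1)]] by blast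
  have "inv \<sigma> 0 = 0" using permutes_not_in[OF permutes_inv[OF \<sigma>(1)]] by simp
  then show ?thesis
    using l conj_S0[OF _ assms(2)] in0 in1 bij_betw_trans[OF permutes_imp_bij[OF permutes_inv[OF \<sigma>(2)]], of \<phi>]
    unfolding labelling_def
    by (auto simp: permutes_inverses[OF \<sigma>(1)] permute_word_nth simp del: One_nat_def)
qed

text \<open>
  Two enumerations of the same labels differ by a permutation of \<open>{1..n}\<close>, which conjugates one
  monomial into the other.
\<close>

lemma W_labelling_unique:
  assumes l: "labelling \<phi> n \<alpha> hs A \<gamma> h" and l': "labelling \<phi>' n' \<alpha>' hs' A \<gamma> h"
  shows "W n (Poly_Mapping.single \<alpha> (pure_tensor hs)) = W n' (Poly_Mapping.single \<alpha>' (pure_tensor hs'))"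
proof -
  note bij = labelling_bij[OF l] and bij' = labelling_bij[OF l']
  have n: "n' = n" using bij_betw_same_card[OF bij] bij_betw_same_card[OF bij'] by simp
  have inj': "inj_on \<phi>' {0..n}" using l' n by (auto simp: labelling_def bij_betw_def)
  define \<tau> where "\<tau> i = (if i \<in> {1..n} then inv_into {1..n} \<phi>' (\<phi> i) else i)" for i
  have "bij_betw (inv_into {1..n} \<phi>' \<circ> \<phi>) {1..n} {1..n}"
    using bij_betw_trans[OF bij bij_betw_inv_into[OF bij']] n by simp
  then have "bij_betw \<tau> {1..n} {1..n}"
    by (rule iffD1[OF bij_betw_cong, rotated]) (simp add: \<tau>_def)
  then have \<tau>: "\<tau> permutes {1..n}" by (rule bij_imp_permutes) (simp only: \<tau>_def if_False simp_thms)
  then have S1: "\<tau> \<in> S1 n" by (simp add: S1_def)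
  have \<tau>0: "inv \<tau> i \<in> {0..n}" if "i \<in> {0..n}" for i
    using that S1_S0[OF S1] permutes_in_image[OF permutes_inv, of \<tau> "{0..n}" i] by (simp add: S0_def)
  have eq: "\<phi>' (\<tau> i) = \<phi> i" if "i \<in> {0..n}" for i
  proof (cases "i = 0")
    case True
    then show ?thesis using l l' by (simp add: \<tau>_def labelling_def)
  next
    case False
    then have "\<phi> i \<in> \<phi>' ` {1..n}" using that bij bij' n by (auto simp: bij_betw_def)
    then show ?thesis using False that by (simp add: \<tau>_def f_inv_into_f)
  qed
  have eq': "\<phi> (inv \<tau> i) = \<phi>' i" if "i \<in> {0..n}" for i
    using eq[OF \<tau>0[OF that]] by (simp add: permutes_inverses[OF \<tau>])
  have \<alpha>: "\<alpha> permutes {0..n}" and \<alpha>': "\<alpha>' permutes {0..n}" using l l' n by (simp_all add: labelling_def S0_def)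
  have "\<tau> \<circ> \<alpha> \<circ> inv \<tau> = \<alpha>'"
  proof
    fix i
    have "\<tau> \<circ> \<alpha> \<circ> inv \<tau> \<in> S0 n" using conj_S0[OF _ S1] l by (simp add: labelling_def)
    then have conj: "\<tau> \<circ> \<alpha> \<circ> inv \<tau> permutes {0..n}" by (simp add: S0_def)
    show "(\<tau> \<circ> \<alpha> \<circ> inv \<tau>) i = \<alpha>' i"
    proof (cases "i \<in> {0..n}")
      case True
      have "\<phi>' ((\<tau> \<circ> \<alpha> \<circ> inv \<tau>) i) = \<phi> (\<alpha> (inv \<tau> i))"
        using eq[of "\<alpha> (inv \<tau> i)"] permutes_in_image[OF \<alpha>] \<tau>0[OF True] by simp
      also have "\<dots> = \<gamma> (\<phi>' i)" using l \<tau>0[OF True] eq'[OF True] by (simp add: labelling_def)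
      also have "\<dots> = \<phi>' (\<alpha>' i)" using l' n True by (simp add: labelling_def)
      finally show ?thesis
        using inj_onD[OF inj'] permutes_in_image[OF conj, of i] permutes_in_image[OF \<alpha>', of i] True by blast
    next
      case False
      then show ?thesis using permutes_not_in[OF conj] permutes_not_in[OF \<alpha>'] by simp
    qed
  qed
  moreover have "permute_word n \<tau> hs = hs'"
  proof (rule nth_equalityI)
    show "length (permute_word n \<tau> hs) = length hs'" using l' n by (simp add: labelling_def)
    fix j assume "j < length (permute_word n \<tau> hs)"
    then have i: "Suc j \<in> {1..n}" by simp
    then have "inv \<tau> (Suc j) \<in> {1..n}" using permutes_in_image[OF permutes_inv[OF \<tau>]] by blast
    then have "hs ! (inv \<tau> (Suc j) - 1) = h (\<phi>' (Suc j))" using l i eq'[of "Suc j"] by (simp add: labelling_def)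
    also have "\<dots> = hs' ! j" using l' n i unfolding labelling_def by force
    finally show "permute_word n \<tau> hs ! j = hs' ! j" using permute_word_nth[OF i, of \<tau> hs] by simp
  qed
  ultimately show ?thesis
    using W_conj[OF _ _ S1, of \<alpha> hs] l n by (simp add: labelling_def)
qed

text \<open>
  The class of the monomial with label set \<open>A\<close>, computed from the increasing enumeration of \<open>A\<close>
  because contractions relabel in this way.
\<close>

definition labelled_W :: "nat set \<Rightarrow> (nat \<Rightarrow> nat) \<Rightarrow> (nat \<Rightarrow> 'a::real_vector) \<Rightarrow> 'a TP" where
  "labelled_W A \<gamma> h = W (card A) (Poly_Mapping.single (relabel (insert 0 A) \<gamma>)
     (pure_tensor (map h (sorted_list_of_set A))))"

lemma card_below_nth:
  assumes "finite A" "i < card A"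
  shows "card {y \<in> A. y < sorted_list_of_set A ! i} = i"
proof -
  let ?xs = "sorted_list_of_set A"
  have len: "length ?xs = card A" by simp
  have xs: "sorted_wrt (<) ?xs" by simp
  have "{y \<in> A. y < ?xs ! i} = (!) ?xs ` {..<i}"
  proof (intro equalityI subsetI)
    fix y assume y: "y \<in> {y \<in> A. y < ?xs ! i}"
    then have "y \<in> set ?xs" using assms(1) by simp
    then obtain j where j: "j < card A" "y = ?xs ! j" unfolding in_set_conv_nth len by blast
    have "\<not> i \<le> j"
    proof
      assume "i \<le> j"
      then have "?xs ! i \<le> ?xs ! j" using j(1) by (intro sorted_nth_mono) simp_all
      then show False using y j by (auto dest: leD)
    qed
    then show "y \<in> (!) ?xs ` {..<i}" using j by simp
  next
    fix y assume "y \<in> (!) ?xs ` {..<i}"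
    then obtain j where j: "j < i" "y = ?xs ! j" by blast
    then have "y < ?xs ! i" using sorted_wrt_nth_less[OF xs j(1)] assms(2) by simp
    moreover have "y \<in> A" using j assms nth_mem[of j ?xs] by simp
    ultimately show "y \<in> {y \<in> A. y < ?xs ! i}" by simp
  qed
  moreover have "inj_on ((!) ?xs) {..<i}" using assms(2) by (intro inj_on_nth) auto
  ultimately show ?thesis by (simp add: card_image)
qed

lemma labelling_relabel:
  assumes A: "finite A" "0 \<notin> A" and \<gamma>: "\<gamma> permutes insert 0 A"
  shows "labelling ((!) (sorted_list_of_set (insert 0 A))) (card A) (relabel (insert 0 A) \<gamma>)
    (map h (sorted_list_of_set A)) A \<gamma> h"
proof -
  define B where "B = insert 0 A"
  define n where "n = card A"
  define e where "e = (!) (sorted_list_of_set B)"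
  define r where "r x = card {y \<in> B. y < x}" for x
  have fin: "finite B" and card: "card B = Suc n" using A by (simp_all add: B_def n_def)
  have "sorted_list_of_set (insert 0 A) = insort 0 (sorted_list_of_set A)"
    using A by simp
  then have Cons: "sorted_list_of_set B = 0 # sorted_list_of_set A"
    by (simp add: insort_is_Cons B_def)
  have r: "r (e i) = i" if "i \<in> {0..n}" for i
    using card_below_nth[OF fin, of i] that card by (simp add: r_def e_def)
  have bij: "bij_betw e {0..n} B"
  proof -
    have "{0..n} = {..<length (sorted_list_of_set B)}" using card by auto
    then show ?thesis
      using fin unfolding e_def by (intro bij_betw_nth) simp_all
  qed
  have e: "e i \<in> B" if "i \<in> {0..n}" for i using bij that by (auto simp: bij_betw_def)
  have er: "e (r x) = x" if x: "x \<in> B" for x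
  proof -
    obtain i where "i \<in> {0..n}" "x = e i" using bij x unfolding bij_betw_def by blast
    then show ?thesis using r by simp
  qed
  have r_in: "r x \<in> {0..n}" if x: "x \<in> B" for x
  proof -
    obtain i where "i \<in> {0..n}" "x = e i" using bij x unfolding bij_betw_def by blast
    then show ?thesis using r by simp
  qed
  have bij_r: "bij_betw r B {0..n}"
    by (rule bij_betw_byWitness[where f' = e]) (use r er r_in e in auto)
  have rel: "relabel B \<gamma> i = r (\<gamma> (e i))" if "i \<in> {0..n}" for i
    using that card by (simp add: relabel_def r_def e_def)
  have "bij_betw (r \<circ> (\<gamma> \<circ> e)) {0..n} {0..n}"
    by (rule bij_betw_trans[OF bij_betw_trans[OF bij permutes_imp_bij[OF \<gamma>[folded B_def]]] bij_r])
  then have "bij_betw (relabel B \<gamma>) {0..n} {0..n}"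
    by (rule iffD1[OF bij_betw_cong, rotated]) (simp add: rel)
  then have S0: "relabel B \<gamma> \<in> S0 n"
    unfolding S0_def by (auto intro!: bij_imp_permutes simp: relabel_def card)
  have comm: "e (relabel B \<gamma> i) = \<gamma> (e i)" if "i \<in> {0..n}" for i
    using er[of "\<gamma> (e i)"] e[OF that] permutes_in_image[OF \<gamma>[folded B_def]] by (simp add: rel[OF that])
  have "map h (sorted_list_of_set A) ! (i - 1) = h (e i)" if "i \<in> {1..n}" for i
    using that by (cases i) (simp_all add: e_def Cons n_def)
  moreover have "e 0 = 0" by (simp add: e_def Cons)
  ultimately have "labelling e n (relabel B \<gamma>) (map h (sorted_list_of_set A)) A \<gamma> h"
    unfolding labelling_def using bij S0 comm A(2) by (simp add: B_def n_def)
  then show ?thesis by (simp add: e_def B_def n_def)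
qed

lemma W_labelling:
  assumes "labelling \<phi> n \<alpha> hs A \<gamma> h" "finite A" "\<gamma> permutes insert 0 A"
  shows "W n (Poly_Mapping.single \<alpha> (pure_tensor hs)) = labelled_W A \<gamma> h"
  unfolding labelled_W_def
  using W_labelling_unique[OF assms(1) labelling_relabel[OF assms(2) _ assms(3)]] assms(1)
  by (simp add: labelling_def)

text \<open>
  An enumeration of \<open>A\<close> followed by \<open>f\<close> enumerates \<open>f ` A\<close>; \<open>f\<close> need not be increasing.
\<close>

lemma labelled_W_image:
  assumes "finite A" "0 \<notin> A" "\<gamma> permutes insert 0 A" "\<gamma>' permutes insert 0 (f ` A)"
    and f: "inj_on f (insert 0 A)" "f 0 = 0"
    and "\<And>x. x \<in> insert 0 A \<Longrightarrow> \<gamma>' (f x) = f (\<gamma> x)"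
    and "\<And>x. x \<in> A \<Longrightarrow> h' (f x) = h x"
  shows "labelled_W (f ` A) \<gamma>' h' = labelled_W A \<gamma> h"
proof -
  let ?xs = "(!) (sorted_list_of_set (insert 0 A))" and ?n = "card A"
  have l: "labelling ?xs ?n (relabel (insert 0 A) \<gamma>) (map h (sorted_list_of_set A)) A \<gamma> h"
    by (rule labelling_relabel[OF assms(1-3)])
  have "bij_betw f (insert 0 A) (insert 0 (f ` A))" using f by (simp add: bij_betw_def)
  then have "bij_betw (f \<circ> ?xs) {0..?n} (insert 0 (f ` A))"
    using l unfolding labelling_def by (blast intro: bij_betw_trans)
  moreover have "0 \<notin> f ` A" using f assms(2) by (force simp: inj_on_def)
  moreover have in0: "?xs i \<in> insert 0 A" if "i \<in> {0..?n}" for i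
    using l that unfolding labelling_def bij_betw_def by blast
  moreover have in1: "?xs i \<in> A" if "i \<in> {1..?n}" for i
    using labelling_bij[OF l] that unfolding bij_betw_def by blast
  ultimately have "labelling (f \<circ> ?xs) ?n (relabel (insert 0 A) \<gamma>) (map h (sorted_list_of_set A)) (f ` A) \<gamma>' h'"
    using l f(2) assms(7,8) unfolding labelling_def by (simp del: One_nat_def)
  from W_labelling[OF this] show ?thesis using assms(1,4) by (simp add: labelled_W_def)
qed

subsection \<open>Labelled contractions\<close>

definition labelled_contraction :: "real \<Rightarrow> nat set set \<Rightarrow> nat set \<Rightarrow> (nat \<Rightarrow> nat) \<Rightarrow> (nat \<Rightarrow> 'a::real_inner) \<Rightarrow> 'a TP" where
  "labelled_contraction q M A \<gamma> h = weight q M \<gamma> h *\<^sub>C labelled_W (A - \<Union>M) (residual M \<gamma>) h"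

lemma labelled_contraction_image:
  assumes A: "finite A" "0 \<notin> A" "M \<in> matchings A" "\<gamma> permutes insert 0 A" "\<gamma>' permutes insert 0 (f ` A)"
    and f: "inj_on f (insert 0 A)" "f 0 = 0"
    and \<gamma>: "\<And>x. x \<in> insert 0 A \<Longrightarrow> \<gamma>' (f x) = f (\<gamma> x)"
    and h: "\<And>x. x \<in> A \<Longrightarrow> h' (f x) = h x"
  shows "labelled_contraction q ((`) f ` M) (f ` A) \<gamma>' h' = labelled_contraction q M A \<gamma> h"
proof -
  have injA: "inj_on f A" by (rule inj_on_subset[OF f(1)]) auto
  have zero': "0 \<notin> f ` A" using f A(2) by (force simp: inj_on_def)
  have "\<Union>((`) f ` M) = f ` \<Union>M" by blast
  then have diff: "f ` A - \<Union>((`) f ` M) = f ` (A - \<Union>M)"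
    using inj_on_image_set_diff[OF injA _ matchings_Union[OF A(3)], of A] by auto
  have "labelled_W (f ` (A - \<Union>M)) (residual ((`) f ` M) \<gamma>') h' = labelled_W (A - \<Union>M) (residual M \<gamma>) h"
  proof (rule labelled_W_image)
    show "residual M \<gamma> permutes insert 0 (A - \<Union>M)" by (rule residual_permutes[OF A(1-4)])
    show "residual ((`) f ` M) \<gamma>' permutes insert 0 (f ` (A - \<Union>M))"
      using residual_permutes[OF finite_imageI[OF A(1)] zero' matchings_image[OF injA A(3)] A(5)] diff by simp
    show "inj_on f (insert 0 (A - \<Union>M))" by (rule inj_on_subset[OF f(1)]) auto
    show "residual ((`) f ` M) \<gamma>' (f x) = f (residual M \<gamma> x)" if "x \<in> insert 0 (A - \<Union>M)" for x
      by (rule residual_image[OF A f _ that]) (fact \<gamma>)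
  qed (use A f h in auto)
  moreover have "weight q ((`) f ` M) \<gamma>' h' = weight q M \<gamma> h"
    by (rule weight_image[OF A f]) (fact \<gamma>, fact h)
  ultimately show ?thesis by (simp only: labelled_contraction_def diff)
qed


section \<open>Contractions of monomials\<close>

abbreviation letter :: "'a list \<Rightarrow> nat \<Rightarrow> 'a" where
  "letter hs i \<equiv> hs ! (i - 1)"

lemma labelling_id:
  "\<alpha> \<in> S0 n \<Longrightarrow> length hs = n \<Longrightarrow> labelling (\<lambda>i. i) n \<alpha> hs {1..n} \<alpha> (letter hs)"
proof -
  have "insert 0 {1..n} = {0..n}" by auto
  then show "\<alpha> \<in> S0 n \<Longrightarrow> length hs = n \<Longrightarrow> labelling (\<lambda>i. i) n \<alpha> hs {1..n} \<alpha> (letter hs)"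
    by (simp add: labelling_def bij_betw_def)
qed

context
  fixes n :: nat and \<pi> :: "nat set set" and \<alpha> :: "nat \<Rightarrow> nat" and q :: real
  assumes \<pi>: "\<pi> \<in> P12 n" and \<alpha>: "\<alpha> \<in> S0 n"
begin

lemma card_singletons: "card ({1..n} - \<Union>(pairs \<pi>)) = n - 2 * card (pairs \<pi>)"
  using card_Union_matching[OF _ pairs_P12[OF \<pi>]] matchings_Union[OF pairs_P12[OF \<pi>]]
  by (simp add: card_Diff_subset finite_subset[of _ "{1..n}"])

text \<open>
  Here the difference of cycle numbers turns into a number of cycles: the nonzero points are
  the contracted ones and the remaining ones, and \<open>card_loops_Un\<close> applies to this splitting.
\<close>

lemma contract_perm_matching:
  "contract_perm q n \<pi> \<alpha> =
     Poly_Mapping.single (relabel (insert 0 ({1..n} - \<Union>(pairs \<pi>))) (residual (pairs \<pi>) \<alpha>))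
       (complex_of_real (q powi (int (card (pairs \<pi>)) -
          int (card (loops (involution (pairs \<pi>) \<circ> \<alpha>) (\<Union>(pairs \<pi>)))))))"
proof -
  let ?M = "pairs \<pi>"
  let ?X = "\<Union>?M" and ?\<gamma> = "involution ?M \<circ> \<alpha>"
  let ?A = "{1..n} - ?X"
  have M: "?M \<in> matchings {1..n}" by (rule pairs_P12[OF \<pi>])
  have X: "?X \<subseteq> {1..n}" by (rule matchings_Union[OF M])
  have \<alpha>': "\<alpha> permutes insert 0 {1..n}" using \<alpha> by (simp add: S0_iff_permutes)
  have ins: "insert 0 {1..n} = {0..n}" by auto
  have A: "{0..n} - supp \<pi> = insert 0 ?A" using X by (auto simp: supp_def)
  have \<gamma>: "?\<gamma> permutes {0..n}"
    using involution_comp_permutes[OF _ _ M \<alpha>'] ins by simp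
  have \<delta>: "residual ?M \<alpha> permutes insert 0 ?A"
    by (rule residual_permutes[OF _ _ M \<alpha>']) simp_all
  have "cyc0 {0..n} ?\<gamma> = card (loops ?\<gamma> (?X \<union> ?A))"
  proof -
    have "{0..n} - {0} = ?X \<union> ?A" using X by auto
    then show ?thesis using cyc0_eq_card_loops[OF \<gamma>] by simp
  qed
  also have "\<dots> = card (loops ?\<gamma> ?X) + card (loops (residual ?M \<alpha>) ?A)"
    unfolding residual_def
    by (rule card_loops_Un[OF permutes_permutation[OF \<gamma>]]) (use X finite_subset in auto)
  also have "card (loops (residual ?M \<alpha>) ?A) = cyc0 (insert 0 ?A) (residual ?M \<alpha>)"
    using cyc0_eq_card_loops[OF \<delta>] by simp
  finally have "int (cyc0 (insert 0 ?A) (residual ?M \<alpha>)) - int (cyc0 {0..n} ?\<gamma>) =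
      - int (card (loops ?\<gamma> ?X))" by (simp add: o_def)
  then show ?thesis
    unfolding contract_perm_def Let_def involution_pairs[symmetric, of \<pi>] A
    by (simp add: supp_def residual_def[symmetric])
qed

lemma contract_single_matching:
  "\<exists>c. contract q n \<pi> (Poly_Mapping.single \<alpha> F) =
     Poly_Mapping.single (relabel (insert 0 ({1..n} - \<Union>(pairs \<pi>))) (residual (pairs \<pi>) \<alpha>)) (c *\<^sub>C contract_tensor n \<pi> F)"
  unfolding contract_single[OF \<pi>] contract_perm_matching gtens_single by blast

lemma labelling_residual:
  "labelling ((!) (sorted_list_of_set (insert 0 ({1..n} - \<Union>(pairs \<pi>))))) (n - 2 * card (pairs \<pi>))
     (relabel (insert 0 ({1..n} - \<Union>(pairs \<pi>))) (residual (pairs \<pi>) \<alpha>))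
     (map h (sorted_list_of_set ({1..n} - \<Union>(pairs \<pi>)))) ({1..n} - \<Union>(pairs \<pi>)) (residual (pairs \<pi>) \<alpha>) h"
  unfolding card_singletons[symmetric]
  by (rule labelling_relabel[OF _ _ residual_permutes[OF _ _ pairs_P12[OF \<pi>] \<alpha>[unfolded S0_iff_permutes]]]) simp_all

lemma relabel_residual_S0:
  "relabel (insert 0 ({1..n} - \<Union>(pairs \<pi>))) (residual (pairs \<pi>) \<alpha>) \<in> S0 (n - 2 * card (pairs \<pi>))"
  using labelling_residual[of "\<lambda>i. i"] unfolding labelling_def by blast

lemma contract_single_S0_supported:
  "contract q n \<pi> (Poly_Mapping.single \<alpha> F) \<in> S0_supported (n - 2 * card (pairs \<pi>))"
  using contract_single_matching[of F] single_S0_supported[OF relabel_residual_S0] by metis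

lemma W_contract_pure:
  assumes hs: "length hs = n"
  shows "W (n - 2 * card (pairs \<pi>)) (contract q n \<pi> (Poly_Mapping.single \<alpha> (pure_tensor hs))) =
    labelled_contraction q (pairs \<pi>) {1..n} \<alpha> (letter hs)"
proof -
  let ?M = "pairs \<pi>"
  let ?A = "{1..n} - \<Union>?M"
  let ?\<alpha> = "relabel (insert 0 ?A) (residual ?M \<alpha>)"
  let ?w = "pure_tensor (map (letter hs) (sorted_list_of_set ?A))"
  have "contract q n \<pi> (Poly_Mapping.single \<alpha> (pure_tensor hs)) =
      weight q ?M \<alpha> (letter hs) *\<^sub>C Poly_Mapping.single ?\<alpha> ?w"
    unfolding contract_single[OF \<pi>] contract_perm_matching gtens_single contract_tensor_pure[OF \<pi>]
    by (simp add: contract_word_def hs weight_def supp_def scaleC_scaleC clinear_scale[OF clinear_single])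
  then show ?thesis
    unfolding labelled_contraction_def labelled_W_def card_singletons
    by (simp only: W_scale[OF single_S0_supported[OF relabel_residual_S0]])
qed

end

lemma contract_S0_supported:
  assumes "\<pi> \<in> P12 n" "\<xi> \<in> S0_supported n"
  shows "contract q n \<pi> \<xi> \<in> S0_supported (n - 2 * card (pairs \<pi>))"
proof -
  have "contract q n \<pi> \<xi> =
      (\<Sum>\<alpha>\<in>Poly_Mapping.keys \<xi>. contract q n \<pi> (Poly_Mapping.single \<alpha> (Poly_Mapping.lookup \<xi> \<alpha>)))"
    by (simp only: contract_single[OF assms(1)]) (simp only: contract_def contract_alg_gr)
  moreover have "\<alpha> \<in> S0 n" if "\<alpha> \<in> Poly_Mapping.keys \<xi>" for \<alpha>
    using that assms(2) by (auto simp: S0_supported_def)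
  ultimately show ?thesis
    by (simp add: cv.subspace_sum[OF subspace_S0_supported] contract_single_S0_supported[OF assms(1)])
qed

text \<open>
  A contraction of a monomial can be carried out on the labels of any enumeration.
\<close>

lemma labelled_contraction_labelling:
  assumes l: "labelling \<phi> n \<alpha> hs A \<gamma> h" and A: "finite A" "\<gamma> permutes insert 0 A"
    and M: "M \<in> matchings {1..n}"
  shows "labelled_contraction q ((`) \<phi> ` M) A \<gamma> h = labelled_contraction q M {1..n} \<alpha> (letter hs)"
proof -
  have im: "\<phi> ` {1..n} = A" using labelling_bij[OF l] by (simp add: bij_betw_def)
  have ins: "insert 0 {1..n} = {0..n}" by auto
  have \<alpha>: "\<alpha> permutes insert 0 {1..n}" using l by (simp add: labelling_def S0_iff_permutes)
  have "labelled_contraction q ((`) \<phi> ` M) (\<phi> ` {1..n}) \<gamma> h = labelled_contraction q M {1..n} \<alpha> (letter hs)"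
  proof (rule labelled_contraction_image[OF _ _ M \<alpha>])
    show "\<gamma> permutes insert 0 (\<phi> ` {1..n})" using A(2) im by simp
    show "inj_on \<phi> (insert 0 {1..n})" unfolding ins using l by (simp add: labelling_def bij_betw_def)
    show "\<gamma> (\<phi> x) = \<phi> (\<alpha> x)" if "x \<in> insert 0 {1..n}" for x
      using that l unfolding ins by (simp add: labelling_def)
    show "h (\<phi> x) = letter hs x" if "x \<in> {1..n}" for x
      using that l by (simp add: labelling_def)
  qed (use l in \<open>simp_all add: labelling_def\<close>)
  then show ?thesis by (simp only: im)
qed

lemma T_labelling:
  assumes l: "labelling \<phi> n \<alpha> hs A \<gamma> h" and A: "finite A" "\<gamma> permutes insert 0 A"
  shows "T q n (Poly_Mapping.single \<alpha> (pure_tensor hs)) = (\<Sum>M\<in>matchings A. labelled_contraction q M A \<gamma> h)"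
proof -
  have \<alpha>: "\<alpha> \<in> S0 n" and hs: "length hs = n" using l by (simp_all add: labelling_def)
  have "T q n (Poly_Mapping.single \<alpha> (pure_tensor hs)) =
      (\<Sum>\<pi>\<in>P12 n. labelled_contraction q (pairs \<pi>) {1..n} \<alpha> (letter hs))"
    unfolding T_def by (intro sum.cong refl W_contract_pure \<alpha> hs)
  also have "\<dots> = (\<Sum>M\<in>matchings {1..n}. labelled_contraction q M {1..n} \<alpha> (letter hs))"
    by (rule sum.reindex_bij_betw[OF bij_betw_pairs])
  also have "\<dots> = (\<Sum>M\<in>matchings {1..n}. labelled_contraction q ((`) \<phi> ` M) A \<gamma> h)"
    by (intro sum.cong refl labelled_contraction_labelling[OF l A, symmetric])
  also have "\<dots> = (\<Sum>M\<in>matchings A. labelled_contraction q M A \<gamma> h)"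
    using bij_betw_matchings_image[of \<phi> "{1..n}"] labelling_bij[OF l]
    by (intro sum.reindex_bij_betw) (simp add: bij_betw_def)
  finally show ?thesis .
qed

lemma T_add:
  assumes "\<xi> \<in> S0_supported n" "\<eta> \<in> S0_supported n"
  shows "T q n (\<xi> + \<eta>) = T q n \<xi> + T q n \<eta>"
  unfolding T_def sum.distrib[symmetric]
  by (intro sum.cong refl)
    (simp add: clinear_add[OF clinear_contract] W_add contract_S0_supported assms)

lemma T_scale:
  assumes "\<xi> \<in> S0_supported n"
  shows "T q n (c *\<^sub>C \<xi>) = c *\<^sub>C T q n \<xi>"
  unfolding T_def cv.scale_sum_right
  by (intro sum.cong refl)
    (simp add: clinear_scale[OF clinear_contract] W_scale contract_S0_supported assms)

lemma T_sym_tens: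
  assumes l: "labelling \<phi> n \<alpha> hs A \<gamma> h" and A: "finite A" "\<gamma> permutes insert 0 A"
  shows "T q n (sym_tens n (gr \<alpha>) (pure_tensor hs)) = (\<Sum>M\<in>matchings A. labelled_contraction q M A \<gamma> h)"
  unfolding sym_tens_def gtens_gr
  by (rule symmetrize_average[OF _ _ T_add T_scale T_labelling[OF labelling_permute_word[OF l] A]])
    (use l in \<open>simp_all add: labelling_def\<close>)

lemma clinear_T_sym_tens:
  assumes "\<alpha> \<in> S0 n"
  shows "clinear (\<lambda>F. T q n (sym_tens n (gr \<alpha>) F))"
proof (rule clinearI)
  have mem: "symmetrize n (Poly_Mapping.single \<alpha> F) \<in> S0_supported n" for F
    unfolding symmetrize_single using conj_S0[OF assms]
    by (intro cv.subspace_scale[OF subspace_S0_supported] cv.subspace_sum[OF subspace_S0_supported] single_S0_supported)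
  fix F G and c
  show "T q n (sym_tens n (gr \<alpha>) (F + G)) = T q n (sym_tens n (gr \<alpha>) F) + T q n (sym_tens n (gr \<alpha>) G)"
    by (simp add: sym_tens_def gtens_gr clinear_add[OF clinear_single] clinear_add[OF clinear_symmetrize] T_add mem)
  show "T q n (sym_tens n (gr \<alpha>) (c *\<^sub>C F)) = c *\<^sub>C T q n (sym_tens n (gr \<alpha>) F)"
    by (simp add: sym_tens_def gtens_gr clinear_scale[OF clinear_single] clinear_scale[OF clinear_symmetrize] T_scale mem)
qed

section \<open>The Wick product\<close>

text \<open>
  The embedding that places the points of the second factor after the \<open>n\<close> points of the first.
\<close>

definition shift :: "nat \<Rightarrow> nat \<Rightarrow> nat" where
  "shift n j = (if j = 0 then 0 else n + j)"

lemma shift_perm_shift: "shift_perm n \<beta> (shift n j) = shift n (\<beta> j)"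
  by (simp add: shift_perm_def shift_def Let_def)

lemma shift_perm_permutes:
  assumes "\<beta> \<in> S0 k"
  shows "shift_perm n \<beta> permutes insert 0 {n + 1..n + k}"
proof (rule bij_imp_permutes)
  have \<beta>: "\<beta> permutes {0..k}" using assms by (simp add: S0_def)
  have im: "insert 0 {n + 1..n + k} = shift n ` {0..k}"
  proof -
    have "x \<in> shift n ` {0..k}" if "x \<in> {n + 1..n + k}" for x
      using that by (intro image_eqI[of _ _ "x - n"]) (auto simp: shift_def)
    moreover have "0 \<in> shift n ` {0..k}" by (rule image_eqI[of _ _ 0]) (auto simp: shift_def)
    ultimately show ?thesis by (auto simp: shift_def)
  qed
  have "shift_perm n \<beta> ` shift n ` {0..k} = shift n ` \<beta> ` {0..k}"
    by (simp add: image_image shift_perm_shift)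
  then have onto: "shift_perm n \<beta> ` insert 0 {n + 1..n + k} = insert 0 {n + 1..n + k}"
    unfolding im permutes_image[OF \<beta>] .
  have "inj_on (shift_perm n \<beta>) (insert 0 {n + 1..n + k})"
    by (rule eq_card_imp_inj_on) (simp, simp only: onto)
  with onto show "bij_betw (shift_perm n \<beta>) (insert 0 {n + 1..n + k}) (insert 0 {n + 1..n + k})"
    unfolding bij_betw_def by blast
  show "shift_perm n \<beta> x = x" if x: "x \<notin> insert 0 {n + 1..n + k}" for x
  proof (cases "x \<le> n")
    case False
    then have "\<beta> (x - n) = x - n" using x by (intro permutes_not_in[OF \<beta>]) auto
    then show ?thesis using False by (simp add: shift_perm_def Let_def)
  qed (use x in \<open>simp add: shift_perm_def\<close>)
qed

lemma labelling_shift: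
  assumes "\<beta> \<in> S0 k" "length gs = k" "length hs = n"
  shows "labelling (shift n) k \<beta> gs {n + 1..n + k} (shift_perm n \<beta>) (letter (hs @ gs))"
proof -
  have "bij_betw (shift n) {0..k} (insert 0 {n + 1..n + k})"
  proof (rule bij_betw_byWitness[where f' = "\<lambda>x. x - n"])
  qed (auto simp: shift_def)
  then show ?thesis
    unfolding labelling_def using assms
    by (simp add: shift_perm_shift) (auto simp: shift_def nth_append)
qed

lemma perm_cup_S0:
  assumes "\<alpha> \<in> S0 n" "\<beta> \<in> S0 k"
  shows "perm_cup n \<alpha> \<beta> \<in> S0 (n + k)"
  unfolding S0_def perm_cup_def
  using permutes_subset[OF shift_perm_permutes[OF assms(2), of n], of "{0..n + k}"]
    permutes_subset[of \<alpha> "{0..n}" "{0..n + k}"] assms(1)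
  by (auto intro!: permutes_compose simp: S0_def)

text \<open>
  The right-hand side of the product formula, as a map of the tensor coefficient. It is set to
  \<open>0\<close> for permutations of other degrees, where \<open>W\<close> need not be linear.
\<close>

definition wick_sum :: "real \<Rightarrow> nat \<Rightarrow> nat \<Rightarrow> (nat \<Rightarrow> nat) \<Rightarrow> (nat \<Rightarrow> nat) \<Rightarrow> 'a::real_inner tensor \<Rightarrow> 'a TP" where
  "wick_sum q n k \<alpha> \<beta> F = (if \<alpha> \<in> S0 n \<and> \<beta> \<in> S0 k
     then \<Sum>\<pi>\<in>P12_bip n k. W (n + k - 2 * card (pairs \<pi>))
       (contract q (n + k) \<pi> (Poly_Mapping.single (perm_cup n \<alpha> \<beta>) F))
     else 0)"

lemma P12_bip_P12: "\<pi> \<in> P12_bip n k \<Longrightarrow> \<pi> \<in> P12 (n + k)"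
  by (simp add: P12_bip_def)

lemma clinear_wick_sum: "clinear (wick_sum q n k \<alpha> \<beta>)"
proof (cases "\<alpha> \<in> S0 n \<and> \<beta> \<in> S0 k")
  case True
  have "clinear (\<lambda>F. \<Sum>\<pi>\<in>P12_bip n k. W (n + k - 2 * card (pairs \<pi>))
       (contract q (n + k) \<pi> (Poly_Mapping.single (perm_cup n \<alpha> \<beta>) F)))"
    using True perm_cup_S0 P12_bip_P12
    by (intro clinear_sum_fun clinear_W clinear_compose[OF clinear_single clinear_contract]
        contract_single_S0_supported) auto
  then show ?thesis using True by (simp add: wick_sum_def[abs_def])
next
  case False
  then show ?thesis by (intro clinearI) (simp_all only: wick_sum_def if_False add_0 cv.scale_zero_right)
qed

lemma wick_sum_pure:
  assumes "\<alpha> \<in> S0 n" "\<beta> \<in> S0 k" "length fs = n + k"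
  shows "wick_sum q n k \<alpha> \<beta> (pure_tensor fs) =
    (\<Sum>M\<in>cross_matchings {1..n} {n + 1..n + k}. labelled_contraction q M {1..n + k} (perm_cup n \<alpha> \<beta>) (letter fs))"
proof -
  have "wick_sum q n k \<alpha> \<beta> (pure_tensor fs) =
      (\<Sum>\<pi>\<in>P12_bip n k. labelled_contraction q (pairs \<pi>) {1..n + k} (perm_cup n \<alpha> \<beta>) (letter fs))"
    unfolding wick_sum_def using assms
    by (simp add: W_contract_pure[OF P12_bip_P12 perm_cup_S0])
  also have "\<dots> = (\<Sum>M\<in>cross_matchings {1..n} {n + 1..n + k}. labelled_contraction q M {1..n + k} (perm_cup n \<alpha> \<beta>) (letter fs))"
    by (rule sum.reindex_bij_betw[OF bij_betw_pairs_bip])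
  finally show ?thesis .
qed

text \<open>
  Enumerating \<open>A\<close> first and \<open>B\<close> afterwards identifies \<open>\<alpha> \<union> \<beta>\<close> with the product \<open>\<delta> \<circ> \<gamma>\<close> of
  permutations whose domains meet only in \<open>0\<close>.
\<close>

lemma labelling_cup:
  assumes l: "labelling \<phi> n \<alpha> hs A \<gamma> h" "labelling \<psi> k \<beta> gs B \<delta> h"
    and AB: "A \<inter> B = {}" and \<gamma>: "\<gamma> permutes insert 0 A" and \<delta>: "\<delta> permutes insert 0 B"
  defines "f \<equiv> \<lambda>i. if i \<le> n then \<phi> i else \<psi> (i - n)"
  shows "labelling f (n + k) (perm_cup n \<alpha> \<beta>) (hs @ gs) (A \<union> B) (\<delta> \<circ> \<gamma>) h"
    and "f ` {1..n} = A" and "f ` {n + 1..n + k} = B"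
proof -
  have zero: "0 \<notin> A" "0 \<notin> B" and \<phi>0: "\<phi> 0 = 0" and \<psi>0: "\<psi> 0 = 0"
    and \<alpha>: "\<alpha> \<in> S0 n" and \<beta>: "\<beta> \<in> S0 k"
    and comm: "\<And>i. i \<in> {0..n} \<Longrightarrow> \<phi> (\<alpha> i) = \<gamma> (\<phi> i)" "\<And>i. i \<in> {0..k} \<Longrightarrow> \<psi> (\<beta> i) = \<delta> (\<psi> i)"
    using l by (auto simp: labelling_def)
  have \<phi>: "bij_betw \<phi> {0..n} (insert 0 A)" using l by (simp add: labelling_def)
  have \<psi>: "bij_betw \<psi> {1..k} B" by (rule labelling_bij[OF l(2)])
  have low: "bij_betw f {0..n} (insert 0 A)"
    using \<phi> by (rule iffD1[OF bij_betw_cong, rotated]) (simp add: f_def)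
  have "bij_betw (\<lambda>i. i - n) {n + 1..n + k} {1..k}"
    by (rule bij_betw_byWitness[where f' = "\<lambda>i. i + n"]) auto
  from bij_betw_trans[OF this \<psi>] have high: "bij_betw f {n + 1..n + k} B"
    by (rule iffD1[OF bij_betw_cong, rotated]) (simp add: f_def)
  show "f ` {n + 1..n + k} = B" using high by (simp add: bij_betw_def)
  show "f ` {1..n} = A"
  proof -
    have "f ` {1..n} = \<phi> ` {1..n}" by (intro image_cong refl) (simp add: f_def)
    then show ?thesis using labelling_bij[OF l(1)] by (simp add: bij_betw_def)
  qed
  have "bij_betw f ({0..n} \<union> {n + 1..n + k}) (insert 0 A \<union> B)"
    using AB zero by (intro bij_betw_combine[OF low high]) auto
  moreover have "{0..n} \<union> {n + 1..n + k} = {0..n + k}" by auto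
  ultimately have bij: "bij_betw f {0..n + k} (insert 0 (A \<union> B))" by simp
  have eq: "f (perm_cup n \<alpha> \<beta> i) = (\<delta> \<circ> \<gamma>) (f i)" if i: "i \<in> {0..n + k}" for i
  proof (cases "i \<le> n")
    case True
    have \<alpha>i: "\<alpha> i \<in> {0..n}" using True \<alpha> permutes_in_image[of \<alpha> "{0..n}" i] by (simp add: S0_def)
    have fi: "\<gamma> (f i) = \<phi> (\<alpha> i)" using comm(1)[of i] True by (simp add: f_def)
    show ?thesis
    proof (cases "\<alpha> i = 0")
      case zero: True
      have "perm_cup n \<alpha> \<beta> i = shift n (\<beta> 0)"
        using zero shift_perm_shift[of n \<beta> 0] by (simp add: perm_cup_def shift_def)
      moreover have "f (shift n j) = \<psi> j" for j using \<phi>0 \<psi>0 by (simp add: f_def shift_def)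
      ultimately show ?thesis using fi comm(2)[of 0] by (simp add: zero \<phi>0 \<psi>0)
    next
      case False
      then have "\<phi> (\<alpha> i) \<in> A" using labelling_bij[OF l(1)] \<alpha>i by (auto simp: bij_betw_def)
      then have "\<delta> (\<phi> (\<alpha> i)) = \<phi> (\<alpha> i)" by (rule permutes_other_in[OF \<delta> AB zero(1)])
      moreover have "perm_cup n \<alpha> \<beta> i = \<alpha> i"
        using False \<alpha>i by (simp add: perm_cup_def shift_perm_def)
      ultimately show ?thesis using fi \<alpha>i by (simp add: f_def)
    qed
  next
    case False
    have "\<alpha> i = i" using \<alpha> permutes_not_in[of \<alpha> "{0..n}" i] False by (simp add: S0_def)
    then have "perm_cup n \<alpha> \<beta> i = shift n (\<beta> (i - n))"
      using shift_perm_shift[of n \<beta> "i - n"] False by (simp add: perm_cup_def shift_def)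
    moreover have "f (shift n j) = \<psi> j" for j using \<phi>0 \<psi>0 by (simp add: f_def shift_def)
    moreover have "i - n \<in> {1..k}" using False i by auto
    then have "\<psi> (i - n) \<in> B" using \<psi> unfolding bij_betw_def by blast
    then have "\<gamma> (\<psi> (i - n)) = \<psi> (i - n)" using AB by (intro permutes_other_in[OF \<gamma> _ zero(2)]) auto
    ultimately show ?thesis using False i comm(2)[of "i - n"] by (simp add: f_def)
  qed
  have letters: "letter (hs @ gs) i = h (f i)" if i: "i \<in> {1..n + k}" for i
  proof (cases "i \<le> n")
    case True
    then have "i \<in> {1..n}" using i by simp
    then have "letter hs i = h (\<phi> i)" using l(1) unfolding labelling_def by blast
    moreover have "length hs = n" "i - 1 < n" using l(1) \<open>i \<in> {1..n}\<close> by (auto simp: labelling_def)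
    ultimately show ?thesis using True by (simp add: nth_append f_def)
  next
    case False
    then have "i - n \<in> {1..k}" using i by auto
    then have "letter gs (i - n) = h (\<psi> (i - n))" using l(2) unfolding labelling_def by blast
    moreover have "i - 1 - n = i - n - 1" "\<not> i - 1 < n" using False by auto
    moreover have "length hs = n" using l(1) by (simp add: labelling_def)
    ultimately show ?thesis using False by (simp add: nth_append f_def)
  qed
  show "labelling f (n + k) (perm_cup n \<alpha> \<beta>) (hs @ gs) (A \<union> B) (\<delta> \<circ> \<gamma>) h"
    unfolding labelling_def using bij eq letters zero perm_cup_S0[OF \<alpha> \<beta>] l
    by (simp add: labelling_def f_def \<phi>0)
qed

text \<open>
  In this form the sum visibly depends on the labelled monomials alone, and not on the chosen
  representatives.
\<close>

lemma wick_sum_labelling: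
  assumes l: "labelling \<phi> n \<alpha> hs A \<gamma> h" "labelling \<psi> k \<beta> gs B \<delta> h"
    and AB: "A \<inter> B = {}" and fin: "finite A" "finite B"
    and \<gamma>: "\<gamma> permutes insert 0 A" and \<delta>: "\<delta> permutes insert 0 B"
  shows "wick_sum q n k \<alpha> \<beta> (pure_tensor (hs @ gs)) =
    (\<Sum>M\<in>cross_matchings A B. labelled_contraction q M (A \<union> B) (\<delta> \<circ> \<gamma>) h)"
proof -
  let ?f = "\<lambda>i. if i \<le> n then \<phi> i else \<psi> (i - n)"
  note cup = labelling_cup[OF l AB \<gamma> \<delta>]
  have un: "{1..n} \<union> {n + 1..n + k} = {1..n + k}" by auto
  have perm: "\<delta> \<circ> \<gamma> permutes insert 0 (A \<union> B)"
    by (rule permutes_compose[OF permutes_subset[OF \<gamma>] permutes_subset[OF \<delta>]]) auto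
  have inj: "inj_on ?f ({1..n} \<union> {n + 1..n + k})"
    unfolding un by (rule bij_betw_imp_inj_on[OF labelling_bij[OF cup(1)]])
  have "wick_sum q n k \<alpha> \<beta> (pure_tensor (hs @ gs)) =
      (\<Sum>M\<in>cross_matchings {1..n} {n + 1..n + k}. labelled_contraction q M {1..n + k} (perm_cup n \<alpha> \<beta>) (letter (hs @ gs)))"
    using l by (intro wick_sum_pure) (simp_all add: labelling_def)
  also have "\<dots> = (\<Sum>M\<in>cross_matchings {1..n} {n + 1..n + k}. labelled_contraction q ((`) ?f ` M) (A \<union> B) (\<delta> \<circ> \<gamma>) h)"
  proof (rule sum.cong[OF refl])
    fix M assume "M \<in> cross_matchings {1..n} {n + 1..n + k}"
    then have "M \<in> matchings {1..n + k}" by (simp only: cross_matchings_def un mem_Collect_eq)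
    from labelled_contraction_labelling[OF cup(1) finite_UnI[OF fin] perm this]
    show "labelled_contraction q M {1..n + k} (perm_cup n \<alpha> \<beta>) (letter (hs @ gs)) = labelled_contraction q ((`) ?f ` M) (A \<union> B) (\<delta> \<circ> \<gamma>) h"
      by (rule sym)
  qed
  also have "\<dots> = (\<Sum>M\<in>cross_matchings A B. labelled_contraction q M (A \<union> B) (\<delta> \<circ> \<gamma>) h)"
    using bij_betw_cross_matchings_image[OF inj] unfolding cup(2,3) by (rule sum.reindex_bij_betw)
  finally show ?thesis .
qed

subsection \<open>Bilinear extension\<close>

lemma tensor_lift_fun_add: "tensor_lift (\<lambda>k. f k + g k) G = tensor_lift f G + tensor_lift g G"
  by (simp add: tensor_lift_def lin_ext_def scaleC_add_right sum.distrib)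

lemma tensor_lift_fun_scale: "tensor_lift (\<lambda>k. c *\<^sub>C f k) G = c *\<^sub>C tensor_lift f G"
  by (simp add: tensor_lift_def lin_ext_def cv.scale_sum_right mult.commute)

lemma multilinear_tensor_lift:
  assumes "\<And>hs. multilinear (\<lambda>gs. f hs gs)"
  shows "multilinear (\<lambda>gs. tensor_lift (\<lambda>hs. f hs gs) F)"
  using assms unfolding multilinear_def
  by (simp add: tensor_lift_fun_add tensor_lift_fun_scale)

lemma multilinear_of_append:
  fixes hs gs :: "'a::real_vector list"
  assumes "\<And>n k. clinear (E n k)"
  shows "multilinear (\<lambda>hs. E (length hs) (length gs) (pure_tensor (hs @ gs)))"
    and "multilinear (\<lambda>gs. E (length hs) (length gs) (pure_tensor (hs @ gs)))"
proof -
  have add: "pure_tensor (us @ (a + b) # vs) = pure_tensor (us @ a # vs) + pure_tensor (us @ b # vs)"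
    and scale: "pure_tensor (us @ (r *\<^sub>R a) # vs) = complex_of_real r *\<^sub>C pure_tensor (us @ a # vs)"
    for us vs :: "'a list" and a b r
    using multilinear_pure unfolding multilinear_def by blast+
  have add': "pure_tensor (hs @ us @ (a + b) # vs) = pure_tensor (hs @ us @ a # vs) + pure_tensor (hs @ us @ b # vs)"
    and scale': "pure_tensor (hs @ us @ (r *\<^sub>R a) # vs) = complex_of_real r *\<^sub>C pure_tensor (hs @ us @ a # vs)"
    for us vs :: "'a list" and a b r
    using add[of "hs @ us"] scale[of "hs @ us"] by simp_all
  show "multilinear (\<lambda>hs. E (length hs) (length gs) (pure_tensor (hs @ gs)))"
    unfolding multilinear_def by (simp add: add scale clinear_add[OF assms] clinear_scale[OF assms])
  show "multilinear (\<lambda>gs. E (length hs) (length gs) (pure_tensor (hs @ gs)))"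
    unfolding multilinear_def by (simp add: add' scale' clinear_add[OF assms] clinear_scale[OF assms])
qed

lemma clinear_tensor_mult_right: "clinear (\<lambda>G. F \<otimes>\<^sub>T (G :: 'a::real_vector tensor))"
proof -
  have "multilinear (\<lambda>gs :: 'a list. pure_tensor (hs @ gs))" for hs
    using multilinear_of_append(2)[of "\<lambda>_ _ x. x"] by (simp add: clinearI)
  then show ?thesis
    unfolding tensor_mult_def by (intro tensor_lift_linear multilinear_tensor_lift)
qed

text \<open>
  A word determines its degree, so a single pair of liftings defines the product in all degrees
  at once.
\<close>

definition wick_sum_ext ::
    "real \<Rightarrow> (nat \<Rightarrow> nat) \<Rightarrow> (nat \<Rightarrow> nat) \<Rightarrow> 'a::real_inner tensor \<Rightarrow> 'a tensor \<Rightarrow> 'a TP" where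
  "wick_sum_ext q \<alpha> \<beta> F G = tensor_lift (\<lambda>hs. tensor_lift
     (\<lambda>gs. wick_sum q (length hs) (length gs) \<alpha> \<beta> (pure_tensor (hs @ gs))) G) F"

lemma clinear_wick_sum_ext_left: "clinear (\<lambda>F. wick_sum_ext q \<alpha> \<beta> F G)"
  unfolding wick_sum_ext_def
  by (intro tensor_lift_linear multilinear_tensor_lift multilinear_of_append clinear_wick_sum)

lemma clinear_wick_sum_ext_right: "clinear (wick_sum_ext q \<alpha> \<beta> F)"
proof (rule clinearI)
  note lin = tensor_lift_linear[OF multilinear_of_append(2)[of "\<lambda>n k. wick_sum q n k \<alpha> \<beta>", OF clinear_wick_sum]]
  show "wick_sum_ext q \<alpha> \<beta> F (x + y) = wick_sum_ext q \<alpha> \<beta> F x + wick_sum_ext q \<alpha> \<beta> F y" for x y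
    by (simp add: wick_sum_ext_def clinear_add[OF lin] tensor_lift_fun_add)
  show "wick_sum_ext q \<alpha> \<beta> F (c *\<^sub>C x) = c *\<^sub>C wick_sum_ext q \<alpha> \<beta> F x" for c x
    by (simp add: wick_sum_ext_def clinear_scale[OF lin] tensor_lift_fun_scale)
qed

lemma wick_sum_ext_pure:
  "wick_sum_ext q \<alpha> \<beta> (pure_tensor hs) (pure_tensor gs) =
    wick_sum q (length hs) (length gs) \<alpha> \<beta> (pure_tensor (hs @ gs))"
proof -
  note ml = multilinear_of_append[of "\<lambda>n k. wick_sum q n k \<alpha> \<beta>", OF clinear_wick_sum]
  show ?thesis
    unfolding wick_sum_ext_def tensor_lift_pure[OF multilinear_tensor_lift[OF ml(1)]]
    by (rule tensor_lift_pure[OF ml(2)])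
qed

definition wick_bilin :: "real \<Rightarrow> 'a::real_inner group_tensor \<Rightarrow> 'a group_tensor \<Rightarrow> 'a TP" where
  "wick_bilin q \<xi> \<eta> = on_coeffs (\<lambda>\<alpha> F. on_coeffs (\<lambda>\<beta> G. wick_sum_ext q \<alpha> \<beta> F G) \<eta>) \<xi>"

lemma clinear_wick_bilin_left: "clinear (\<lambda>\<xi>. wick_bilin q \<xi> \<eta>)"
  unfolding wick_bilin_def
  by (rule clinear_on_coeffs) (unfold on_coeffs_def, intro clinear_sum_fun clinear_wick_sum_ext_left)

lemma clinear_wick_bilin_right: "clinear (wick_bilin q \<xi>)"
  unfolding wick_bilin_def[abs_def] on_coeffs_def[of _ \<xi>]
  by (intro clinear_sum_fun clinear_on_coeffs clinear_wick_sum_ext_right)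

lemma wick_bilin_single:
  "wick_bilin q (Poly_Mapping.single \<alpha> (pure_tensor hs)) (Poly_Mapping.single \<beta> (pure_tensor gs)) =
    wick_sum q (length hs) (length gs) \<alpha> \<beta> (pure_tensor (hs @ gs))"
proof -
  have lin: "clinear (\<lambda>F. on_coeffs (\<lambda>\<beta> G. wick_sum_ext q \<alpha> \<beta> F G) \<eta>)" for \<alpha> and \<eta> :: "'a group_tensor"
    unfolding on_coeffs_def by (intro clinear_sum_fun clinear_wick_sum_ext_left)
  show ?thesis
    unfolding wick_bilin_def on_coeffs_single[OF lin]
      on_coeffs_single[of "\<lambda>\<beta> G. wick_sum_ext q \<alpha> \<beta> (pure_tensor hs) G", OF clinear_wick_sum_ext_right]
    by (rule wick_sum_ext_pure)
qed

definition wick_mult :: "real \<Rightarrow> 'a::real_inner TP \<Rightarrow> 'a TP \<Rightarrow> 'a TP" where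
  "wick_mult q x y = wick_bilin q (Rep_TP x) (Rep_TP y)"

lemma clinear_Rep_TP: "clinear Rep_TP"
  by (rule clinearI) (simp_all add: plus_TP.rep_eq scaleC_TP.rep_eq)

lemma clinear_wick_mult_left: "clinear (\<lambda>x. wick_mult q x y)"
  unfolding wick_mult_def by (rule clinear_compose[OF clinear_Rep_TP clinear_wick_bilin_left])

lemma clinear_wick_mult_right: "clinear (wick_mult q x)"
  unfolding wick_mult_def[abs_def] by (rule clinear_compose[OF clinear_Rep_TP clinear_wick_bilin_right])

text \<open>
  The factors are represented by averages over conjugate monomials, all of which have the same
  labels, so every summand of the double average gives the same value.
\<close>

lemma wick_mult_W:
  assumes l: "labelling \<phi> n \<alpha> hs A \<gamma> h" "labelling \<psi> k \<beta> gs B \<delta> h"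
    and AB: "A \<inter> B = {}" "finite A" "finite B" "\<gamma> permutes insert 0 A" "\<delta> permutes insert 0 B"
  shows "wick_mult q (W n (Poly_Mapping.single \<alpha> (pure_tensor hs))) (W k (Poly_Mapping.single \<beta> (pure_tensor gs))) =
    (\<Sum>M\<in>cross_matchings A B. labelled_contraction q M (A \<union> B) (\<delta> \<circ> \<gamma>) h)" (is "_ = ?v")
proof -
  have \<alpha>: "\<alpha> \<in> S0 n" "length hs = n" and \<beta>: "\<beta> \<in> S0 k" "length gs = k"
    using l by (simp_all add: labelling_def)
  have "wick_bilin q (symmetrize n (Poly_Mapping.single \<alpha> (pure_tensor hs)))
      (symmetrize k (Poly_Mapping.single \<beta> (pure_tensor gs))) = ?v"
  proof (rule symmetrize_average[OF \<alpha>])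
    fix \<sigma> assume \<sigma>: "\<sigma> \<in> S1 n"
    show "wick_bilin q (Poly_Mapping.single (\<sigma> \<circ> \<alpha> \<circ> inv \<sigma>) (pure_tensor (permute_word n \<sigma> hs)))
        (symmetrize k (Poly_Mapping.single \<beta> (pure_tensor gs))) = ?v"
    proof (rule symmetrize_average[OF \<beta>])
      fix \<tau> assume \<tau>: "\<tau> \<in> S1 k"
      show "wick_bilin q (Poly_Mapping.single (\<sigma> \<circ> \<alpha> \<circ> inv \<sigma>) (pure_tensor (permute_word n \<sigma> hs)))
        (Poly_Mapping.single (\<tau> \<circ> \<beta> \<circ> inv \<tau>) (pure_tensor (permute_word k \<tau> gs))) = ?v"
        unfolding wick_bilin_single length_permute_word
        by (rule wick_sum_labelling[OF labelling_permute_word[OF l(1) \<sigma>] labelling_permute_word[OF l(2) \<tau>] AB])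
    qed (simp_all add: clinear_add[OF clinear_wick_bilin_right] clinear_scale[OF clinear_wick_bilin_right])
  qed (simp_all add: clinear_add[OF clinear_wick_bilin_left] clinear_scale[OF clinear_wick_bilin_left])
  then show ?thesis
    by (simp add: wick_mult_def Rep_W single_S0_supported \<alpha>(1) \<beta>(1))
qed

lemma wick_mult_labelled_W:
  assumes "A \<inter> B = {}" "finite A" "finite B" "0 \<notin> A" "0 \<notin> B" "\<gamma> permutes insert 0 A" "\<delta> permutes insert 0 B"
  shows "wick_mult q (labelled_W A \<gamma> h) (labelled_W B \<delta> h) = (\<Sum>M\<in>cross_matchings A B. labelled_contraction q M (A \<union> B) (\<delta> \<circ> \<gamma>) h)"
  unfolding labelled_W_def
  by (rule wick_mult_W[OF labelling_relabel labelling_relabel]) (use assms in auto)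


subsection \<open>Contracting in two steps\<close>

text \<open>
  Contracting along \<open>M \<union> N\<close> first, the contraction along \<open>M\<close> affects only \<open>\<gamma>\<close> and that along \<open>N\<close>
  only \<open>\<delta>\<close>, which leaves the product of the residual permutations for \<open>K\<close>.
\<close>

lemma labelled_contraction_split:
  assumes q: "q \<noteq> 0" and fin: "finite A" "finite B" and zero: "0 \<notin> A" "0 \<notin> B" and AB: "A \<inter> B = {}"
    and \<gamma>: "\<gamma> permutes insert 0 A" and \<delta>: "\<delta> permutes insert 0 B"
    and M: "M \<in> matchings A" and N: "N \<in> matchings B"
    and K: "K \<in> matchings ((A - \<Union>M) \<union> (B - \<Union>N))"
  shows "labelled_contraction q (M \<union> N \<union> K) (A \<union> B) (\<delta> \<circ> \<gamma>) h =
    (weight q M \<gamma> h * weight q N \<delta> h) *\<^sub>C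
      labelled_contraction q K ((A - \<Union>M) \<union> (B - \<Union>N)) (residual N \<delta> \<circ> residual M \<gamma>) h"
proof -
  have sub: "\<Union>M \<subseteq> A" "\<Union>N \<subseteq> B" "\<Union>K \<subseteq> (A - \<Union>M) \<union> (B - \<Union>N)"
    by (rule matchings_Union[OF M], rule matchings_Union[OF N], rule matchings_Union[OF K])
  have perm: "\<delta> \<circ> \<gamma> permutes insert 0 (A \<union> B)"
    by (rule permutes_compose[OF permutes_subset[OF \<gamma>] permutes_subset[OF \<delta>]]) auto
  have disj: "\<Union>M \<inter> \<Union>N = {}" "\<Union>(M \<union> N) \<inter> \<Union>K = {}" using sub AB by blast+
  have MN: "M \<union> N \<in> matchings (A \<union> B)" by (rule matchings_Un[OF M N disj(1)])
  have "M \<union> N \<union> K \<in> matchings (A \<union> B \<union> ((A - \<Union>M) \<union> (B - \<Union>N)))" by (rule matchings_Un[OF MN K disj(2)])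
  moreover have "A \<union> B \<union> ((A - \<Union>M) \<union> (B - \<Union>N)) = A \<union> B" by blast
  ultimately have MNK: "M \<union> N \<union> K \<in> matchings (A \<union> B)" by simp
  have finAB: "finite (A \<union> B)" and zeroAB: "0 \<notin> A \<union> B" using fin zero by auto
  let ?\<gamma> = "residual M \<gamma>"
  have \<gamma>': "?\<gamma> permutes insert 0 (A - \<Union>M)" by (rule residual_permutes[OF fin(1) zero(1) M \<gamma>])
  have A': "finite (A - \<Union>M)" "0 \<notin> A - \<Union>M" "(A - \<Union>M) \<inter> B = {}" using fin zero AB by auto
  have res1: "residual M (\<delta> \<circ> \<gamma>) = \<delta> \<circ> ?\<gamma>" and w1: "weight q M (\<delta> \<circ> \<gamma>) h = weight q M \<gamma> h"
    by (rule residual_comp_left[OF fin zero AB \<gamma> \<delta> M], rule weight_comp_left[OF fin zero AB \<gamma> \<delta> M])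
  have res2: "residual N (\<delta> \<circ> ?\<gamma>) = residual N \<delta> \<circ> ?\<gamma>" and w2: "weight q N (\<delta> \<circ> ?\<gamma>) h = weight q N \<delta> h"
    by (rule residual_comp_right[OF A'(1) fin(2) A'(2) zero(2) A'(3) \<gamma>' \<delta> N],
        rule weight_comp_right[OF A'(1) fin(2) A'(2) zero(2) A'(3) \<gamma>' \<delta> N])
  have res12: "residual (M \<union> N) (\<delta> \<circ> \<gamma>) = residual N \<delta> \<circ> ?\<gamma>"
    using residual_Un[OF q finAB zeroAB perm MN disj(1)] by (simp only: res1 res2)
  have w12: "weight q (M \<union> N) (\<delta> \<circ> \<gamma>) h = weight q M \<gamma> h * weight q N \<delta> h"
    using weight_Un[OF q finAB zeroAB perm MN disj(1), of h] by (simp only: res1 w1 w2)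
  have "A \<union> B - \<Union>(M \<union> N \<union> K) = ((A - \<Union>M) \<union> (B - \<Union>N)) - \<Union>K"
    using sub AB by blast
  then show ?thesis
    unfolding labelled_contraction_def residual_Un[OF q finAB zeroAB perm MNK disj(2)]
      weight_Un[OF q finAB zeroAB perm MNK disj(2)] res12 w12
    by (simp add: scaleC_scaleC)
qed

text \<open>
  The identity behind the theorem: multiplying the sums over \<open>M\<close> and \<open>N\<close> by the formula for \<open>W\<close>
  introduces a sum over \<open>K\<close>, and the triples run over all matchings of \<open>A \<union> B\<close>.
\<close>

lemma wick_mult_all_contractions:
  assumes fin: "finite A" "finite B" and zero: "0 \<notin> A" "0 \<notin> B" and AB: "A \<inter> B = {}"
    and \<gamma>: "\<gamma> permutes insert 0 A" and \<delta>: "\<delta> permutes insert 0 B" and q: "q \<noteq> 0"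
  shows "wick_mult q (\<Sum>M\<in>matchings A. labelled_contraction q M A \<gamma> h) (\<Sum>N\<in>matchings B. labelled_contraction q N B \<delta> h) =
    (\<Sum>M\<in>matchings (A \<union> B). labelled_contraction q M (A \<union> B) (\<delta> \<circ> \<gamma>) h)"
proof -
  let ?K = "\<lambda>M N. cross_matchings (A - \<Union>M) (B - \<Union>N)"
  let ?L = "\<lambda>M. labelled_contraction q M (A \<union> B) (\<delta> \<circ> \<gamma>) h"
  have prod: "wick_mult q (labelled_contraction q M A \<gamma> h) (labelled_contraction q N B \<delta> h) = (\<Sum>K\<in>?K M N. ?L (M \<union> N \<union> K))"
    if M: "M \<in> matchings A" and N: "N \<in> matchings B" for M N
  proof -
    have "wick_mult q (labelled_W (A - \<Union>M) (residual M \<gamma>) h) (labelled_W (B - \<Union>N) (residual N \<delta>) h) =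
        (\<Sum>K\<in>?K M N. labelled_contraction q K ((A - \<Union>M) \<union> (B - \<Union>N)) (residual N \<delta> \<circ> residual M \<gamma>) h)"
      using fin zero AB
      by (intro wick_mult_labelled_W residual_permutes[OF fin(1) zero(1) M \<gamma>] residual_permutes[OF fin(2) zero(2) N \<delta>]) auto
    then have "wick_mult q (labelled_contraction q M A \<gamma> h) (labelled_contraction q N B \<delta> h) =
        (\<Sum>K\<in>?K M N. (weight q M \<gamma> h * weight q N \<delta> h) *\<^sub>C
          labelled_contraction q K ((A - \<Union>M) \<union> (B - \<Union>N)) (residual N \<delta> \<circ> residual M \<gamma>) h)"
      by (simp only: labelled_contraction_def[of q M] labelled_contraction_def[of q N] clinear_scale[OF clinear_wick_mult_left]
          clinear_scale[OF clinear_wick_mult_right] scaleC_scaleC cv.scale_sum_right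
          mult.commute[of "weight q N \<delta> h"])
    also have "\<dots> = (\<Sum>K\<in>?K M N. ?L (M \<union> N \<union> K))"
    proof (rule sum.cong[OF refl])
      fix K assume "K \<in> ?K M N"
      then have "K \<in> matchings ((A - \<Union>M) \<union> (B - \<Union>N))" by (simp add: cross_matchings_def)
      from labelled_contraction_split[OF q fin zero AB \<gamma> \<delta> M N this, of h]
      show "(weight q M \<gamma> h * weight q N \<delta> h) *\<^sub>C
          labelled_contraction q K ((A - \<Union>M) \<union> (B - \<Union>N)) (residual N \<delta> \<circ> residual M \<gamma>) h = ?L (M \<union> N \<union> K)" by (rule sym)
    qed
    finally show ?thesis .
  qed
  let ?S = "SIGMA MN:matchings A \<times> matchings B. ?K (fst MN) (snd MN)"
  have fin_cross: "finite (?K M N)" for M N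
    by (rule finite_subset[OF _ finite_matchings[of "A \<union> B"]])
      (use fin in \<open>auto simp: cross_matchings_def matchings_def\<close>)
  have "wick_mult q (\<Sum>M\<in>matchings A. labelled_contraction q M A \<gamma> h) (\<Sum>N\<in>matchings B. labelled_contraction q N B \<delta> h) =
      (\<Sum>M\<in>matchings A. \<Sum>N\<in>matchings B. wick_mult q (labelled_contraction q M A \<gamma> h) (labelled_contraction q N B \<delta> h))"
    by (simp only: clinear_sum[OF clinear_wick_mult_left] clinear_sum[OF clinear_wick_mult_right])
      (rule sum.swap)
  also have "\<dots> = (\<Sum>M\<in>matchings A. \<Sum>N\<in>matchings B. \<Sum>K\<in>?K M N. ?L (M \<union> N \<union> K))"
    by (intro sum.cong refl prod)
  also have "\<dots> = (\<Sum>MN\<in>matchings A \<times> matchings B. \<Sum>K\<in>?K (fst MN) (snd MN). ?L (fst MN \<union> snd MN \<union> K))"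
    by (simp add: sum.cartesian_product case_prod_unfold)
  also have "\<dots> = (\<Sum>x\<in>?S. ?L (fst (fst x) \<union> snd (fst x) \<union> snd x))"
    using fin by (subst sum.Sigma) (auto simp: finite_matchings fin_cross case_prod_unfold)
  also have "\<dots> = (\<Sum>x\<in>?S. ?L ((\<lambda>((M, N), K). M \<union> N \<union> K) x))"
    by (simp add: case_prod_unfold)
  also have "\<dots> = (\<Sum>M\<in>matchings (A \<union> B). ?L M)"
    by (rule sum.reindex_bij_betw[OF bij_betw_split_matchings[OF AB]])
  finally show ?thesis .
qed

lemma clinear_eq_on_tensor_mult:
  assumes f: "clinear f" and g: "clinear g"
    and eq: "\<And>fs. length fs = n + k \<Longrightarrow> f (pure_tensor fs) = g (pure_tensor fs)"
    and F: "F \<in> tpow n" and G: "G \<in> tpow k"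
  shows "f (F \<otimes>\<^sub>T G) = g (F \<otimes>\<^sub>T G)"
proof (rule clinear_eq_on_tpow[OF _ _ _ F])
  fix hs :: "'a list" assume hs: "length hs = n"
  show "f (pure_tensor hs \<otimes>\<^sub>T G) = g (pure_tensor hs \<otimes>\<^sub>T G)"
    by (rule clinear_eq_on_tpow[OF _ _ _ G])
      (simp_all add: clinear_compose[OF clinear_tensor_mult_right f]
        clinear_compose[OF clinear_tensor_mult_right g] tensor_mult_pure eq hs)
qed (simp_all add: clinear_compose[OF tensor_mult_linear_left f] clinear_compose[OF tensor_mult_linear_left g])

lemma is_TP_mult_wick_mult:
  assumes q: "q \<noteq> 0"
  shows "is_TP_mult q (wick_mult q)"
  unfolding is_TP_mult_def
proof (intro conjI allI ballI)
  fix n k :: nat and \<alpha> \<beta> and F G :: "'a tensor"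
  assume \<alpha>: "\<alpha> \<in> S0 n" and \<beta>: "\<beta> \<in> S0 k" and F: "F \<in> tpow n" and G: "G \<in> tpow k"
  let ?T = "\<lambda>n \<alpha> F. T q n (sym_tens n (gr \<alpha>) F)"
  let ?A = "{1..n}" and ?B = "{n + 1..n + k}" and ?c = "perm_cup n \<alpha> \<beta>"
  have c: "?c \<in> S0 (n + k)" by (rule perm_cup_S0[OF \<alpha> \<beta>])
  have AB: "?A \<union> ?B = {1..n + k}" by auto
  note \<alpha>' = \<alpha>[unfolded S0_iff_permutes] and \<beta>' = shift_perm_permutes[OF \<beta>, of n] and c' = c[unfolded S0_iff_permutes]
  have pure: "wick_mult q (?T n \<alpha> (pure_tensor hs)) (?T k \<beta> (pure_tensor gs)) =
      ?T (n + k) ?c (pure_tensor hs \<otimes>\<^sub>T pure_tensor gs)"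
    if hs: "length hs = n" and gs: "length gs = k" for hs gs :: "'a list"
  proof -
    let ?h = "letter (hs @ gs)"
    have "labelling (\<lambda>i. i) n \<alpha> hs ?A \<alpha> ?h"
      using labelling_id[OF \<alpha> hs] hs by (auto simp: labelling_def nth_append)
    then have "?T n \<alpha> (pure_tensor hs) = (\<Sum>M\<in>matchings ?A. labelled_contraction q M ?A \<alpha> ?h)"
      by (rule T_sym_tens[OF _ _ \<alpha>']) simp
    moreover have "?T k \<beta> (pure_tensor gs) = (\<Sum>N\<in>matchings ?B. labelled_contraction q N ?B (shift_perm n \<beta>) ?h)"
      by (rule T_sym_tens[OF labelling_shift[OF \<beta> gs hs] _ \<beta>']) simp
    moreover have "?T (n + k) ?c (pure_tensor (hs @ gs)) = (\<Sum>M\<in>matchings {1..n + k}. labelled_contraction q M {1..n + k} ?c ?h)"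
      using hs gs by (intro T_sym_tens[OF labelling_id[OF c] _ c']) simp_all
    moreover have "wick_mult q (\<Sum>M\<in>matchings ?A. labelled_contraction q M ?A \<alpha> ?h) (\<Sum>N\<in>matchings ?B. labelled_contraction q N ?B (shift_perm n \<beta>) ?h) =
        (\<Sum>M\<in>matchings (?A \<union> ?B). labelled_contraction q M (?A \<union> ?B) (shift_perm n \<beta> \<circ> \<alpha>) ?h)"
      by (rule wick_mult_all_contractions[OF _ _ _ _ _ \<alpha>' \<beta>' q]) auto
    ultimately show ?thesis by (simp only: AB tensor_mult_pure perm_cup_def)
  qed
  note T\<alpha> = clinear_T_sym_tens[OF \<alpha>] and T\<beta> = clinear_T_sym_tens[OF \<beta>] and Tc = clinear_T_sym_tens[OF c]
  show "wick_mult q (?T n \<alpha> F) (?T k \<beta> G) = ?T (n + k) ?c (F \<otimes>\<^sub>T G)"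
  proof (rule clinear_eq_on_tpow[OF _ _ _ F])
    show "clinear (\<lambda>F. wick_mult q (?T n \<alpha> F) (?T k \<beta> G))"
      by (rule clinear_compose[OF T\<alpha> clinear_wick_mult_left])
    show "clinear (\<lambda>F. ?T (n + k) ?c (F \<otimes>\<^sub>T G))"
      by (rule clinear_compose[OF tensor_mult_linear_left Tc])
    fix hs :: "'a list" assume hs: "length hs = n"
    show "wick_mult q (?T n \<alpha> (pure_tensor hs)) (?T k \<beta> G) = ?T (n + k) ?c (pure_tensor hs \<otimes>\<^sub>T G)"
    proof (rule clinear_eq_on_tpow[OF _ _ _ G])
      show "clinear (\<lambda>G. wick_mult q (?T n \<alpha> (pure_tensor hs)) (?T k \<beta> G))"
        by (rule clinear_compose[OF T\<beta> clinear_wick_mult_right])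
      show "clinear (\<lambda>G. ?T (n + k) ?c (pure_tensor hs \<otimes>\<^sub>T G))"
        by (rule clinear_compose[OF clinear_tensor_mult_right Tc])
    qed (rule pure[OF hs])
  qed
qed (rule clinear_wick_mult_left clinear_wick_mult_right)+

subsection \<open>Uniqueness\<close>

lemma labelled_contraction_empty:
  assumes "finite A" "\<gamma> permutes insert 0 A"
  shows "labelled_contraction q {} A \<gamma> h = labelled_W A \<gamma> h"
proof -
  have perm: "permutation \<gamma>" using permutes_permutation[OF assms(2)] assms(1) by simp
  have inv: "involution {} = (\<lambda>x. x)" by (auto simp: involution_def supp_def pairs_def)
  have "residual {} \<gamma> x = \<gamma> x" for x
    unfolding residual_def inv using perm
    by (intro remove_points_eqI) (simp_all add: leads_to.stop o_def)
  then have "residual {} \<gamma> = \<gamma>" by blast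
  then show ?thesis by (simp add: labelled_contraction_def weight_def loops_def scaleC_one)
qed

definition T_elements :: "real \<Rightarrow> 'a::real_inner TP set" where
  "T_elements q = {T q n (sym_tens n (gr \<alpha>) (pure_tensor hs)) | n \<alpha> hs. \<alpha> \<in> S0 n \<and> length hs = n}"

text \<open>
  Solving for \<open>W\<close> by induction on the degree: the empty contraction contributes \<open>W\<close> to the sum
  \<open>T\<close> of the same monomial, and all others have fewer points.
\<close>

lemma labelled_W_in_span_T:
  assumes "finite A" "0 \<notin> A" "\<gamma> permutes insert 0 A"
  shows "labelled_W A \<gamma> h \<in> cv.span (T_elements q)"
  using assms
proof (induction "card A" arbitrary: A \<gamma> rule: less_induct)
  case less
  note l = labelling_relabel[OF less.prems, of h]
  let ?t = "\<Sum>M\<in>matchings A. labelled_contraction q M A \<gamma> h"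
  have "?t \<in> T_elements q"
    unfolding T_elements_def T_sym_tens[OF l less.prems(1,3), symmetric]
    using l unfolding labelling_def by blast
  then have t: "?t \<in> cv.span (T_elements q)" by (rule cv.span_base)
  have "labelled_contraction q M A \<gamma> h \<in> cv.span (T_elements q)" if M: "M \<in> matchings A - {{}}" for M
  proof -
    obtain P where P: "P \<in> M" "card P = 2" using M by (auto simp: matchings_def)
    then have "P \<noteq> {}" by auto
    then have "\<Union>M \<subseteq> A" "\<Union>M \<noteq> {}" using M P(1) matchings_Union[of M A] by blast+
    then have "card (A - \<Union>M) < card A" using less.prems(1) by (intro psubset_card_mono) auto
    then have "labelled_W (A - \<Union>M) (residual M \<gamma>) h \<in> cv.span (T_elements q)"
      using M less.prems by (intro less.hyps residual_permutes) auto
    then show ?thesis by (simp add: labelled_contraction_def cv.span_scale)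
  qed
  then have "(\<Sum>M\<in>matchings A - {{}}. labelled_contraction q M A \<gamma> h) \<in> cv.span (T_elements q)"
    by (rule cv.span_sum)
  with t have "?t - (\<Sum>M\<in>matchings A - {{}}. labelled_contraction q M A \<gamma> h) \<in> cv.span (T_elements q)"
    by (rule cv.span_diff)
  moreover have "?t = labelled_contraction q {} A \<gamma> h + (\<Sum>M\<in>matchings A - {{}}. labelled_contraction q M A \<gamma> h)"
    by (rule sum.remove[OF finite_matchings[OF less.prems(1)] matchings_empty])
  ultimately show ?case by (simp add: labelled_contraction_empty[OF less.prems(1,3)])
qed

lemma W_in_span_T:
  assumes \<alpha>: "\<alpha> \<in> S0 n" and F: "F \<in> tpow n"
  shows "W n (Poly_Mapping.single \<alpha> F) \<in> cv.span (T_elements q)"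
proof -
  note lin = clinear_W[OF clinear_single single_S0_supported[OF \<alpha>]]
  have "F \<in> cv.span {pure_tensor hs | hs. length hs = n}" using F tpow_subset_span by blast
  then show ?thesis
  proof (induction rule: cv.span_induct)
    case base
    show ?case
      unfolding cv.subspace_def mem_Collect_eq
      by (simp only: clinear_zero[OF lin] clinear_add[OF lin] clinear_scale[OF lin])
        (simp add: cv.span_zero cv.span_add cv.span_scale)
  next
    case (step F)
    then obtain hs where hs: "F = pure_tensor hs" "length hs = n" by blast
    show ?case
      unfolding hs(1) W_labelling[OF labelling_id[OF \<alpha> hs(2)] _ \<alpha>[unfolded S0_iff_permutes], simplified]
      by (rule labelled_W_in_span_T) (use \<alpha>[unfolded S0_iff_permutes] in auto)
  qed
qed

lemma span_T_elements: "x \<in> cv.span (T_elements q)"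
proof -
  have "Rep_TP x \<in> cv.span {sym_tens n (gr \<alpha>) F | n \<alpha> F. \<alpha> \<in> S0 n \<and> F \<in> tpow n}" by (rule Rep_TP)
  then have "Rep_TP x \<in> Rep_TP ` cv.span (T_elements q)"
  proof (induction rule: cv.span_induct)
    case base
    show ?case
      unfolding cv.subspace_def
    proof (intro conjI ballI allI)
      let ?R = "{\<xi>. \<xi> \<in> Rep_TP ` cv.span (T_elements q)}"
      have "Rep_TP 0 \<in> ?R" using cv.span_zero by blast
      then show "0 \<in> ?R" by (simp only: zero_TP.rep_eq)
      show "\<xi> + \<eta> \<in> ?R" if sum: "\<xi> \<in> ?R" "\<eta> \<in> ?R" for \<xi> \<eta>
      proof -
        obtain x y where xy: "x \<in> cv.span (T_elements q)" "y \<in> cv.span (T_elements q)"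
            "\<xi> = Rep_TP x" "\<eta> = Rep_TP y" using sum by blast
        have "Rep_TP (x + y) \<in> ?R" using cv.span_add[OF xy(1,2)] by blast
        then show ?thesis by (simp only: xy(3,4) plus_TP.rep_eq)
      qed
      show "c *\<^sub>C \<xi> \<in> ?R" if scale: "\<xi> \<in> ?R" for c \<xi>
      proof -
        obtain x where x: "x \<in> cv.span (T_elements q)" "\<xi> = Rep_TP x" using scale by blast
        have "Rep_TP (c *\<^sub>C x) \<in> ?R" using cv.span_scale[OF x(1)] by blast
        then show ?thesis by (simp only: x(2) scaleC_TP.rep_eq)
      qed
    qed
  next
    case (step \<xi>)
    then obtain n \<alpha> F where \<xi>: "\<xi> = sym_tens n (gr \<alpha>) F" "\<alpha> \<in> S0 n" "F \<in> tpow n" by blast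
    then have "\<xi> = Rep_TP (W n (Poly_Mapping.single \<alpha> F))"
      by (simp add: Rep_W single_S0_supported sym_tens_def gtens_gr)
    then show ?case using W_in_span_T[OF \<xi>(2,3)] by blast
  qed
  then show ?thesis by (auto simp: Rep_TP_inject)
qed

lemma is_TP_mult_unique:
  assumes m: "is_TP_mult q m" and m': "is_TP_mult q m'"
  shows "m = m'"
proof (intro ext)
  fix x y
  have left: "clinear (\<lambda>x. m x y)" "clinear (\<lambda>x. m' x y)"
    and right: "clinear (m x)" "clinear (m' x)" for x y
    using m m' by (simp_all add: is_TP_mult_def)
  have eq: "m s t = m' s t" if "s \<in> T_elements q" "t \<in> T_elements q" for s t
    using that m m' unfolding is_TP_mult_def T_elements_def by (clarsimp simp: pure_in_tpow)
  have "m s y = m' s y" if "s \<in> T_elements q" for s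
    by (rule clinear_eq_on_span[OF right eq[OF that] span_T_elements])
  then show "m x y = m' x y"
    by (rule clinear_eq_on_span[OF left _ span_T_elements])
qed

lemma TP_mult_eq_wick_mult: "q \<noteq> 0 \<Longrightarrow> TP_mult q = wick_mult q"
  unfolding TP_mult_def
  by (rule the_equality[where P = "is_TP_mult q", OF is_TP_mult_wick_mult])
    (auto intro: is_TP_mult_unique is_TP_mult_wick_mult)

section \<open>The product formula\<close>

lemma wick_mult_single:
  assumes \<alpha>: "\<alpha> \<in> S0 n" and \<beta>: "\<beta> \<in> S0 k" and F: "F \<in> tpow n" and G: "G \<in> tpow k"
  shows "wick_mult q (W n (Poly_Mapping.single \<alpha> F)) (W k (Poly_Mapping.single \<beta> G)) =
    wick_sum q n k \<alpha> \<beta> (F \<otimes>\<^sub>T G)"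
proof -
  note W\<alpha> = clinear_W[OF clinear_single single_S0_supported[OF \<alpha>]]
    and W\<beta> = clinear_W[OF clinear_single single_S0_supported[OF \<beta>]]
  have pure: "wick_mult q (W n (Poly_Mapping.single \<alpha> (pure_tensor hs))) (W k (Poly_Mapping.single \<beta> (pure_tensor gs))) =
      wick_sum q n k \<alpha> \<beta> (pure_tensor hs \<otimes>\<^sub>T pure_tensor gs)"
    if hs: "length hs = n" and gs: "length gs = k" for hs gs :: "'a list"
  proof -
    have l: "labelling (\<lambda>i. i) n \<alpha> hs {1..n} \<alpha> (letter (hs @ gs))"
      using labelling_id[OF \<alpha> hs] hs by (auto simp: labelling_def nth_append)
    note l' = labelling_shift[OF \<beta> gs hs]
    have disj: "{1..n} \<inter> {n + 1..n + k} = {}" by auto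
    show ?thesis
      unfolding tensor_mult_pure
        wick_sum_labelling[OF l l' disj finite_atLeastAtMost finite_atLeastAtMost \<alpha>[unfolded S0_iff_permutes] shift_perm_permutes[OF \<beta>]]
      by (rule wick_mult_W[OF l l' disj finite_atLeastAtMost finite_atLeastAtMost \<alpha>[unfolded S0_iff_permutes] shift_perm_permutes[OF \<beta>]])
  qed
  show ?thesis
  proof (rule clinear_eq_on_tpow[OF clinear_compose[OF W\<alpha> clinear_wick_mult_left]
        clinear_compose[OF tensor_mult_linear_left clinear_wick_sum] _ F])
    fix hs :: "'a list" assume hs: "length hs = n"
    show "wick_mult q (W n (Poly_Mapping.single \<alpha> (pure_tensor hs))) (W k (Poly_Mapping.single \<beta> G)) =
        wick_sum q n k \<alpha> \<beta> (pure_tensor hs \<otimes>\<^sub>T G)"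
      by (rule clinear_eq_on_tpow[OF clinear_compose[OF W\<beta> clinear_wick_mult_right]
        clinear_compose[OF clinear_tensor_mult_right clinear_wick_sum] _ G]) (rule pure[OF hs])
  qed
qed

lemma card_pairs_P12_bip: "\<pi> \<in> P12_bip n k \<Longrightarrow> card (pairs \<pi>) \<le> min n k"
  using card_cross_matching[of "{1..n}" "{n + 1..n + k}" "pairs \<pi>"]
    bij_betwE[OF bij_betw_pairs_bip[of n k]] by simp

text \<open>
  The partition into singletons contributes the leading term of the product formula.
\<close>

lemma wick_sum_level_0:
  assumes \<alpha>: "\<alpha> \<in> S0 n" and \<beta>: "\<beta> \<in> S0 k" and F: "F \<in> tpow n" and G: "G \<in> tpow k"
  shows "(\<Sum>\<pi> | \<pi> \<in> P12_bip n k \<and> card (pairs \<pi>) = 0. W (n + k - 2 * card (pairs \<pi>))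
      (contract q (n + k) \<pi> (Poly_Mapping.single (perm_cup n \<alpha> \<beta>) (F \<otimes>\<^sub>T G)))) =
    W (n + k) (Poly_Mapping.single (perm_cup n \<alpha> \<beta>) (F \<otimes>\<^sub>T G))"
proof -
  let ?c = "perm_cup n \<alpha> \<beta>" and ?C = "cross_matchings {1..n} {n + 1..n + k}"
  have c: "?c \<in> S0 (n + k)" by (rule perm_cup_S0[OF \<alpha> \<beta>])
  have fin: "finite (pairs \<pi>)" if "\<pi> \<in> P12_bip n k" for \<pi>
    using finite_matching[OF _ pairs_P12[OF P12_bip_P12[OF that]]] by simp
  have "{} \<in> ?C" by (simp add: cross_matchings_def matchings_empty)
  then obtain \<pi>0 where \<pi>0: "\<pi>0 \<in> P12_bip n k" "pairs \<pi>0 = {}"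
    using bij_betw_pairs_bip[of n k] unfolding bij_betw_def by (metis imageE)
  have "{\<pi>. \<pi> \<in> P12_bip n k \<and> card (pairs \<pi>) = 0} = {\<pi>0}"
  proof (intro equalityI subsetI)
    fix \<pi> assume "\<pi> \<in> {\<pi>. \<pi> \<in> P12_bip n k \<and> card (pairs \<pi>) = 0}"
    then have "\<pi> \<in> P12_bip n k" "pairs \<pi> = pairs \<pi>0" using fin \<pi>0(2) by auto
    then show "\<pi> \<in> {\<pi>0}"
      using inj_onD[OF bij_betw_imp_inj_on[OF bij_betw_pairs_bip]] \<pi>0(1) by blast
  qed (use \<pi>0 in simp)
  then have sum: "(\<Sum>\<pi> | \<pi> \<in> P12_bip n k \<and> card (pairs \<pi>) = 0. W (n + k - 2 * card (pairs \<pi>))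
      (contract q (n + k) \<pi> (Poly_Mapping.single ?c (F \<otimes>\<^sub>T G)))) =
      W (n + k - 2 * card (pairs \<pi>0)) (contract q (n + k) \<pi>0 (Poly_Mapping.single ?c (F \<otimes>\<^sub>T G)))"
    by simp
  have \<pi>0': "\<pi>0 \<in> P12 (n + k)" by (rule P12_bip_P12[OF \<pi>0(1)])
  have "W (n + k - 2 * card (pairs \<pi>0)) (contract q (n + k) \<pi>0 (Poly_Mapping.single ?c (F \<otimes>\<^sub>T G))) =
      W (n + k) (Poly_Mapping.single ?c (F \<otimes>\<^sub>T G))"
  proof (rule clinear_eq_on_tensor_mult[OF _ _ _ F G])
    show "clinear (\<lambda>F. W (n + k - 2 * card (pairs \<pi>0)) (contract q (n + k) \<pi>0 (Poly_Mapping.single ?c F)))"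
      by (rule clinear_W[OF clinear_compose[OF clinear_single clinear_contract[OF \<pi>0']]
            contract_single_S0_supported[OF \<pi>0' c]])
    show "clinear (\<lambda>F. W (n + k) (Poly_Mapping.single ?c F))"
      by (rule clinear_W[OF clinear_single single_S0_supported[OF c]])
    fix fs :: "'a list" assume fs: "length fs = n + k"
    show "W (n + k - 2 * card (pairs \<pi>0)) (contract q (n + k) \<pi>0 (Poly_Mapping.single ?c (pure_tensor fs))) =
      W (n + k) (Poly_Mapping.single ?c (pure_tensor fs))"
      by (rule trans[OF W_contract_pure[OF \<pi>0' c fs]])
        (simp only: \<pi>0(2) labelled_contraction_empty[OF finite_atLeastAtMost c[unfolded S0_iff_permutes]]
          W_labelling[OF labelling_id[OF c fs] finite_atLeastAtMost c[unfolded S0_iff_permutes]])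
  qed
  then show ?thesis unfolding sum .
qed

theorem propositionV11:
  fixes q :: real and n k :: nat and \<alpha> \<beta> :: "nat \<Rightarrow> nat"
    and F G :: "'a::{real_inner, complete_space} tensor"
  assumes "q \<noteq> 0"
    and "\<alpha> \<in> S0 n" and "\<beta> \<in> S0 k"
    and "F \<in> tpow n" and "G \<in> tpow k"
  shows "TP_mult q (W n (sym_tens n (gr \<alpha>) F)) (W k (sym_tens k (gr \<beta>) G)) =
           W (n + k) (sym_tens (n + k) (gr (perm_cup n \<alpha> \<beta>)) (F \<otimes>\<^sub>T G)) +
           (\<Sum>l = 1..min n k. (1 / fact l) *\<^sub>C
              W (n + k - 2 * l)
                (contract_level q n k l (gr (perm_cup n \<alpha> \<beta>) \<otimes>\<^sub>G (F \<otimes>\<^sub>T G)))) \<and>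
         W (n + k) (sym_tens (n + k) (gr (perm_cup n \<alpha> \<beta>)) (F \<otimes>\<^sub>T G)) +
           (\<Sum>l = 1..min n k. (1 / fact l) *\<^sub>C
              W (n + k - 2 * l)
                (contract_level q n k l (gr (perm_cup n \<alpha> \<beta>) \<otimes>\<^sub>G (F \<otimes>\<^sub>T G)))) =
         (\<Sum>\<pi>\<in>P12_bip n k.
            W (n + k - 2 * card (pairs \<pi>))
              (sym_tens (n + k - 2 * card (pairs \<pi>))
                (contract_alg q (n + k) \<pi> (gr (perm_cup n \<alpha> \<beta>)))
                (contract_tensor (n + k) \<pi> (F \<otimes>\<^sub>T G))))"
proof -
  let ?c = "perm_cup n \<alpha> \<beta>" and ?N = "n + k"
  define H where "H = F \<otimes>\<^sub>T G"
  define C where "C \<pi> = contract q ?N \<pi> (Poly_Mapping.single ?c H)" for \<pi>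
  define summand where "summand \<pi> = W (?N - 2 * card (pairs \<pi>)) (C \<pi>)" for \<pi>
  have c: "?c \<in> S0 ?N" by (rule perm_cup_S0[OF assms(2,3)])
  have C: "C \<pi> \<in> S0_supported (?N - 2 * card (pairs \<pi>))" if "\<pi> \<in> P12_bip n k" for \<pi>
    unfolding C_def by (rule contract_single_S0_supported[OF P12_bip_P12[OF that] c])
  have wick_sum: "wick_sum q n k \<alpha> \<beta> H = (\<Sum>\<pi>\<in>P12_bip n k. summand \<pi>)"
    using assms by (simp add: wick_sum_def summand_def C_def)
  have product: "TP_mult q (W n (sym_tens n (gr \<alpha>) F)) (W k (sym_tens k (gr \<beta>) G)) = wick_sum q n k \<alpha> \<beta> H"
    using assms by (simp add: TP_mult_eq_wick_mult W_symmetrize wick_mult_single H_def)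
  have finite: "finite (P12_bip n k)"
  proof (rule finite_subset)
    show "P12_bip n k \<subseteq> Pow (Pow {1..?N})" by (auto simp: P12_bip_def P12_def partition_on_def)
  qed simp
  have level: "(1 / fact l) *\<^sub>C W (?N - 2 * l) (contract_level q n k l (gr ?c \<otimes>\<^sub>G H)) =
      (\<Sum>\<pi> | \<pi> \<in> P12_bip n k \<and> card (pairs \<pi>) = l. summand \<pi>)" for l
  proof -
    let ?I = "{\<pi>. \<pi> \<in> P12_bip n k \<and> card (pairs \<pi>) = l}"
    have "W (?N - 2 * l) (sum C I) = (\<Sum>\<pi>\<in>I. summand \<pi>) \<and> sum C I \<in> S0_supported (?N - 2 * l)"
      if "finite I" "I \<subseteq> ?I" for I
      using that
    proof (induction I)
      case empty
      have "(0 :: 'a group_tensor) \<in> S0_supported (?N - 2 * l)"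
        by (rule cv.subspace_0[OF subspace_S0_supported])
      then show ?case using W_scale[of 0 "?N - 2 * l" 0] by simp
    next
      case (insert \<pi> I)
      then have "C \<pi> \<in> S0_supported (?N - 2 * l)" "summand \<pi> = W (?N - 2 * l) (C \<pi>)"
        using C[of \<pi>] by (auto simp: summand_def)
      then show ?case
        using insert cv.subspace_add[OF subspace_S0_supported, of "C \<pi>" "?N - 2 * l" "sum C I"]
        by (simp add: W_add)
    qed
    from this[of ?I] finite have "W (?N - 2 * l) (sum C ?I) = (\<Sum>\<pi>\<in>?I. summand \<pi>)"
      and "sum C ?I \<in> S0_supported (?N - 2 * l)" by simp_all
    then show ?thesis
      by (simp add: contract_level_def gtens_gr C_def[symmetric] W_scale scaleC_scaleC scaleC_one)
  qed
  have "W ?N (sym_tens ?N (gr ?c) H) = (\<Sum>\<pi> | \<pi> \<in> P12_bip n k \<and> card (pairs \<pi>) = 0. summand \<pi>)"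
    using wick_sum_level_0[OF assms(2-5), of q] by (simp add: W_symmetrize[OF c] summand_def C_def H_def)
  then have "W ?N (sym_tens ?N (gr ?c) H) + (\<Sum>l = 1..min n k. (1 / fact l) *\<^sub>C
      W (?N - 2 * l) (contract_level q n k l (gr ?c \<otimes>\<^sub>G H))) =
      (\<Sum>l = 0..min n k. \<Sum>\<pi> | \<pi> \<in> P12_bip n k \<and> card (pairs \<pi>) = l. summand \<pi>)"
    by (simp only: level sum.atLeast_Suc_atMost[of 0 "min n k"] le0 One_nat_def)
  also have "\<dots> = (\<Sum>\<pi>\<in>P12_bip n k. summand \<pi>)"
    using card_pairs_P12_bip by (intro sum.group finite) auto
  finally have levels: "W ?N (sym_tens ?N (gr ?c) H) + (\<Sum>l = 1..min n k. (1 / fact l) *\<^sub>C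
      W (?N - 2 * l) (contract_level q n k l (gr ?c \<otimes>\<^sub>G H))) = (\<Sum>\<pi>\<in>P12_bip n k. summand \<pi>)" .
  have sym: "W (?N - 2 * card (pairs \<pi>)) (sym_tens (?N - 2 * card (pairs \<pi>))
      (contract_alg q ?N \<pi> (gr ?c)) (contract_tensor ?N \<pi> H)) = summand \<pi>" if \<pi>: "\<pi> \<in> P12_bip n k" for \<pi>
  proof -
    note \<pi>' = P12_bip_P12[OF \<pi>]
    show ?thesis
      using W_symmetrize[OF relabel_residual_S0[OF \<pi>' c]]
      unfolding summand_def C_def contract_single[OF \<pi>'] contract_alg_gr contract_perm_matching[OF \<pi>' c]
        sym_tens_def gtens_single gtens_gr by blast
  qed
  show ?thesis
    using product wick_sum levels sym by (simp add: H_def)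
qed

end
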